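(* Let $(X,\Sigma,\nu)$ be a plain triple and $\lambda,\mu>0$, and let $\widehat\gamma$ be the drift of the random walk $(X,\nu)$. Assume $\lambda\widehat\gamma<\mu$. Then the Twisted Traffic Equations associated with $(X,\Sigma,\nu,\lambda,\mu)$ have a unique admissible solution. In particular, there is exactly one $r\in\mathcal B$ for which there exists $\rho\in\mathbb R_+^*$ with $p_{\rho,r}Q_r=0$, where $Q_r$ is the generator of the 0-automatic queue of type $(X,\Sigma,\nu,r,\lambda,\mu)$ and $p_{\rho,r}(1_{\Sigma^*})=1$, $p_{\rho,r}(a_n\cdots a_1)=\rho^n\frac{r(a_n)}{r(\mathrm{Next}(a_n))}\cdots\frac{r(a_2)}{r(\mathrm{Next}(a_2))}r(a_1)$ for $a_n\cdots a_1\in L(X,\Sigma)$, $n\ge1$.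
   Context: Let $X$ be a monoid with product $\ast$ and unit $1_X$. $\Sigma^*$ denotes the free monoid of words over a finite set $\Sigma$, with empty word $1_{\Sigma^*}$. For a generating set $\Sigma$ of $X$, $|x|_\Sigma$ is the least $k$ with $x=a_1\ast\cdots\ast a_k$, $a_i\in\Sigma$. A plain monoid is a free product $X=S^*\star\mathbb F(T)\star X_1\star\cdots\star X_k$, where $S,T$ are finite sets, $S^*$ is the free monoid on $S$, $\mathbb F(T)$ is the free group on $T$ and $X_1,\dots,X_k$ are finite monoids; its natural generating set is $\Sigma=S\sqcup T\sqcup T^{-1}\sqcup(X_1\setminus\{1_{X_1}\})\sqcup\cdots\sqcup(X_k\setminus\{1_{X_k}\})$. Put $L(X,\Sigma)=\{u_1\cdots u_k\in\Sigma^*:\ u_i\ast u_{i+1}\notin\Sigma\cup\{1_X\}\text{ for all }i<k\}$. For $a\in\Sigma$ let $\mathrm{Next}(a)=\{b\in\Sigma: a\ast b\notin\Sigma\cup\{1_X\}\}$ (which equals $\{b: b\ast a\notin\Sigma\cup\{1_X\}\}$). For $x\in\mathbb R^\Sigma$ and $E\subset\Sigma$, $x(E)=\sum_{a\in E}x(a)$. Let $\mathcal B=\{x\in\mathbb R^\Sigma: x(a)>0\ \forall a,\ \sum_a x(a)=1\}$ and $\bar{\mathcal B}$ the analogous set with $x(a)\ge 0$. A plain triple $(X,\Sigma,\nu)$ consists of an infinite plain monoid $X$ not isomorphic to $\mathbb Z$ nor to $\mathbb Z/2\mathbb Z\star\mathbb Z/2\mathbb Z$, its natural generating set $\Sigma$,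 and a probability measure $\nu$ on $\Sigma$ whose support generates $X$. Random walk and drift: with $x_0,x_1,\dots$ i.i.d. of law $\nu$ and $X_n=x_0\ast\cdots\ast x_{n-1}$, the drift is the deterministic a.s. limit $\widehat\gamma=\lim_n |X_n|_\Sigma/n$. The 0-automatic queue of type $(X,\Sigma,\nu,r,\lambda,\mu)$ ($r\in\bar{\mathcal B}$, $\lambda,\mu>0$) is the continuous-time Markov jump process on $L(X,\Sigma)$ with generator $Q_r$ defined as follows. A word $u=u_n\cdots u_1$ represents the buffer, $u_1$ being the front customer and $u_n$ the back customer. For $n\ge 1$ and $v\ne u$, $Q_r(u,v)$ is the sum of the following contributions to the target $v$: for each $b\in\mathrm{Next}(u_n)$, $\lambda\nu(b)$ to $v=bu_n\cdots u_1$; for each $b\in\Sigma$ with $b\ast u_n=c\in\Sigma$, $c\ne u_n$, $\lambda\nu(b)$ to $v=cu_{n-1}\cdots u_1$; for each $b\in\Sigma$ with $b\ast u_n=1_X$, $\lambda\nu(b)$ to $v=u_{n-1}\cdots u_1$; and $\mu$ (service) to $v=u_n\cdots u_2$ (which is $1_{\Sigma^*}$ if $n=1$). From the empty word, $Q_r(1_{\Sigma^*},a)=\lambda\nu(a)\,r(\mathrm{Next}(a))$ for $a\in\Sigma$. All other off-diagonal entries are $0$, and diagonal entries make row sums zero. Twisted Traffic Equations associated with $(X,\Sigma,\nu,\lambda,\mu)$ (in $\eta\in\mathbb R_+^*$, $x\in\mathbb R_+^\Sigma$): for all $a\in\Sigma$, $\eta(\lambda+\mu)x(a)=\eta^2\mu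 x(a)+\lambda\nu(a)x(\mathrm{Next}(a))+\eta\lambda\sum_{(b,d)\in\Sigma^2:\ b\ast d=a}\nu(b)x(d)+\eta^2\lambda\sum_{(b,d)\in\Sigma^2:\ d\in\mathrm{Next}(a),\ b\ast d=1_X}\nu(b)\frac{x(d)}{x(\mathrm{Next}(d))}x(a)$. With $A(x)=\sum_{a\in\Sigma}\nu(a)x(\mathrm{Next}(a))$ and $C(x)=\sum_{(a,b)\in\Sigma^2:\ a\ast b=1_X}\nu(a)x(b)$, an admissible solution of the Twisted Traffic Equations is a solution $(\eta,x)=(\rho,r)$ with $\rho\in\mathbb R_+^*$, $r\in\mathcal B$ and $\rho=\lambda A(r)/(\mu+\lambda C(r))$. *)

theory Defs
  imports "HOL-Probability.Probability" "HOL-Algebra.Elementary_Groups"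
begin

section \<open>Free products of monoids\<close>

text \<open>
  The free product of a family \<open>G\<close> of monoids, realised on reduced words: lists of pairs
  \<open>(i, g)\<close> with \<open>g\<close> a non-unit element of \<open>G i\<close> and neighbouring indices distinct.
  The universal property is \<open>free_product_lift\<close> below.
\<close>

fun fp_cons :: "('i \<Rightarrow> 'a monoid) \<Rightarrow> 'i \<times> 'a \<Rightarrow> ('i \<times> 'a) list \<Rightarrow> ('i \<times> 'a) list" where
  "fp_cons G (i, g) [] = (if g = \<one>\<^bsub>G i\<^esub> then [] else [(i, g)])"
| "fp_cons G (i, g) ((j, h) # w) =
     (if g = \<one>\<^bsub>G i\<^esub> then (j, h) # w
      else if i = j then
        (if g \<otimes>\<^bsub>G i\<^esub> h = \<one>\<^bsub>G i\<^esub> then w else (i, g \<otimes>\<^bsub>G i\<^esub> h) # w)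
      else (i, g) # (j, h) # w)"

definition free_product :: "'i set \<Rightarrow> ('i \<Rightarrow> 'a monoid) \<Rightarrow> ('i \<times> 'a) list monoid" where
  "free_product I G =
     \<lparr>carrier = {w. (\<forall>(i, g) \<in> set w. i \<in> I \<and> g \<in> carrier (G i) \<and> g \<noteq> \<one>\<^bsub>G i\<^esub>)
                    \<and> successively (\<lambda>x y. fst x \<noteq> fst y) w},
      mult = (\<lambda>u v. foldr (fp_cons G) u v),
      one = []\<rparr>"

definition fp_incl :: "('i \<Rightarrow> 'a monoid) \<Rightarrow> 'i \<Rightarrow> 'a \<Rightarrow> ('i \<times> 'a) list" where
  "fp_incl G i g = (if g = \<one>\<^bsub>G i\<^esub> then [] else [(i, g)])"

definition fp_lift :: "('b, 'c) monoid_scheme \<Rightarrow> ('i \<Rightarrow> 'a \<Rightarrow> 'b) \<Rightarrow> ('i \<times> 'a) list \<Rightarrow> 'b" where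
  "fp_lift H f w = foldr (\<lambda>(i, g) y. f i g \<otimes>\<^bsub>H\<^esub> y) w \<one>\<^bsub>H\<^esub>"

lemma fp_carrier_Nil [simp]: "[] \<in> carrier (free_product I G)"
  by (simp add: free_product_def)

lemma fp_carrier_Cons: "(i, g) # w \<in> carrier (free_product I G) \<longleftrightarrow>
   i \<in> I \<and> g \<in> carrier (G i) \<and> g \<noteq> \<one>\<^bsub>G i\<^esub> \<and> w \<in> carrier (free_product I G)
   \<and> (w = [] \<or> fst (hd w) \<noteq> i)"
  by (cases w) (auto simp: free_product_def)

lemma fp_mult: "u \<otimes>\<^bsub>free_product I G\<^esub> v = foldr (fp_cons G) u v"
  by (simp add: free_product_def)

lemma fp_one: "\<one>\<^bsub>free_product I G\<^esub> = []"
  by (simp add: free_product_def)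

lemma fp_cons_closed:
  assumes "\<And>i. i \<in> I \<Longrightarrow> Group.monoid (G i)" "i \<in> I" "g \<in> carrier (G i)"
    and "w \<in> carrier (free_product I G)"
  shows "fp_cons G (i, g) w \<in> carrier (free_product I G)"
proof (cases w)
  case Nil
  then show ?thesis using assms by (auto simp: fp_carrier_Cons)
next
  case (Cons x w')
  obtain j h where "x = (j, h)" by (cases x)
  then show ?thesis using assms Cons monoid.m_closed[OF assms(1)[OF assms(2)]]
    by (auto simp: fp_carrier_Cons)
qed

lemma fp_cons_one: "fp_cons G (i, \<one>\<^bsub>G i\<^esub>) w = w"
  by (cases w) auto

lemma fp_cons_mult:
  assumes "\<And>i. i \<in> I \<Longrightarrow> Group.monoid (G i)" "i \<in> I" "g \<in> carrier (G i)" "h \<in> carrier (G i)"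
    and "w \<in> carrier (free_product I G)"
  shows "fp_cons G (i, g) (fp_cons G (i, h) w) = fp_cons G (i, g \<otimes>\<^bsub>G i\<^esub> h) w"
proof -
  interpret Gi: Group.monoid "G i" using assms by blast
  show ?thesis
  proof (cases w)
    case Nil
    then show ?thesis using assms by auto
  next
    case (Cons x w')
    obtain j k where x: "x = (j, k)" by (cases x)
    show ?thesis
    proof (cases "j = i")
      case False
      then show ?thesis using assms Cons x by auto
    next
      case True
      then have w': "w' \<in> carrier (free_product I G)" "w' = [] \<or> fst (hd w') \<noteq> i"
        and k: "k \<in> carrier (G i)" "k \<noteq> \<one>\<^bsub>G i\<^esub>"
        using assms(5) Cons x by (auto simp: fp_carrier_Cons)
      have aux: "fp_cons G (i, y) w' = (if y = \<one>\<^bsub>G i\<^esub> then w' else (i, y) # w')" for y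
        using w'(2) by (cases w') auto
      have aux2: "fp_cons G (i, y) ((i, k) # w') = fp_cons G (i, y \<otimes>\<^bsub>G i\<^esub> k) w'"
        if "y \<in> carrier (G i)" for y
        using aux k that by auto
      show ?thesis
      proof (cases "h \<otimes>\<^bsub>G i\<^esub> k = \<one>\<^bsub>G i\<^esub>")
        case hk: True
        then have "g \<otimes>\<^bsub>G i\<^esub> h \<otimes>\<^bsub>G i\<^esub> k = g" using assms k by (simp add: Gi.m_assoc)
        then show ?thesis using assms k aux aux2 Cons x True hk by simp
      next
        case hk: False
        then show ?thesis using assms k aux aux2 Cons x True
          by (simp add: Gi.m_assoc)
      qed
    qed
  qed
qed

lemma fp_foldr_closed:
  assumes "\<And>i. i \<in> I \<Longrightarrow> Group.monoid (G i)"
    and "u \<in> carrier (free_product I G)" "v \<in> carrier (free_product I G)"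
  shows "foldr (fp_cons G) u v \<in> carrier (free_product I G)"
  using assms(2)
proof (induction u)
  case (Cons x u)
  obtain i g where "x = (i, g)" by (cases x)
  then show ?case using Cons fp_cons_closed[OF assms(1)] by (auto simp: fp_carrier_Cons)
qed (use assms in simp)

lemma fp_foldr_cons:
  assumes G: "\<And>i. i \<in> I \<Longrightarrow> Group.monoid (G i)" and i: "i \<in> I" "g \<in> carrier (G i)"
    and u: "u \<in> carrier (free_product I G)" and v: "v \<in> carrier (free_product I G)"
  shows "foldr (fp_cons G) (fp_cons G (i, g) u) v = fp_cons G (i, g) (foldr (fp_cons G) u v)"
proof (cases u)
  case Nil
  then show ?thesis by (auto simp: fp_cons_one)
next
  case (Cons x u')
  obtain j h where x: "x = (j, h)" by (cases x)
  have u': "u' \<in> carrier (free_product I G)" and h: "j \<in> I" "h \<in> carrier (G j)"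
    using u Cons x by (auto simp: fp_carrier_Cons)
  have cl: "foldr (fp_cons G) u' v \<in> carrier (free_product I G)"
    using fp_foldr_closed[OF G u' v] .
  show ?thesis
  proof (cases "i = j")
    case False
    then show ?thesis using Cons x by (auto simp: fp_cons_one)
  next
    case True
    have m: "fp_cons G (i, g) (fp_cons G (i, h) (foldr (fp_cons G) u' v))
        = fp_cons G (i, g \<otimes>\<^bsub>G i\<^esub> h) (foldr (fp_cons G) u' v)"
      using fp_cons_mult[OF G i _ cl] h True by simp
    then show ?thesis using Cons x True by (auto simp: fp_cons_one)
  qed
qed

lemma monoid_free_product:
  assumes G: "\<And>i. i \<in> I \<Longrightarrow> Group.monoid (G i)"
  shows "Group.monoid (free_product I G)"
proof (rule monoidI)
  have r: "foldr (fp_cons G) u [] = u" if "u \<in> carrier (free_product I G)" for u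
    using that
  proof (induction u)
    case (Cons x u)
    obtain i g where x: "x = (i, g)" by (cases x)
    show ?case using Cons x by (cases u) (auto simp: fp_carrier_Cons)
  qed simp
  fix u v w
  assume u: "u \<in> carrier (free_product I G)"
  show "u \<otimes>\<^bsub>free_product I G\<^esub> \<one>\<^bsub>free_product I G\<^esub> = u"
    using r[OF u] by (simp add: fp_mult fp_one)
  assume v: "v \<in> carrier (free_product I G)"
  show "u \<otimes>\<^bsub>free_product I G\<^esub> v \<in> carrier (free_product I G)"
    using fp_foldr_closed[OF G u v] by (simp add: fp_mult)
  assume w: "w \<in> carrier (free_product I G)"
  have "foldr (fp_cons G) (foldr (fp_cons G) u v) w = foldr (fp_cons G) u (foldr (fp_cons G) v w)"
    using u
  proof (induction u)
    case (Cons x u)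
    obtain i g where x: "x = (i, g)" by (cases x)
    then have *: "i \<in> I" "g \<in> carrier (G i)" "u \<in> carrier (free_product I G)"
      using Cons.prems by (auto simp: fp_carrier_Cons)
    show ?case
      using fp_foldr_cons[OF G *(1,2) fp_foldr_closed[OF G *(3) v] w] Cons.IH[OF *(3)] x by simp
  qed simp
  then show "(u \<otimes>\<^bsub>free_product I G\<^esub> v) \<otimes>\<^bsub>free_product I G\<^esub> w =
      u \<otimes>\<^bsub>free_product I G\<^esub> (v \<otimes>\<^bsub>free_product I G\<^esub> w)"
    by (simp add: fp_mult)
qed (auto simp: fp_one fp_mult)

lemma fp_incl_hom:
  assumes "Group.monoid (G i)" "i \<in> I"
  shows "fp_incl G i \<in> hom (G i) (free_product I G)"
proof -
  interpret Group.monoid "G i" by fact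
  show ?thesis
    using assms(2) by (auto simp: hom_def fp_incl_def fp_mult fp_carrier_Cons)
qed

lemma fp_lift_closed:
  assumes "Group.monoid H" "\<And>i. i \<in> I \<Longrightarrow> f i \<in> hom (G i) H"
    and "w \<in> carrier (free_product I G)"
  shows "fp_lift H f w \<in> carrier H"
  using assms(3)
proof (induction w)
  case Nil
  then show ?case using assms(1) by (simp add: fp_lift_def monoid.one_closed)
next
  case (Cons x w)
  obtain i g where x: "x = (i, g)" by (cases x)
  then have *: "i \<in> I" "g \<in> carrier (G i)" "w \<in> carrier (free_product I G)"
    using Cons.prems by (auto simp: fp_carrier_Cons)
  have "f i g \<in> carrier H" using assms(2)[OF *(1)] *(2) by (auto simp: hom_def)
  then show ?case using monoid.m_closed[OF assms(1)] Cons.IH[OF *(3)] x by (simp add: fp_lift_def)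
qed

theorem free_product_lift:
  assumes G: "\<And>i. i \<in> I \<Longrightarrow> Group.monoid (G i)" and H: "Group.monoid H"
    and f: "\<And>i. i \<in> I \<Longrightarrow> f i \<in> hom (G i) H" "\<And>i. i \<in> I \<Longrightarrow> f i \<one>\<^bsub>G i\<^esub> = \<one>\<^bsub>H\<^esub>"
  shows "fp_lift H f \<in> hom (free_product I G) H"
    and "fp_lift H f \<one>\<^bsub>free_product I G\<^esub> = \<one>\<^bsub>H\<^esub>"
    and "\<And>i g. i \<in> I \<Longrightarrow> g \<in> carrier (G i) \<Longrightarrow> fp_lift H f (fp_incl G i g) = f i g"
    and "\<And>\<phi> w. \<phi> \<in> hom (free_product I G) H \<Longrightarrow> \<phi> \<one>\<^bsub>free_product I G\<^esub> = \<one>\<^bsub>H\<^esub> \<Longrightarrow>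
           (\<And>i g. i \<in> I \<Longrightarrow> g \<in> carrier (G i) \<Longrightarrow> \<phi> (fp_incl G i g) = f i g) \<Longrightarrow>
           w \<in> carrier (free_product I G) \<Longrightarrow> \<phi> w = fp_lift H f w"
proof -
  interpret H: Group.monoid H by fact
  interpret P: Group.monoid "free_product I G" using monoid_free_product[OF G] .
  have fc: "f i g \<in> carrier H" if "i \<in> I" "g \<in> carrier (G i)" for i g
    using f(1)[OF that(1)] that(2) by (auto simp: hom_def)
  have fm: "f i (g \<otimes>\<^bsub>G i\<^esub> h) = f i g \<otimes>\<^bsub>H\<^esub> f i h"
    if "i \<in> I" "g \<in> carrier (G i)" "h \<in> carrier (G i)" for i g h
    using f(1)[OF that(1)] that(2,3) by (auto simp: hom_def)
  have lc: "fp_lift H f w \<in> carrier H" if "w \<in> carrier (free_product I G)" for w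
    by (rule fp_lift_closed[of H I f G, OF H f(1) that])
  have cons: "fp_lift H f (fp_cons G (i, g) w) = f i g \<otimes>\<^bsub>H\<^esub> fp_lift H f w"
    if i: "i \<in> I" "g \<in> carrier (G i)" and w: "w \<in> carrier (free_product I G)" for i g w
  proof (cases w)
    case Nil
    then show ?thesis using i f(2) fc by (auto simp: fp_lift_def)
  next
    case (Cons x w')
    obtain j h where x: "x = (j, h)" by (cases x)
    have *: "j \<in> I" "h \<in> carrier (G j)" "w' \<in> carrier (free_product I G)"
      using w Cons x by (auto simp: fp_carrier_Cons)
    have split: "fp_lift H f w = f j h \<otimes>\<^bsub>H\<^esub> fp_lift H f w'"
      using Cons x by (simp add: fp_lift_def)
    have cs: "fp_lift H f ((l, y) # w'') = f l y \<otimes>\<^bsub>H\<^esub> fp_lift H f w''" for l y w''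
      by (simp add: fp_lift_def)
    have lw: "fp_lift H f w \<in> carrier H" using lc[OF w] .
    show ?thesis
    proof (cases "g = \<one>\<^bsub>G i\<^esub>")
      case True
      then show ?thesis using f(2)[OF i(1)] lw by (simp add: fp_cons_one)
    next
      case g: False
      show ?thesis
      proof (cases "i = j")
        case True
        have a: "f i g \<otimes>\<^bsub>H\<^esub> fp_lift H f w = f i (g \<otimes>\<^bsub>G i\<^esub> h) \<otimes>\<^bsub>H\<^esub> fp_lift H f w'"
          using split fm[OF i(1,2)] * True fc i lc by (simp add: H.m_assoc)
        show ?thesis
          using a f(2)[OF i(1)] lc[OF *(3)] g True Cons x by (simp add: cs)
      next
        case False
        then show ?thesis using g Cons x by (simp add: cs)
      qed
    qed
  qed
  show "fp_lift H f \<in> hom (free_product I G) H"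
  proof (rule homI)
    fix u assume "u \<in> carrier (free_product I G)"
    then show "fp_lift H f u \<in> carrier H" by (rule lc)
  next
    fix u v assume u: "u \<in> carrier (free_product I G)" and v: "v \<in> carrier (free_product I G)"
    from u show "fp_lift H f (u \<otimes>\<^bsub>free_product I G\<^esub> v) = fp_lift H f u \<otimes>\<^bsub>H\<^esub> fp_lift H f v"
    proof (induction u)
      case Nil
      then show ?case using lc[OF v] by (simp add: fp_mult) (simp add: fp_lift_def)
    next
      case (Cons x u)
      obtain i g where x: "x = (i, g)" by (cases x)
      then have *: "i \<in> I" "g \<in> carrier (G i)" "u \<in> carrier (free_product I G)"
        using Cons.prems by (auto simp: fp_carrier_Cons)
      have "fp_lift H f ((x # u) \<otimes>\<^bsub>free_product I G\<^esub> v)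
          = f i g \<otimes>\<^bsub>H\<^esub> fp_lift H f (u \<otimes>\<^bsub>free_product I G\<^esub> v)"
        using cons[OF *(1,2) P.m_closed[OF *(3) v]] x by (simp add: fp_mult)
      also have "\<dots> = f i g \<otimes>\<^bsub>H\<^esub> fp_lift H f u \<otimes>\<^bsub>H\<^esub> fp_lift H f v"
        using Cons.IH[OF *(3)] fc[OF *(1,2)] lc[OF *(3)] lc[OF v] by (simp add: H.m_assoc)
      finally show ?case using x by (simp add: fp_lift_def)
    qed
  qed
  show "fp_lift H f \<one>\<^bsub>free_product I G\<^esub> = \<one>\<^bsub>H\<^esub>"
    by (simp add: fp_lift_def fp_one)
  show "fp_lift H f (fp_incl G i g) = f i g" if "i \<in> I" "g \<in> carrier (G i)" for i g
    using that f(2) fc by (auto simp: fp_lift_def fp_incl_def)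
  show "\<phi> w = fp_lift H f w"
    if \<phi>: "\<phi> \<in> hom (free_product I G) H" "\<phi> \<one>\<^bsub>free_product I G\<^esub> = \<one>\<^bsub>H\<^esub>"
      "\<And>i g. i \<in> I \<Longrightarrow> g \<in> carrier (G i) \<Longrightarrow> \<phi> (fp_incl G i g) = f i g"
      and w: "w \<in> carrier (free_product I G)" for \<phi> w
    using w
  proof (induction w)
    case Nil
    then show ?case using \<phi>(2) by (simp add: fp_lift_def fp_one)
  next
    case (Cons x w)
    obtain i g where x: "x = (i, g)" by (cases x)
    then have *: "i \<in> I" "g \<in> carrier (G i)" "g \<noteq> \<one>\<^bsub>G i\<^esub>" "w \<in> carrier (free_product I G)"
      "w = [] \<or> fst (hd w) \<noteq> i"
      using Cons.prems by (auto simp: fp_carrier_Cons)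
    have inc: "fp_incl G i g \<in> carrier (free_product I G)"
      using * by (simp add: fp_incl_def fp_carrier_Cons)
    have "fp_cons G (i, g) w = (i, g) # w"
      using * by (cases w) auto
    then have "(i, g) # w = fp_incl G i g \<otimes>\<^bsub>free_product I G\<^esub> w"
      using * by (simp add: fp_incl_def fp_mult)
    then have "\<phi> (x # w) = \<phi> (fp_incl G i g) \<otimes>\<^bsub>H\<^esub> \<phi> w"
      using hom_mult[OF \<phi>(1) inc *(4)] x by simp
    then show ?case using \<phi>(3)[OF *(1,2)] Cons.IH[OF *(4)] x by (simp add: fp_lift_def)
  qed
qed


section \<open>Plain monoids\<close>

definition free_monoid :: "'s set \<Rightarrow> 's list monoid" where
  "free_monoid S = \<lparr>carrier = lists S, mult = (@), one = []\<rparr>"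

text \<open>
  The free group on \<open>T\<close> as reduced words; \<open>(t, True)\<close> stands for the generator \<open>t\<close> and
  \<open>(t, False)\<close> for its inverse.
\<close>

fun fg_cons :: "'t \<times> bool \<Rightarrow> ('t \<times> bool) list \<Rightarrow> ('t \<times> bool) list" where
  "fg_cons a [] = [a]"
| "fg_cons a (b # w) = (if fst a = fst b \<and> snd a \<noteq> snd b then w else a # b # w)"

definition free_group :: "'t set \<Rightarrow> ('t \<times> bool) list monoid" where
  "free_group T =
     \<lparr>carrier = {w \<in> lists (T \<times> UNIV). successively (\<lambda>a b. \<not> (fst a = fst b \<and> snd a \<noteq> snd b)) w},
      mult = (\<lambda>u v. foldr fg_cons u v),
      one = []\<rparr>"

text \<open>
  \<open>free_product\<close> needs factors over one element type, so \<open>S\<^sup>*\<close>, \<open>\<bbbF>(T)\<close> and the \<open>X\<^sub>i\<close> are copied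
  into a common sum type.
\<close>

datatype ('s, 't, 'x) factor_elt =
  FreeMonElt "'s list" | FreeGrpElt "('t \<times> bool) list" | FinElt 'x

datatype factor_idx = FreeMonIdx | FreeGrpIdx | FinIdx nat

definition copy_monoid :: "('a \<Rightarrow> 'b) \<Rightarrow> 'a monoid \<Rightarrow> 'b monoid" where
  "copy_monoid f G =
     \<lparr>carrier = f ` carrier G,
      mult = (\<lambda>x y. f (inv_into (carrier G) f x \<otimes>\<^bsub>G\<^esub> inv_into (carrier G) f y)),
      one = f \<one>\<^bsub>G\<^esub>\<rparr>"

lemma copy_monoid_iso:
  assumes "inj f" "Group.monoid G"
  shows "f \<in> iso G (copy_monoid f G)"
  using assms monoid.m_closed[OF assms(2)]
  by (auto simp: iso_def hom_def bij_betw_def copy_monoid_def inv_into_f_f inj_on_subset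
      intro: inj_on_subset)

fun plain_factor ::
  "'s set \<Rightarrow> 't set \<Rightarrow> (nat \<Rightarrow> 'x monoid) \<Rightarrow> factor_idx \<Rightarrow> ('s, 't, 'x) factor_elt monoid" where
  "plain_factor S T M FreeMonIdx = copy_monoid FreeMonElt (free_monoid S)"
| "plain_factor S T M FreeGrpIdx = copy_monoid FreeGrpElt (free_group T)"
| "plain_factor S T M (FinIdx i) = copy_monoid FinElt (M i)"

type_synonym ('s, 't, 'x) plain_elt = "(factor_idx \<times> ('s, 't, 'x) factor_elt) list"

definition plain_monoid ::
  "'s set \<Rightarrow> 't set \<Rightarrow> nat \<Rightarrow> (nat \<Rightarrow> 'x monoid) \<Rightarrow> ('s, 't, 'x) plain_elt monoid" where
  "plain_monoid S T k M =
     free_product ({FreeMonIdx, FreeGrpIdx} \<union> FinIdx ` {1..k}) (plain_factor S T M)"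

definition plain_gens ::
  "'s set \<Rightarrow> 't set \<Rightarrow> nat \<Rightarrow> (nat \<Rightarrow> 'x monoid) \<Rightarrow> ('s, 't, 'x) plain_elt set" where
  "plain_gens S T k M =
     (let \<iota> = fp_incl (plain_factor S T M) in
       (\<lambda>s. \<iota> FreeMonIdx (FreeMonElt [s])) ` S
     \<union> (\<lambda>t. \<iota> FreeGrpIdx (FreeGrpElt [(t, True)])) ` T
     \<union> (\<lambda>t. \<iota> FreeGrpIdx (FreeGrpElt [(t, False)])) ` T
     \<union> (\<Union>i\<in>{1..k}. (\<lambda>x. \<iota> (FinIdx i) (FinElt x)) ` (carrier (M i) - {\<one>\<^bsub>M i\<^esub>})))"


section \<open>Plain triples, normal forms, drift\<close>

definition word_prod :: "('m, 'z) monoid_scheme \<Rightarrow> 'm list \<Rightarrow> 'm" where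
  "word_prod X w = foldr (mult X) w \<one>\<^bsub>X\<^esub>"

definition generates :: "('m, 'z) monoid_scheme \<Rightarrow> 'm set \<Rightarrow> bool" where
  "generates X A \<longleftrightarrow> word_prod X ` lists A = carrier X"

definition word_length :: "('m, 'z) monoid_scheme \<Rightarrow> 'm set \<Rightarrow> 'm \<Rightarrow> nat" where
  "word_length X \<Sigma> x = (LEAST k. \<exists>w\<in>lists \<Sigma>. length w = k \<and> word_prod X w = x)"

definition plain_triple ::
  "('s, 't, 'x) plain_elt monoid \<Rightarrow> ('s, 't, 'x) plain_elt set \<Rightarrow> ('s, 't, 'x) plain_elt pmf \<Rightarrow> bool"
where
  "plain_triple X \<Sigma> \<nu> \<longleftrightarrow>
     (\<exists>S T k M. finite S \<and> finite T
        \<and> (\<forall>i\<in>{1..k}. Group.monoid (M i) \<and> finite (carrier (M i)))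
        \<and> X = plain_monoid S T k M \<and> \<Sigma> = plain_gens S T k M)
     \<and> infinite (carrier X)
     \<and> \<not> X \<cong> integer_group
     \<and> \<not> X \<cong> free_product {1, 2::nat} (\<lambda>_. integer_mod_group 2)
     \<and> set_pmf \<nu> \<subseteq> \<Sigma> \<and> generates X (set_pmf \<nu>)"

text \<open>The i.i.d. steps are the coordinates of the product space.\<close>

definition is_drift :: "('m, 'z) monoid_scheme \<Rightarrow> 'm set \<Rightarrow> 'm pmf \<Rightarrow> real \<Rightarrow> bool" where
  "is_drift X \<Sigma> \<nu> \<gamma> \<longleftrightarrow>
     (AE x in (\<Pi>\<^sub>M i\<in>(UNIV :: nat set). measure_pmf \<nu>).
        (\<lambda>n. real (word_length X \<Sigma> (word_prod X (map x [0..<n]))) / real n) \<longlonglongrightarrow> \<gamma>)"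

text \<open>A word \<open>u\<^sub>1\<cdots>u\<^sub>k\<close> is the list \<open>[u\<^sub>1, \<dots>, u\<^sub>k]\<close>.\<close>

definition normal_words :: "('m, 'z) monoid_scheme \<Rightarrow> 'm set \<Rightarrow> 'm list set" where
  "normal_words X \<Sigma> = {u \<in> lists \<Sigma>. successively (\<lambda>a b. a \<otimes>\<^bsub>X\<^esub> b \<notin> \<Sigma> \<union> {\<one>\<^bsub>X\<^esub>}) u}"

definition Next :: "('m, 'z) monoid_scheme \<Rightarrow> 'm set \<Rightarrow> 'm \<Rightarrow> 'm set" where
  "Next X \<Sigma> a = {b \<in> \<Sigma>. a \<otimes>\<^bsub>X\<^esub> b \<notin> \<Sigma> \<union> {\<one>\<^bsub>X\<^esub>}}"

text \<open>Vectors indexed by \<open>\<Sigma>\<close> are extensional functions, so that equality means equality on \<open>\<Sigma>\<close>.\<close>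

definition simplex_int :: "'m set \<Rightarrow> ('m \<Rightarrow> real) set" where
  "simplex_int \<Sigma> = {x \<in> \<Sigma> \<rightarrow>\<^sub>E {0<..}. sum x \<Sigma> = 1}"


section \<open>The 0-automatic queue\<close>

text \<open>
  A buffer content \<open>u\<^sub>n\<cdots>u\<^sub>1\<close> is the list \<open>[u\<^sub>n, \<dots>, u\<^sub>1]\<close>: the head is the back customer and the
  last element is the front customer, served by \<open>butlast\<close>.
\<close>

fun queue_rate ::
  "('m, 'z) monoid_scheme \<Rightarrow> 'm set \<Rightarrow> 'm pmf \<Rightarrow> ('m \<Rightarrow> real) \<Rightarrow> real \<Rightarrow> real \<Rightarrow> 'm list \<Rightarrow> 'm list \<Rightarrow> real"
where
  "queue_rate X \<Sigma> \<nu> r lam \<mu> [] v =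
     (\<Sum>a\<in>\<Sigma>. if v = [a] then lam * pmf \<nu> a * sum r (Next X \<Sigma> a) else 0)"
| "queue_rate X \<Sigma> \<nu> r lam \<mu> (a # w) v =
     (\<Sum>b\<in>Next X \<Sigma> a. if v = b # a # w then lam * pmf \<nu> b else 0)
   + (\<Sum>b\<in>{b \<in> \<Sigma>. b \<otimes>\<^bsub>X\<^esub> a \<in> \<Sigma> \<and> b \<otimes>\<^bsub>X\<^esub> a \<noteq> a}.
        if v = (b \<otimes>\<^bsub>X\<^esub> a) # w then lam * pmf \<nu> b else 0)
   + (\<Sum>b\<in>{b \<in> \<Sigma>. b \<otimes>\<^bsub>X\<^esub> a = \<one>\<^bsub>X\<^esub>}. if v = w then lam * pmf \<nu> b else 0)
   + (if v = butlast (a # w) then \<mu> else 0)"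

definition queue_generator ::
  "('m, 'z) monoid_scheme \<Rightarrow> 'm set \<Rightarrow> 'm pmf \<Rightarrow> ('m \<Rightarrow> real) \<Rightarrow> real \<Rightarrow> real \<Rightarrow> 'm list \<Rightarrow> 'm list \<Rightarrow> real"
where
  "queue_generator X \<Sigma> \<nu> r lam \<mu> u v =
     (if v = u then - (\<Sum>\<^sub>\<infinity>v'\<in>normal_words X \<Sigma> - {u}. queue_rate X \<Sigma> \<nu> r lam \<mu> u v')
      else queue_rate X \<Sigma> \<nu> r lam \<mu> u v)"

text \<open>Only finitely many terms of each column sum of \<open>pQ\<close> are nonzero.\<close>

definition null_vector :: "'s set \<Rightarrow> ('s \<Rightarrow> real) \<Rightarrow> ('s \<Rightarrow> 's \<Rightarrow> real) \<Rightarrow> bool" where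
  "null_vector L p Q \<longleftrightarrow> (\<forall>v\<in>L. ((\<lambda>u. p u * Q u v) has_sum 0) L)"

definition product_form ::
  "('m, 'z) monoid_scheme \<Rightarrow> 'm set \<Rightarrow> real \<Rightarrow> ('m \<Rightarrow> real) \<Rightarrow> 'm list \<Rightarrow> real" where
  "product_form X \<Sigma> \<rho> r u =
     (if u = [] then 1
      else \<rho> ^ length u * prod_list (map (\<lambda>a. r a / sum r (Next X \<Sigma> a)) (butlast u)) * r (last u))"


section \<open>Twisted Traffic Equations\<close>

definition twisted_traffic ::
  "('m, 'z) monoid_scheme \<Rightarrow> 'm set \<Rightarrow> 'm pmf \<Rightarrow> real \<Rightarrow> real \<Rightarrow> real \<Rightarrow> ('m \<Rightarrow> real) \<Rightarrow> bool" where
  "twisted_traffic X \<Sigma> \<nu> lam \<mu> \<eta> x \<longleftrightarrow>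
     \<eta> > 0 \<and> x \<in> \<Sigma> \<rightarrow>\<^sub>E {0..} \<and>
     (\<forall>a\<in>\<Sigma>.
        \<eta> * (lam + \<mu>) * x a =
          \<eta>\<^sup>2 * \<mu> * x a
        + lam * pmf \<nu> a * sum x (Next X \<Sigma> a)
        + \<eta> * lam * (\<Sum>(b, d)\<in>{(b, d) \<in> \<Sigma> \<times> \<Sigma>. b \<otimes>\<^bsub>X\<^esub> d = a}. pmf \<nu> b * x d)
        + \<eta>\<^sup>2 * lam * (\<Sum>(b, d)\<in>{(b, d) \<in> \<Sigma> \<times> \<Sigma>. d \<in> Next X \<Sigma> a \<and> b \<otimes>\<^bsub>X\<^esub> d = \<one>\<^bsub>X\<^esub>}.
              pmf \<nu> b * (x d / sum x (Next X \<Sigma> d)) * x a))"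

definition traffic_A :: "('m, 'z) monoid_scheme \<Rightarrow> 'm set \<Rightarrow> 'm pmf \<Rightarrow> ('m \<Rightarrow> real) \<Rightarrow> real" where
  "traffic_A X \<Sigma> \<nu> x = (\<Sum>a\<in>\<Sigma>. pmf \<nu> a * sum x (Next X \<Sigma> a))"

definition traffic_C :: "('m, 'z) monoid_scheme \<Rightarrow> 'm set \<Rightarrow> 'm pmf \<Rightarrow> ('m \<Rightarrow> real) \<Rightarrow> real" where
  "traffic_C X \<Sigma> \<nu> x =
     (\<Sum>(a, b)\<in>{(a, b) \<in> \<Sigma> \<times> \<Sigma>. a \<otimes>\<^bsub>X\<^esub> b = \<one>\<^bsub>X\<^esub>}. pmf \<nu> a * x b)"

definition admissible_solution ::
  "('m, 'z) monoid_scheme \<Rightarrow> 'm set \<Rightarrow> 'm pmf \<Rightarrow> real \<Rightarrow> real \<Rightarrow> real \<Rightarrow> ('m \<Rightarrow> real) \<Rightarrow> bool" where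
  "admissible_solution X \<Sigma> \<nu> lam \<mu> \<rho> r \<longleftrightarrow>
     twisted_traffic X \<Sigma> \<nu> lam \<mu> \<rho> r \<and> \<rho> > 0 \<and> r \<in> simplex_int \<Sigma> \<and>
     \<rho> = lam * traffic_A X \<Sigma> \<nu> r / (\<mu> + lam * traffic_C X \<Sigma> \<nu> r)"

end

theory Submission
  imports Defs
begin

text \<open>
  Summing the Twisted Traffic Equations over \<open>a\<close> gives
  \<open>(\<eta> - 1) (\<eta> (\<mu> + \<lambda> C(x)) - \<lambda> A(x)) = 0\<close>. An admissible solution is therefore a fixed point of the
  map on the simplex obtained by inserting \<open>\<eta> = \<lambda> A(x) / (\<mu> + \<lambda> C(x))\<close>, and existence follows from
  Brouwer's theorem, whether or not the queue is stable. The map is discontinuous at the boundary, so it is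
  first perturbed towards the barycentre; irreducibility keeps the limit of the fixed points
  in the interior.

  For uniqueness, the product form of an admissible solution is compared with the expected occupation
  times of an excursion of the queue started from the arrivals into the empty word. When
  \<open>\<lambda> \<gamma> < \<mu>\<close>, a Foster-Lyapunov function shows that they have finite total mass, and then they
  coincide with the product form. Occupation times depend linearly and monotonically on the
  arrivals; the level sums \<open>\<rho>\<^sup>n\<close> then give equality of the loads, and irreducibility gives
  equality of the vectors.
\<close>

section \<open>Brouwer's theorem over a finite index set\<close>

text \<open>Away from the empty word the transition rates do not involve \<open>r\<close>; it enters
  the generator only through the rates out of the empty word. This makes the product forms of two
  candidates comparable: they satisfy balance equations with the same kernel and different sources.
  The traffic equation for \<open>a\<close> is the balance equation at the one-letter word
  \<open>[a]\<close>, longer words add no condition, and the prescribed value of \<rho> is the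
  balance at the empty word. Hence the null vectors of product form are exactly the admissible
  solutions. The word length is not a Lyapunov function, since its mean change in a single step
  depends on the back letter and need not be negative. The drift is therefore used only through one
  finite \<open>n\<close> at which \<open>lam\<close> times the mean length after \<open>n\<close>
  letters is below \<open>\<mu> * n\<close>; the Lyapunov function is built from this
  \<open>n\<close>. Irreducibility rests on the connectedness of the graph that \<open>Next\<close>
  defines on the letters. For an infinite plain monoid this graph is connected unless the monoid is
  the group of integers, where the generator and its inverse are two separate components.\<close>

lemma finite_cube_subseq:
  fixes x :: "nat \<Rightarrow> 'i \<Rightarrow> real"
  assumes "finite S" "\<And>n i. i \<in> S \<Longrightarrow> 0 \<le> x n i \<and> x n i \<le> 1"
  shows "\<exists>r l. strict_mono (r :: nat \<Rightarrow> nat) \<and> (\<forall>i\<in>S. (\<lambda>n. x (r n) i) \<longlonglongrightarrow> l i)"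
  using assms
proof (induction S rule: finite_induct)
  case empty
  show ?case by (rule exI[of _ id]) (simp add: strict_mono_def)
next
  case (insert j S)
  then obtain r l where r: "strict_mono (r :: nat \<Rightarrow> nat)" "\<And>i. i \<in> S \<Longrightarrow> (\<lambda>n. x (r n) i) \<longlonglongrightarrow> l i"
    by blast
  have "seq_compact {0..1::real}"
    by (simp add: compact_imp_seq_compact)
  moreover have "\<forall>n. x (r n) j \<in> {0..1}" using insert.prems by auto
  ultimately obtain m s where ms: "strict_mono (s :: nat \<Rightarrow> nat)" "((\<lambda>n. x (r n) j) \<circ> s) \<longlonglongrightarrow> m"
    using seq_compactE[of "{0..1::real}" "\<lambda>n. x (r n) j"] by metis
  have "(\<lambda>n. x ((r \<circ> s) n) i) \<longlonglongrightarrow> (l(j := m)) i" if "i \<in> insert j S" for i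
  proof (cases "i = j")
    case True
    then show ?thesis using ms by (simp add: o_def)
  next
    case False
    then show ?thesis using LIMSEQ_subseq_LIMSEQ[OF r(2) ms(1), of i] that by (simp add: o_def)
  qed
  then show ?case using strict_mono_o[OF r(1) ms(1)] by blast
qed

text \<open>The library's Brouwer theorem needs the dimension as a type, whereas here it is the
  cardinality of a set; its combinatorial core \<open>kuhn_lemma\<close> does not.\<close>

theorem brouwer_finite_cube:
  fixes f :: "('i \<Rightarrow> real) \<Rightarrow> 'i \<Rightarrow> real"
  assumes "finite S"
    and range: "\<And>x i. (\<And>i. i \<in> S \<Longrightarrow> 0 \<le> x i \<and> x i \<le> 1) \<Longrightarrow> i \<in> S \<Longrightarrow> 0 \<le> f x i \<and> f x i \<le> 1"
    and cont: "\<And>x y i. (\<And>n i. i \<in> S \<Longrightarrow> 0 \<le> x n i \<and> x n i \<le> 1) \<Longrightarrow>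
        (\<And>i. i \<in> S \<Longrightarrow> (\<lambda>n::nat. x n i) \<longlonglongrightarrow> y i) \<Longrightarrow> i \<in> S \<Longrightarrow> (\<lambda>n. f (x n) i) \<longlonglongrightarrow> f y i"
  shows "\<exists>x. (\<forall>i\<in>S. 0 \<le> x i \<and> x i \<le> 1) \<and> (\<forall>i\<in>S. f x i = x i)"
proof -
  define N where "N = card S"
  obtain h where h: "bij_betw h S {..<N}"
    using \<open>finite S\<close> ex_bij_betw_finite_nat[of S] unfolding N_def atLeast0LessThan by blast
  have hlt: "h i < N" if "i \<in> S" for i using h that by (auto simp: bij_betw_def)
  \<comment> \<open>Grid points of mesh \<open>1 / p\<close>, with the coordinates renumbered by
    \<open>h\<close> for \<open>kuhn_lemma\<close>.\<close>
  define pt :: "nat \<Rightarrow> (nat \<Rightarrow> nat) \<Rightarrow> 'i \<Rightarrow> real" where "pt p x = (\<lambda>i. real (x (h i)) / real p)" for p x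
  define g where "g = inv_into S h"
  have gh: "g (h i) = i" if "i \<in> S" for i
    using h that unfolding g_def by (simp add: bij_betw_def inv_into_f_f)
  have gS: "g j \<in> S" "h (g j) = j" if "j < N" for j
    using h that unfolding g_def bij_betw_def by (auto simp: inv_into_into f_inv_into_f)
  \<comment> \<open>Label 0 means that \<open>f\<close> does not decrease the coordinate, label 1
    that it does not increase it. On the faces Kuhn's lemma forces the label; it keeps this meaning
    there because \<open>f\<close> maps the cube into itself.\<close>
  define label where "label p x j = (if x j = p then 1 else if x j = 0 then 0
      else if f (pt p x) (g j) \<ge> pt p x (g j) then 0 else 1 :: nat)" for p x j
  have pt01: "0 \<le> pt p x i \<and> pt p x i \<le> 1" if "0 < p" "\<forall>j<N. x j \<le> p" "i \<in> S" for p x i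
    using that hlt[OF that(3)] by (auto simp: pt_def divide_le_eq_1)
  have lab0: "f (pt p x) i \<ge> pt p x i" if "0 < p" "\<forall>j<N. x j \<le> p" "i \<in> S" "label p x (h i) = 0" for p x i
    using that range[OF pt01[OF that(1,2)] that(3)] hlt[OF that(3)]
    by (auto simp: label_def gh split: if_splits) (simp add: pt_def)
  have lab1: "f (pt p x) i \<le> pt p x i" if "0 < p" "\<forall>j<N. x j \<le> p" "i \<in> S" "label p x (h i) \<noteq> 0" for p x i
    using that range[OF pt01[OF that(1,2)] that(3)] hlt[OF that(3)]
    by (auto simp: label_def gh split: if_splits) (simp add: pt_def)
  have "\<exists>q. (\<forall>j<N. q j < Suc p) \<and> (\<forall>j<N. \<exists>u v. (\<forall>l<N. q l \<le> u l \<and> u l \<le> q l + 1) \<and>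
      (\<forall>l<N. q l \<le> v l \<and> v l \<le> q l + 1) \<and> label (Suc p) u j \<noteq> label (Suc p) v j)" for p
  proof -
    have lab: "\<forall>x. (\<forall>i<N. x i \<le> Suc p) \<longrightarrow> (\<forall>i<N. label (Suc p) x i = 0 \<or> label (Suc p) x i = 1)"
      "\<forall>x. (\<forall>i<N. x i \<le> Suc p) \<longrightarrow> (\<forall>i<N. x i = 0 \<longrightarrow> label (Suc p) x i = 0)"
      "\<forall>x. (\<forall>i<N. x i \<le> Suc p) \<longrightarrow> (\<forall>i<N. x i = Suc p \<longrightarrow> label (Suc p) x i = 1)"
      by (auto simp: label_def)
    show ?thesis
      by (rule kuhn_lemma[OF _ lab]) (simp, blast)
  qed
  then have "\<exists>q. \<forall>p. (\<forall>j<N. q p j < Suc p) \<and> (\<forall>j<N. \<exists>u v. (\<forall>l<N. q p l \<le> u l \<and> u l \<le> q p l + 1) \<and>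
      (\<forall>l<N. q p l \<le> v l \<and> v l \<le> q p l + 1) \<and> label (Suc p) u j \<noteq> label (Suc p) v j)"
    by (intro choice allI)
  then obtain q where q: "\<And>p j. j < N \<Longrightarrow> q p j < Suc p"
    "\<And>p j. j < N \<Longrightarrow> \<exists>u v. (\<forall>l<N. q p l \<le> u l \<and> u l \<le> q p l + 1) \<and>
      (\<forall>l<N. q p l \<le> v l \<and> v l \<le> q p l + 1) \<and> label (Suc p) u j \<noteq> label (Suc p) v j"
    by blast
  have q01: "0 \<le> pt (Suc p) (q p) i \<and> pt (Suc p) (q p) i \<le> 1" if "i \<in> S" for p i
    using pt01[of "Suc p" "q p" i] q(1) that by (simp add: less_imp_le)
  obtain \<phi> y where \<phi>: "strict_mono (\<phi> :: nat \<Rightarrow> nat)"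
    "\<And>i. i \<in> S \<Longrightarrow> (\<lambda>n. pt (Suc (\<phi> n)) (q (\<phi> n)) i) \<longlonglongrightarrow> y i"
    using finite_cube_subseq[OF \<open>finite S\<close>, of "\<lambda>p. pt (Suc p) (q p)"] q01 by blast
  \<comment> \<open>All corners of the cell at \<open>q\<close> share the limit \<open>y\<close>,
    because the mesh tends to 0.\<close>
  have nearby: "(\<lambda>n. pt (Suc (\<phi> n)) (u n) i) \<longlonglongrightarrow> y i"
    if u: "\<And>n l. l < N \<Longrightarrow> q (\<phi> n) l \<le> u n l \<and> u n l \<le> q (\<phi> n) l + 1" and i: "i \<in> S" for u i
  proof -
    have "(\<lambda>n. inverse (real (Suc n))) \<longlonglongrightarrow> 0" by (rule LIMSEQ_inverse_real_of_nat)
    from LIMSEQ_subseq_LIMSEQ[OF this \<phi>(1)]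
    have "(\<lambda>n. inverse (real (Suc (\<phi> n)))) \<longlonglongrightarrow> 0" by (simp add: o_def)
    from tendsto_add[OF \<phi>(2)[OF i] this]
    have up: "(\<lambda>n. pt (Suc (\<phi> n)) (q (\<phi> n)) i + inverse (real (Suc (\<phi> n)))) \<longlonglongrightarrow> y i" by simp
    show ?thesis
    proof (rule real_tendsto_sandwich[OF _ _ \<phi>(2)[OF i] up]; intro always_eventually allI)
      fix n
      show "pt (Suc (\<phi> n)) (q (\<phi> n)) i \<le> pt (Suc (\<phi> n)) (u n) i"
        using u[OF hlt[OF i], of n] by (simp add: pt_def divide_right_mono)
      have "real (u n (h i)) \<le> real (q (\<phi> n) (h i)) + 1"
        using u[OF hlt[OF i], of n] by linarith
      then have "real (u n (h i)) / real (Suc (\<phi> n)) \<le> (real (q (\<phi> n) (h i)) + 1) / real (Suc (\<phi> n))"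
        by (intro divide_right_mono) auto
      then show "pt (Suc (\<phi> n)) (u n) i \<le> pt (Suc (\<phi> n)) (q (\<phi> n)) i + inverse (real (Suc (\<phi> n)))"
        by (simp only: pt_def add_divide_distrib inverse_eq_divide)
    qed
  qed
  have le: "\<forall>l<N. u l \<le> Suc p" if "\<forall>l<N. q p l \<le> u l \<and> u l \<le> q p l + 1" for u p
  proof (intro allI impI)
    fix l assume "l < N"
    then show "u l \<le> Suc p" using that q(1)[of l p] by fastforce
  qed
  \<comment> \<open>Each cell has corners with both labels for coordinate \<open>i\<close>. Both
    kinds of corners tend to \<open>y\<close>, so continuity gives the two inequalities.\<close>
  have fix_pt: "f y i = y i" if i: "i \<in> S" for i
  proof -
    have "\<exists>u v. (\<forall>l<N. q p l \<le> u l \<and> u l \<le> q p l + 1) \<and> (\<forall>l<N. q p l \<le> v l \<and> v l \<le> q p l + 1) \<and>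
        label (Suc p) u (h i) = 0 \<and> label (Suc p) v (h i) \<noteq> 0" for p
    proof -
      obtain u v where uv: "(\<forall>l<N. q p l \<le> u l \<and> u l \<le> q p l + 1)" "(\<forall>l<N. q p l \<le> v l \<and> v l \<le> q p l + 1)"
        "label (Suc p) u (h i) \<noteq> label (Suc p) v (h i)"
        using q(2)[OF hlt[OF i], of p] by blast
      have "(label (Suc p) u (h i) = 0 \<and> label (Suc p) v (h i) \<noteq> 0)
          \<or> (label (Suc p) v (h i) = 0 \<and> label (Suc p) u (h i) \<noteq> 0)"
        using uv(3) unfolding label_def by (auto split: if_splits)
      then show ?thesis using uv(1,2) by blast
    qed
    then have "\<exists>u. \<forall>p. \<exists>v. (\<forall>l<N. q p l \<le> u p l \<and> u p l \<le> q p l + 1) \<and> (\<forall>l<N. q p l \<le> v l \<and> v l \<le> q p l + 1) \<and>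
        label (Suc p) (u p) (h i) = 0 \<and> label (Suc p) v (h i) \<noteq> 0"
      by (intro choice allI)
    then obtain u where "\<forall>p. \<exists>v. (\<forall>l<N. q p l \<le> u p l \<and> u p l \<le> q p l + 1) \<and> (\<forall>l<N. q p l \<le> v l \<and> v l \<le> q p l + 1) \<and>
        label (Suc p) (u p) (h i) = 0 \<and> label (Suc p) v (h i) \<noteq> 0"
      by blast
    then have "\<exists>v. \<forall>p. (\<forall>l<N. q p l \<le> u p l \<and> u p l \<le> q p l + 1) \<and> (\<forall>l<N. q p l \<le> v p l \<and> v p l \<le> q p l + 1) \<and>
        label (Suc p) (u p) (h i) = 0 \<and> label (Suc p) (v p) (h i) \<noteq> 0"
      by (rule choice)
    then obtain v where
      u: "\<And>p. \<forall>l<N. q p l \<le> u p l \<and> u p l \<le> q p l + 1" "\<And>p. label (Suc p) (u p) (h i) = 0" and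
      v: "\<And>p. \<forall>l<N. q p l \<le> v p l \<and> v p l \<le> q p l + 1" "\<And>p. label (Suc p) (v p) (h i) \<noteq> 0"
      by blast
    have fl: "(\<lambda>n. f (pt (Suc (\<phi> n)) (w (\<phi> n))) i) \<longlonglongrightarrow> f y i"
      if "\<And>p. \<forall>l<N. q p l \<le> w p l \<and> w p l \<le> q p l + 1" for w
    proof (rule cont[OF _ _ i])
      show "0 \<le> pt (Suc (\<phi> n)) (w (\<phi> n)) i \<and> pt (Suc (\<phi> n)) (w (\<phi> n)) i \<le> 1" if "i \<in> S" for n i
        using pt01[OF _ le[OF \<open>\<And>p. \<forall>l<N. q p l \<le> w p l \<and> w p l \<le> q p l + 1\<close>] that] by simp
      show "(\<lambda>n. pt (Suc (\<phi> n)) (w (\<phi> n)) i) \<longlonglongrightarrow> y i" if "i \<in> S" for i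
        by (rule nearby) (use \<open>\<And>p. \<forall>l<N. q p l \<le> w p l \<and> w p l \<le> q p l + 1\<close> that in auto)
    qed
    have "(\<lambda>n. pt (Suc (\<phi> n)) (u (\<phi> n)) i) \<longlonglongrightarrow> y i" "(\<lambda>n. pt (Suc (\<phi> n)) (v (\<phi> n)) i) \<longlonglongrightarrow> y i"
      by (rule nearby; use u(1) v(1) i in blast)+
    then have "y i \<le> f y i" "f y i \<le> y i"
      using LIMSEQ_le[OF _ fl[OF u(1)]] LIMSEQ_le[OF fl[OF v(1)]]
        lab0[OF _ le[OF u(1)] i u(2)] lab1[OF _ le[OF v(1)] i v(2)] by blast+
    then show ?thesis by simp
  qed
  have "0 \<le> y i \<and> y i \<le> 1" if "i \<in> S" for i
    using LIMSEQ_le_const[OF \<phi>(2)[OF that]] LIMSEQ_le_const2[OF \<phi>(2)[OF that]] q01[OF that] by blast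
  then show ?thesis using fix_pt by blast
qed

section \<open>Traffic equations\<close>

text \<open>The properties of a plain triple on which the analysis rests. \<open>Next_mult\<close>
  allows the back letter \<open>d\<close> of a normal word to be replaced by its product with an
  arriving letter; \<open>irreducible\<close> says that positivity spreads to all letters through
  the pushing and the merging terms of the traffic equations.\<close>

locale zero_automatic =
  fixes X :: "'m monoid" and \<Sigma> :: "'m set" and \<nu> :: "'m pmf"
  assumes finite_gens: "finite \<Sigma>"
    and one_notin: "\<one>\<^bsub>X\<^esub> \<notin> \<Sigma>"
    and Next_commute: "\<lbrakk>a \<in> \<Sigma>; b \<in> Next X \<Sigma> a\<rbrakk> \<Longrightarrow> a \<in> Next X \<Sigma> b"
    and Next_mult: "\<lbrakk>a \<in> \<Sigma>; b \<in> \<Sigma>; a \<otimes>\<^bsub>X\<^esub> b \<in> \<Sigma>\<rbrakk> \<Longrightarrow> Next X \<Sigma> (a \<otimes>\<^bsub>X\<^esub> b) = Next X \<Sigma> b"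
    and Next_nonempty: "a \<in> \<Sigma> \<Longrightarrow> Next X \<Sigma> a \<noteq> {}"
    and supp: "set_pmf \<nu> \<subseteq> \<Sigma>"
    and irreducible: "\<lbrakk>Z \<subseteq> \<Sigma>; Z \<noteq> {};
        \<And>a b. \<lbrakk>a \<in> set_pmf \<nu>; b \<in> Next X \<Sigma> a; b \<in> Z\<rbrakk> \<Longrightarrow> a \<in> Z;
        \<And>b d. \<lbrakk>b \<in> set_pmf \<nu>; d \<in> Z; b \<otimes>\<^bsub>X\<^esub> d \<in> \<Sigma>\<rbrakk> \<Longrightarrow> b \<otimes>\<^bsub>X\<^esub> d \<in> Z\<rbrakk> \<Longrightarrow> Z = \<Sigma>"
begin

abbreviation prod_X (infixl \<open>\<cdot>\<close> 70) where "a \<cdot> b \<equiv> a \<otimes>\<^bsub>X\<^esub> b"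
abbreviation "N \<equiv> Next X \<Sigma>"
abbreviation "L \<equiv> normal_words X \<Sigma>"
abbreviation "\<AA> \<equiv> traffic_A X \<Sigma> \<nu>"
abbreviation "\<CC> \<equiv> traffic_C X \<Sigma> \<nu>"

lemma in_N_iff: "b \<in> N a \<longleftrightarrow> b \<in> \<Sigma> \<and> a \<cdot> b \<notin> \<Sigma> \<and> a \<cdot> b \<noteq> \<one>\<^bsub>X\<^esub>"
  by (auto simp: Next_def)

lemma N_sub: "N a \<subseteq> \<Sigma>" by (auto simp: Next_def)

lemma N_sym: "a \<in> \<Sigma> \<Longrightarrow> b \<in> \<Sigma> \<Longrightarrow> a \<in> N b \<longleftrightarrow> b \<in> N a"
  using Next_commute by blast

lemma finite_N [simp]: "finite (N a)"
  using finite_subset[OF N_sub finite_gens] .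

lemma sum_nu: "sum (pmf \<nu>) \<Sigma> = 1"
  using sum_pmf_eq_1[OF finite_gens supp] .

lemma gens_nonempty: "\<Sigma> \<noteq> {}"
  using supp set_pmf_not_empty[of \<nu>] by auto

definition swap_sum :: "('m \<Rightarrow> real) \<Rightarrow> 'm \<Rightarrow> real" where
  "swap_sum x a = (\<Sum>(b, d)\<in>{(b, d) \<in> \<Sigma> \<times> \<Sigma>. b \<cdot> d = a}. pmf \<nu> b * x d)"

text \<open>Up to a factor \<rho>, \<open>x d / sum x (N d)\<close> is the ratio of the product-form
  weights of \<open>d # a # w\<close> and \<open>a # w\<close>, so the sum collects the
  cancellations that uncover the back letter \<open>a\<close>.\<close>

definition pop_sum :: "('m \<Rightarrow> real) \<Rightarrow> 'm \<Rightarrow> real" where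
  "pop_sum x a = (\<Sum>(b, d)\<in>{(b, d) \<in> \<Sigma> \<times> \<Sigma>. d \<in> N a \<and> b \<cdot> d = \<one>\<^bsub>X\<^esub>}. pmf \<nu> b * (x d / sum x (N d)))"

lemma finite_pairs [simp]: "finite {(b, d). b \<in> \<Sigma> \<and> d \<in> \<Sigma> \<and> P b d}"
  by (rule finite_subset[of _ "\<Sigma> \<times> \<Sigma>"]) (auto simp: finite_gens)

lemma twisted_traffic_iff:
  "twisted_traffic X \<Sigma> \<nu> lam \<mu> \<eta> x \<longleftrightarrow> \<eta> > 0 \<and> x \<in> \<Sigma> \<rightarrow>\<^sub>E {0..} \<and>
     (\<forall>a\<in>\<Sigma>. \<eta> * (lam + \<mu>) * x a = \<eta>\<^sup>2 * \<mu> * x a + lam * pmf \<nu> a * sum x (N a)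
        + \<eta> * lam * swap_sum x a + \<eta>\<^sup>2 * lam * (pop_sum x a * x a))"
  by (simp add: twisted_traffic_def swap_sum_def pop_sum_def sum_distrib_right case_prod_beta)

lemma sum_swap_sum: "(\<Sum>a\<in>\<Sigma>. swap_sum x a) = (\<Sum>(b, d)\<in>{(b, d) \<in> \<Sigma> \<times> \<Sigma>. b \<cdot> d \<in> \<Sigma>}. pmf \<nu> b * x d)"
proof -
  have "{(b, d) \<in> \<Sigma> \<times> \<Sigma>. b \<cdot> d = a} = {p \<in> {(b, d) \<in> \<Sigma> \<times> \<Sigma>. b \<cdot> d \<in> \<Sigma>}. (case p of (b, d) \<Rightarrow> b \<cdot> d) = a}"
    if "a \<in> \<Sigma>" for a using that by auto
  then have "(\<Sum>a\<in>\<Sigma>. swap_sum x a) = (\<Sum>a\<in>\<Sigma>. \<Sum>p\<in>{p \<in> {(b, d) \<in> \<Sigma> \<times> \<Sigma>. b \<cdot> d \<in> \<Sigma>}. (case p of (b, d) \<Rightarrow> b \<cdot> d) = a}.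
      case p of (b, d) \<Rightarrow> pmf \<nu> b * x d)"
    by (simp add: swap_sum_def)
  also have "\<dots> = (\<Sum>(b, d)\<in>{(b, d) \<in> \<Sigma> \<times> \<Sigma>. b \<cdot> d \<in> \<Sigma>}. pmf \<nu> b * x d)"
    by (rule sum.group) (auto simp: finite_gens)
  finally show ?thesis .
qed

lemma traffic_A_pairs: "\<AA> x = (\<Sum>(b, d)\<in>{(b, d) \<in> \<Sigma> \<times> \<Sigma>. d \<in> N b}. pmf \<nu> b * x d)"
proof -
  have "{(b, d) \<in> \<Sigma> \<times> \<Sigma>. d \<in> N b} = (SIGMA b:\<Sigma>. N b)" using N_sub by auto
  then show ?thesis
    by (simp add: traffic_A_def sum_distrib_left sum.Sigma finite_gens)
qed

text \<open>An arriving letter and a back letter are either pushed, merged or cancelled, and all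
  pairs together have weight 1.\<close>

lemma traffic_balance:
  assumes "sum x \<Sigma> = 1"
  shows "\<AA> x + (\<Sum>a\<in>\<Sigma>. swap_sum x a) + \<CC> x = 1"
proof -
  have "1 = (\<Sum>(b, d)\<in>\<Sigma> \<times> \<Sigma>. pmf \<nu> b * x d)"
    using assms sum_nu by (simp add: sum.cartesian_product[symmetric] sum_product[symmetric])
  also have "\<Sigma> \<times> \<Sigma> = {(b, d) \<in> \<Sigma> \<times> \<Sigma>. d \<in> N b} \<union> {(b, d) \<in> \<Sigma> \<times> \<Sigma>. b \<cdot> d \<in> \<Sigma>} \<union> {(b, d) \<in> \<Sigma> \<times> \<Sigma>. b \<cdot> d = \<one>\<^bsub>X\<^esub>}"
    by (auto simp: in_N_iff)
  also have "(\<Sum>(b, d)\<in>\<dots>. pmf \<nu> b * x d) = \<AA> x + (\<Sum>a\<in>\<Sigma>. swap_sum x a) + \<CC> x"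
    unfolding traffic_A_pairs sum_swap_sum traffic_C_def
    by (subst sum.union_disjoint; (subst sum.union_disjoint)?) (auto simp: in_N_iff one_notin)
  finally show ?thesis by simp
qed

text \<open>By \<open>N_sym\<close> the letters \<open>a\<close> with \<open>d \<in> N a\<close> are
  those of \<open>N d\<close>, so summing \<open>x a\<close> over them cancels the
  denominator.\<close>

lemma sum_pop_sum:
  assumes "\<And>a. a \<in> \<Sigma> \<Longrightarrow> sum x (N a) \<noteq> 0"
  shows "(\<Sum>a\<in>\<Sigma>. pop_sum x a * x a) = \<CC> x"
proof -
  let ?P = "{(b, d) \<in> \<Sigma> \<times> \<Sigma>. b \<cdot> d = \<one>\<^bsub>X\<^esub>}"
  have "(\<Sum>a\<in>\<Sigma>. pop_sum x a * x a)
      = (\<Sum>a\<in>\<Sigma>. \<Sum>p\<in>{p. p \<in> ?P \<and> snd p \<in> N a}. pmf \<nu> (fst p) * (x (snd p) / sum x (N (snd p))) * x a)"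
    unfolding pop_sum_def sum_distrib_right
    by (intro sum.cong refl) (auto simp: case_prod_beta)
  also have "\<dots> = (\<Sum>p\<in>?P. \<Sum>a\<in>{a. a \<in> \<Sigma> \<and> snd p \<in> N a}. pmf \<nu> (fst p) * (x (snd p) / sum x (N (snd p))) * x a)"
    by (rule sum.swap_restrict) (auto simp: finite_gens)
  also have "\<dots> = (\<Sum>p\<in>?P. pmf \<nu> (fst p) * x (snd p))"
  proof (rule sum.cong[OF refl])
    fix p assume "p \<in> ?P"
    then have p: "snd p \<in> \<Sigma>" by auto
    then have "{a. a \<in> \<Sigma> \<and> snd p \<in> N a} = N (snd p)" using N_sub N_sym p by blast
    then show "(\<Sum>a\<in>{a. a \<in> \<Sigma> \<and> snd p \<in> N a}. pmf \<nu> (fst p) * (x (snd p) / sum x (N (snd p))) * x a)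
        = pmf \<nu> (fst p) * x (snd p)"
      using assms[OF p] by (simp only: sum_distrib_left[symmetric]) simp
  qed
  finally show ?thesis by (simp add: traffic_C_def case_prod_beta)
qed

lemma sum_N_pos: "(\<And>a. a \<in> \<Sigma> \<Longrightarrow> 0 < x a) \<Longrightarrow> a \<in> \<Sigma> \<Longrightarrow> 0 < sum (x :: 'm \<Rightarrow> real) (N a)"
  using Next_nonempty N_sub by (intro sum_pos) auto

lemma traffic_A_pos:
  assumes "\<And>a. a \<in> \<Sigma> \<Longrightarrow> 0 < x a"
  shows "0 < \<AA> x"
proof -
  obtain a where a: "a \<in> set_pmf \<nu>" using set_pmf_not_empty[of \<nu>] by blast
  then have "a \<in> \<Sigma>" using supp by blast
  moreover have "0 < pmf \<nu> a * sum x (N a)"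
    using a sum_N_pos[OF assms \<open>a \<in> \<Sigma>\<close>] by (simp add: pmf_positive)
  ultimately show ?thesis unfolding traffic_A_def
    using sum_N_pos[of x, OF assms] by (intro sum_pos2[OF finite_gens, of a]) (auto simp: less_imp_le)
qed

lemma traffic_C_nonneg: "(\<And>a. a \<in> \<Sigma> \<Longrightarrow> 0 \<le> x a) \<Longrightarrow> 0 \<le> \<CC> x"
  unfolding traffic_C_def by (intro sum_nonneg) auto

lemma swap_sum_nonneg: "(\<And>a. a \<in> \<Sigma> \<Longrightarrow> 0 \<le> x a) \<Longrightarrow> 0 \<le> swap_sum x a"
  unfolding swap_sum_def by (intro sum_nonneg) auto

lemma pop_sum_nonneg: "(\<And>a. a \<in> \<Sigma> \<Longrightarrow> 0 \<le> x a) \<Longrightarrow> 0 \<le> pop_sum x a"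
  unfolding pop_sum_def
  by (intro sum_nonneg) (auto intro!: mult_nonneg_nonneg divide_nonneg_nonneg sum_nonneg dest!: subsetD[OF N_sub])

end

section \<open>The fixed-point map and existence\<close>

locale zero_automatic_queue = zero_automatic X \<Sigma> \<nu>
  for X :: "'m monoid" and \<Sigma> :: "'m set" and \<nu> :: "'m pmf" +
  fixes lam \<mu> :: real
  assumes lam_pos: "0 < lam" and mu_pos: "0 < \<mu>"
begin

definition load :: "('m \<Rightarrow> real) \<Rightarrow> real" where
  "load x = lam * \<AA> x / (\<mu> + lam * \<CC> x)"

text \<open>The equation for \<open>a\<close> at \<open>\<eta> = load x\<close>, divided by
  \<open>\<eta>\<close> and solved for the \<open>x a\<close> with coefficient
  \<open>lam + \<mu> - \<eta> * \<mu>\<close>.\<close>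

definition traffic_map :: "('m \<Rightarrow> real) \<Rightarrow> 'm \<Rightarrow> real" where
  "traffic_map x a =
     (lam / load x * (pmf \<nu> a * sum x (N a)) + lam * swap_sum x a + load x * lam * (pop_sum x a * x a))
     / (lam + \<mu> - load x * \<mu>)"

context
  fixes x :: "'m \<Rightarrow> real"
  assumes pos: "\<And>a. a \<in> \<Sigma> \<Longrightarrow> 0 < x a" and sum1: "sum x \<Sigma> = 1"
begin

text \<open>\<open>traffic_balance\<close> gives \<open>\<AA> x \<le> 1\<close>, and
  \<open>\<CC> x\<close> is nonnegative. The denominator of \<open>traffic_map\<close> is thus at
  least \<open>\<mu>\<close> without any stability condition.\<close>

lemma load_bounds: "0 < load x" "load x * \<mu> \<le> lam" "0 < lam + \<mu> - load x * \<mu>"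
proof -
  note C = traffic_C_nonneg[of x, OF less_imp_le[OF pos]]
  note A = traffic_A_pos[of x, OF pos]
  have d: "0 < \<mu> + lam * \<CC> x" using C lam_pos mu_pos by (simp add: add_pos_nonneg)
  show "0 < load x" unfolding load_def using A lam_pos d by simp
  have "0 \<le> (\<Sum>a\<in>\<Sigma>. swap_sum x a)" using swap_sum_nonneg[of x] pos by (intro sum_nonneg) (auto intro: less_imp_le)
  then have "\<AA> x \<le> 1" using traffic_balance[OF sum1] C by linarith
  have "load x * \<mu> = lam * (\<AA> x * (\<mu> / (\<mu> + lam * \<CC> x)))" unfolding load_def by simp
  also have "\<dots> \<le> lam * (1 * 1)"
    using \<open>\<AA> x \<le> 1\<close> A C d lam_pos mu_pos by (intro mult_left_mono mult_mono) (auto simp: divide_le_eq_1)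
  finally show le: "load x * \<mu> \<le> lam" by simp
  show "0 < lam + \<mu> - load x * \<mu>" using le mu_pos by linarith
qed

lemma load_eq: "lam * \<AA> x = load x * (\<mu> + lam * \<CC> x)"
proof -
  have "0 < \<mu> + lam * \<CC> x"
    using traffic_C_nonneg[of x, OF less_imp_le[OF pos]] lam_pos mu_pos by (simp add: add_pos_nonneg)
  then show ?thesis by (simp add: load_def)
qed

text \<open>\<open>load_eq\<close> turns the pushing sum into \<open>\<mu> + lam * \<CC> x\<close>
  and \<open>traffic_balance\<close> eliminates the merging sum; the numerators then add up to the
  common denominator, so no separate normalisation is needed.\<close>

lemma sum_traffic_map: "sum (traffic_map x) \<Sigma> = 1"
proof -
  note b = load_bounds
  have pops: "(\<Sum>a\<in>\<Sigma>. pop_sum x a * x a) = \<CC> x"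
    by (rule sum_pop_sum) (use sum_N_pos[of x, OF pos] in force)
  have "(\<Sum>a\<in>\<Sigma>. lam / load x * (pmf \<nu> a * sum x (N a)) + lam * swap_sum x a + load x * lam * (pop_sum x a * x a))
      = lam / load x * \<AA> x + lam * (\<Sum>a\<in>\<Sigma>. swap_sum x a) + load x * lam * \<CC> x"
    by (simp only: sum.distrib sum_distrib_left[symmetric] traffic_A_def pops)
  also have "lam / load x * \<AA> x = \<mu> + lam * \<CC> x"
    using load_eq b(1) by (simp add: field_simps)
  also have "(\<Sum>a\<in>\<Sigma>. swap_sum x a) = 1 - \<AA> x - \<CC> x"
    using traffic_balance[OF sum1] by linarith
  also have "\<mu> + lam * \<CC> x + lam * (1 - \<AA> x - \<CC> x) + load x * lam * \<CC> x = lam + \<mu> - load x * \<mu>"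
    using load_eq by (simp add: algebra_simps)
  finally show ?thesis
    unfolding traffic_map_def sum_divide_distrib[symmetric] using b(3) by simp
qed

text \<open>A lower bound without quotients of \<open>x\<close>, hence continuous up to the boundary
  of the simplex. It survives the passage to the limit in \<open>admissible_solution_exists\<close>
  and there carries positivity from letter to letter.\<close>

lemma traffic_map_ge:
  assumes "a \<in> \<Sigma>"
  shows "(\<mu> * (pmf \<nu> a * sum x (N a)) + lam * swap_sum x a) / (lam + \<mu>) \<le> traffic_map x a"
proof -
  note b = load_bounds
  note s = sum_N_pos[of x, OF pos assms]
  have "\<mu> \<le> lam / load x" using b by (simp add: pos_le_divide_eq mult.commute)
  moreover have "0 \<le> pmf \<nu> a * sum x (N a)" using s by simp
  moreover have "0 \<le> load x * lam * (pop_sum x a * x a)"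
    using pop_sum_nonneg[of x a] pos assms b lam_pos by (simp add: less_imp_le)
  moreover have "0 \<le> lam * swap_sum x a" using swap_sum_nonneg[of x a] pos lam_pos by (simp add: less_imp_le)
  ultimately have "\<mu> * (pmf \<nu> a * sum x (N a)) + lam * swap_sum x a
      \<le> lam / load x * (pmf \<nu> a * sum x (N a)) + lam * swap_sum x a + load x * lam * (pop_sum x a * x a)"
    "0 \<le> \<mu> * (pmf \<nu> a * sum x (N a)) + lam * swap_sum x a"
    using mult_right_mono[of \<mu> "lam / load x" "pmf \<nu> a * sum x (N a)"] mu_pos
    by (linarith, simp)
  then show ?thesis
    unfolding traffic_map_def
    using b mu_pos by (intro frac_le) (linarith | simp)+
qed

lemma traffic_map_nonneg: "a \<in> \<Sigma> \<Longrightarrow> 0 \<le> traffic_map x a"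
  by (rule order_trans[OF _ traffic_map_ge])
    (use lam_pos mu_pos sum_N_pos[of x, OF pos] swap_sum_nonneg[of x] pos in
      \<open>auto intro!: divide_nonneg_pos add_nonneg_nonneg mult_nonneg_nonneg simp: less_imp_le\<close>)

lemma traffic_map_fixed_point:
  assumes "x \<in> extensional \<Sigma>" "\<And>a. a \<in> \<Sigma> \<Longrightarrow> traffic_map x a = x a"
  shows "admissible_solution X \<Sigma> \<nu> lam \<mu> (load x) x"
  unfolding admissible_solution_def twisted_traffic_iff simplex_int_def
proof (intro conjI ballI)
  note b = load_bounds
  fix a assume a: "a \<in> \<Sigma>"
  have "(lam + \<mu> - load x * \<mu>) * x a
      = lam / load x * (pmf \<nu> a * sum x (N a)) + lam * swap_sum x a + load x * lam * (pop_sum x a * x a)"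
    using assms(2)[OF a] b(3) unfolding traffic_map_def by (simp add: field_simps)
  then have "load x * ((lam + \<mu> - load x * \<mu>) * x a)
      = load x * (lam / load x * (pmf \<nu> a * sum x (N a)) + lam * swap_sum x a + load x * lam * (pop_sum x a * x a))"
    by simp
  then show "load x * (lam + \<mu>) * x a = (load x)\<^sup>2 * \<mu> * x a + lam * pmf \<nu> a * sum x (N a)
        + load x * lam * swap_sum x a + (load x)\<^sup>2 * lam * (pop_sum x a * x a)"
    using b(1) by (simp add: algebra_simps power2_eq_square)
qed (use assms pos sum1 load_bounds(1) in \<open>auto simp: PiE_def less_imp_le load_def\<close>)

end

text \<open>The limit point has to be interior, so that the denominators in \<open>pop_sum\<close>
  and the load stay away from 0.\<close>

lemma traffic_map_tendsto:
  assumes lim: "\<And>a. a \<in> \<Sigma> \<Longrightarrow> (\<lambda>n. y n a) \<longlonglongrightarrow> x a"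
    and pos: "\<And>a. a \<in> \<Sigma> \<Longrightarrow> 0 < x a" and sum1: "sum x \<Sigma> = 1" and a: "a \<in> \<Sigma>"
  shows "(\<lambda>n. traffic_map (y n) a) \<longlonglongrightarrow> traffic_map x a"
proof -
  have N: "(\<lambda>n. sum (y n) (N c)) \<longlonglongrightarrow> sum x (N c)" for c
    using N_sub lim by (intro tendsto_sum) auto
  have A: "(\<lambda>n. \<AA> (y n)) \<longlonglongrightarrow> \<AA> x" unfolding traffic_A_def by (intro tendsto_intros N)
  have C: "(\<lambda>n. \<CC> (y n)) \<longlonglongrightarrow> \<CC> x" unfolding traffic_C_def case_prod_beta
    by (intro tendsto_sum tendsto_intros lim) auto
  have S: "(\<lambda>n. swap_sum (y n) a) \<longlonglongrightarrow> swap_sum x a" unfolding swap_sum_def case_prod_beta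
    by (intro tendsto_sum tendsto_intros lim) auto
  have P: "(\<lambda>n. pop_sum (y n) a) \<longlonglongrightarrow> pop_sum x a" unfolding pop_sum_def
  proof (rule tendsto_sum, clarify)
    fix b d assume "d \<in> \<Sigma>"
    then have "sum x (N d) \<noteq> 0" using sum_N_pos[of x, OF pos] by force
    then show "(\<lambda>n. pmf \<nu> b * (y n d / sum (y n) (N d))) \<longlonglongrightarrow> pmf \<nu> b * (x d / sum x (N d))"
      by (intro tendsto_intros lim N \<open>d \<in> \<Sigma>\<close>)
  qed
  have "\<mu> + lam * \<CC> x \<noteq> 0"
    using traffic_C_nonneg[of x, OF less_imp_le[OF pos]] lam_pos mu_pos
    by (metis add_nonneg_eq_0_iff less_imp_le mult_nonneg_nonneg less_irrefl)
  then have E: "(\<lambda>n. load (y n)) \<longlonglongrightarrow> load x" unfolding load_def by (intro tendsto_intros A C)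
  show ?thesis unfolding traffic_map_def
    using load_bounds[OF pos sum1] by (intro tendsto_intros E N S P lim a) auto
qed

theorem admissible_solution_exists: "\<exists>\<rho> r. admissible_solution X \<Sigma> \<nu> lam \<mu> \<rho> r"
proof -
  define n where "n = real (card \<Sigma>)"
  have n: "0 < n" unfolding n_def using finite_gens gens_nonempty by (simp add: card_gt_0_iff)
  have const: "(\<Sum>a\<in>\<Sigma>. c / n) = c" for c :: real using n by (simp add: n_def)
  \<comment> \<open>A retraction of the cube onto the simplex: missing mass is spread evenly, excess
    mass is divided out, and points of sum 1 stay fixed.\<close>
  define ret where "ret y a = (y a + max 0 (1 - sum y \<Sigma>) / n) / max 1 (sum y \<Sigma>)" for y :: "'m \<Rightarrow> real" and a
  define reg where "reg \<epsilon> y a = (1 - \<epsilon>) * ret y a + \<epsilon> / n" for \<epsilon> y a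
  have ret_sum: "sum (ret y) \<Sigma> = 1" for y
  proof -
    have "(\<Sum>a\<in>\<Sigma>. y a + max 0 (1 - sum y \<Sigma>) / n) = max 1 (sum y \<Sigma>)"
      by (simp only: sum.distrib const)
    then show ?thesis unfolding ret_def by (simp only: sum_divide_distrib[symmetric]) simp
  qed
  have reg_sum: "sum (reg \<epsilon> y) \<Sigma> = 1" for \<epsilon> y
    unfolding reg_def sum.distrib const sum_distrib_left[symmetric] ret_sum by simp
  have reg_pos: "0 < reg \<epsilon> y a" if "0 < \<epsilon>" "\<epsilon> < 1" "\<And>a. a \<in> \<Sigma> \<Longrightarrow> 0 \<le> y a" "a \<in> \<Sigma>" for \<epsilon> y a
  proof -
    have "0 \<le> ret y a" unfolding ret_def using that n
      by (intro divide_nonneg_pos add_nonneg_nonneg) auto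
    then show ?thesis unfolding reg_def using that n by (intro add_nonneg_pos) auto
  qed
  have perturbed: "\<exists>y. (\<forall>a\<in>\<Sigma>. 0 \<le> y a) \<and> sum y \<Sigma> = 1 \<and>
      (\<forall>a\<in>\<Sigma>. traffic_map (\<lambda>a. (1 - \<epsilon>) * y a + \<epsilon> / n) a = y a)" if e: "0 < \<epsilon>" "\<epsilon> < 1" for \<epsilon> :: real
  proof -
    have "\<exists>y. (\<forall>a\<in>\<Sigma>. 0 \<le> y a \<and> y a \<le> 1) \<and> (\<forall>a\<in>\<Sigma>. traffic_map (reg \<epsilon> y) a = y a)"
    proof (rule brouwer_finite_cube[OF finite_gens])
      fix y :: "'m \<Rightarrow> real" and a
      assume y: "\<And>a. a \<in> \<Sigma> \<Longrightarrow> 0 \<le> y a \<and> y a \<le> 1" and a: "a \<in> \<Sigma>"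
      have p: "0 < reg \<epsilon> y a" if "a \<in> \<Sigma>" for a using reg_pos[OF e] y that by blast
      note nn = traffic_map_nonneg[of "reg \<epsilon> y", OF p reg_sum]
      have "traffic_map (reg \<epsilon> y) a \<le> sum (traffic_map (reg \<epsilon> y)) \<Sigma>"
        by (rule member_le_sum) (use a nn finite_gens in auto)
      then show "0 \<le> traffic_map (reg \<epsilon> y) a \<and> traffic_map (reg \<epsilon> y) a \<le> 1"
        using nn[OF _ a] sum_traffic_map[of "reg \<epsilon> y", OF p reg_sum] by simp
    next
      fix x :: "nat \<Rightarrow> 'm \<Rightarrow> real" and y a
      assume x: "\<And>n i. i \<in> \<Sigma> \<Longrightarrow> 0 \<le> x n i \<and> x n i \<le> 1" and a: "a \<in> \<Sigma>"
        and lim: "\<And>i. i \<in> \<Sigma> \<Longrightarrow> (\<lambda>n. x n i) \<longlonglongrightarrow> y i"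
      have "0 \<le> y b" if "b \<in> \<Sigma>" for b
        by (rule LIMSEQ_le_const[OF lim[OF that]]) (use x that in auto)
      then have "0 < reg \<epsilon> y b" if "b \<in> \<Sigma>" for b using reg_pos[OF e] that by blast
      moreover have "(\<lambda>n. reg \<epsilon> (x n) b) \<longlonglongrightarrow> reg \<epsilon> y b" if "b \<in> \<Sigma>" for b
        unfolding reg_def ret_def using n by (intro tendsto_intros tendsto_sum lim that) auto
      ultimately show "(\<lambda>n. traffic_map (reg \<epsilon> (x n)) a) \<longlonglongrightarrow> traffic_map (reg \<epsilon> y) a"
        by (intro traffic_map_tendsto reg_sum a)
    qed
    then obtain y where y: "\<And>a. a \<in> \<Sigma> \<Longrightarrow> 0 \<le> y a" "\<And>a. a \<in> \<Sigma> \<Longrightarrow> traffic_map (reg \<epsilon> y) a = y a"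
      by blast
    have p: "0 < reg \<epsilon> y a" if "a \<in> \<Sigma>" for a using reg_pos[OF e] y(1) that by blast
    \<comment> \<open>The image of the map has sum 1, so the fixed point lies where
      \<open>ret\<close> is the identity and the retraction disappears.\<close>
    have "sum y \<Sigma> = 1" using sum_traffic_map[of "reg \<epsilon> y", OF p reg_sum] y(2) by simp
    then have "reg \<epsilon> y = (\<lambda>a. (1 - \<epsilon>) * y a + \<epsilon> / n)" by (simp add: reg_def ret_def fun_eq_iff)
    then show ?thesis using y \<open>sum y \<Sigma> = 1\<close> by auto
  qed
  \<comment> \<open>The perturbation \<open>1 / (k + 2)\<close> stays strictly below 1, also at
    \<open>k = 0\<close>.\<close>
  have "\<forall>k. \<exists>y. (\<forall>a\<in>\<Sigma>. 0 \<le> y a) \<and> sum y \<Sigma> = 1 \<and>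
      (\<forall>a\<in>\<Sigma>. traffic_map (\<lambda>a. (1 - inverse (real (Suc (Suc k)))) * y a + inverse (real (Suc (Suc k))) / n) a = y a)"
    by (intro allI perturbed) (auto simp: field_simps)
  then obtain y where y: "\<And>k a. a \<in> \<Sigma> \<Longrightarrow> 0 \<le> y k a" "\<And>k. sum (y k) \<Sigma> = 1"
    "\<And>k a. a \<in> \<Sigma> \<Longrightarrow> traffic_map (\<lambda>a. (1 - inverse (real (Suc (Suc k)))) * y k a + inverse (real (Suc (Suc k))) / n) a = y k a"
    by metis
  have y1: "y k a \<le> 1" if "a \<in> \<Sigma>" for k a
    using member_le_sum[of a \<Sigma> "y k"] y that finite_gens by auto
  obtain \<phi> l where \<phi>: "strict_mono (\<phi> :: nat \<Rightarrow> nat)" "\<And>a. a \<in> \<Sigma> \<Longrightarrow> (\<lambda>k. y (\<phi> k) a) \<longlonglongrightarrow> l a"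
    using finite_cube_subseq[OF finite_gens, of y] y(1) y1 by blast
  define r where "r = (\<lambda>a. if a \<in> \<Sigma> then l a else undefined)"
  have yr: "(\<lambda>k. y (\<phi> k) a) \<longlonglongrightarrow> r a" if "a \<in> \<Sigma>" for a using \<phi>(2)[OF that] that by (simp add: r_def)
  define \<epsilon> where "\<epsilon> k = inverse (real (Suc (Suc (\<phi> k))))" for k
  have eps: "0 < \<epsilon> k" "\<epsilon> k < 1" for k unfolding \<epsilon>_def by (auto simp: field_simps)
  have eps0: "\<epsilon> \<longlonglongrightarrow> 0"
  proof -
    have "(\<lambda>k. inverse (real (Suc (Suc k)))) \<longlonglongrightarrow> 0"
      using LIMSEQ_inverse_real_of_nat by (rule LIMSEQ_Suc)
    from LIMSEQ_subseq_LIMSEQ[OF this \<phi>(1)] show ?thesis by (simp add: o_def \<epsilon>_def[abs_def])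
  qed
  define x where "x k a = (1 - \<epsilon> k) * y (\<phi> k) a + \<epsilon> k / n" for k a
  have xfix: "traffic_map (x k) a = y (\<phi> k) a" if "a \<in> \<Sigma>" for k a
    using y(3)[OF that, of "\<phi> k"] by (simp only: x_def[abs_def] \<epsilon>_def)
  have xpos: "0 < x k a" if "a \<in> \<Sigma>" for k a
    unfolding x_def using eps[of k] n y(1)[OF that] by (intro add_nonneg_pos) auto
  have xsum: "sum (x k) \<Sigma> = 1" for k
    unfolding x_def sum.distrib const sum_distrib_left[symmetric] y(2) by simp
  have xr: "(\<lambda>k. x k a) \<longlonglongrightarrow> r a" if "a \<in> \<Sigma>" for a
  proof -
    have "(\<lambda>k. (1 - \<epsilon> k) * y (\<phi> k) a + \<epsilon> k / n) \<longlonglongrightarrow> (1 - 0) * r a + 0 / n"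
      using n by (intro tendsto_intros eps0 yr that) auto
    then show ?thesis by (simp add: x_def)
  qed
  have rsum: "sum r \<Sigma> = 1"
  proof -
    have "(\<lambda>k. sum (x k) \<Sigma>) \<longlonglongrightarrow> sum r \<Sigma>" by (intro tendsto_sum xr)
    then show ?thesis by (simp add: xsum LIMSEQ_const_iff)
  qed
  have rge: "(\<mu> * (pmf \<nu> a * sum r (N a)) + lam * swap_sum r a) / (lam + \<mu>) \<le> r a" if "a \<in> \<Sigma>" for a
  proof (rule LIMSEQ_le[OF _ yr[OF that]])
    show "(\<lambda>k. (\<mu> * (pmf \<nu> a * sum (x k) (N a)) + lam * swap_sum (x k) a) / (lam + \<mu>)) \<longlonglongrightarrow>
        (\<mu> * (pmf \<nu> a * sum r (N a)) + lam * swap_sum r a) / (lam + \<mu>)"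
      unfolding swap_sum_def case_prod_beta
      using lam_pos mu_pos N_sub by (intro tendsto_intros tendsto_sum xr) auto
    show "\<exists>K. \<forall>k\<ge>K. (\<mu> * (pmf \<nu> a * sum (x k) (N a)) + lam * swap_sum (x k) a) / (lam + \<mu>) \<le> y (\<phi> k) a"
      using traffic_map_ge[of "x _", OF xpos xsum that] xfix[OF that] by simp
  qed
  have r0: "0 \<le> r a" if "a \<in> \<Sigma>" for a
    by (rule LIMSEQ_le_const[OF yr[OF that]]) (use y(1) that in auto)
  \<comment> \<open>The support of the limit is nonempty because the coordinates sum to 1, and
    \<open>rge\<close> closes it under both moves of \<open>irreducible\<close>.\<close>
  have "{a \<in> \<Sigma>. 0 < r a} = \<Sigma>"
  proof (rule irreducible)
    show "{a \<in> \<Sigma>. 0 < r a} \<noteq> {}"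
    proof
      assume "{a \<in> \<Sigma>. 0 < r a} = {}"
      then have "\<forall>a\<in>\<Sigma>. r a = 0" using r0 by (metis (mono_tags, lifting) empty_Collect_eq order_le_less)
      then show False using rsum by simp
    qed
  next
    fix a b assume a: "a \<in> set_pmf \<nu>" and b: "b \<in> N a" "b \<in> {a \<in> \<Sigma>. 0 < r a}"
    have as: "a \<in> \<Sigma>" using a supp by blast
    have "r b \<le> sum r (N a)" by (rule member_le_sum) (use b r0 N_sub in auto)
    then have "0 < \<mu> * (pmf \<nu> a * sum r (N a))" using a b mu_pos by (simp add: pmf_positive)
    moreover have "0 \<le> lam * swap_sum r a" using swap_sum_nonneg[of r a] r0 lam_pos by simp
    ultimately have "0 < (\<mu> * (pmf \<nu> a * sum r (N a)) + lam * swap_sum r a) / (lam + \<mu>)"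
      using lam_pos mu_pos by simp
    then show "a \<in> {a \<in> \<Sigma>. 0 < r a}" using rge[OF as] as by auto
  next
    fix b d assume b: "b \<in> set_pmf \<nu>" and d: "d \<in> {a \<in> \<Sigma>. 0 < r a}" and bd: "b \<cdot> d \<in> \<Sigma>"
    have bs: "b \<in> \<Sigma>" using b supp by blast
    have "0 < swap_sum r (b \<cdot> d)" unfolding swap_sum_def
      by (rule sum_pos2[of _ "(b, d)"]) (use b d bs r0 in \<open>auto simp: pmf_positive\<close>)
    moreover have "0 \<le> \<mu> * (pmf \<nu> (b \<cdot> d) * sum r (N (b \<cdot> d)))"
      using mu_pos r0 N_sub by (intro mult_nonneg_nonneg sum_nonneg) (auto simp: in_N_iff)
    ultimately have "0 < (\<mu> * (pmf \<nu> (b \<cdot> d) * sum r (N (b \<cdot> d))) + lam * swap_sum r (b \<cdot> d)) / (lam + \<mu>)"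
      using lam_pos mu_pos by (intro divide_pos_pos add_nonneg_pos) auto
    then show "b \<cdot> d \<in> {a \<in> \<Sigma>. 0 < r a}" using rge[OF bd] bd by auto
  qed auto
  then have rpos: "0 < r a" if "a \<in> \<Sigma>" for a using that by blast
  have "traffic_map r a = r a" if "a \<in> \<Sigma>" for a
    using LIMSEQ_unique[OF traffic_map_tendsto[OF xr rpos rsum that]] yr[OF that] xfix[OF that] by simp
  moreover have "r \<in> extensional \<Sigma>" by (simp add: r_def extensional_def)
  ultimately show ?thesis using traffic_map_fixed_point[OF rpos rsum] by blast
qed

end

section \<open>The queue on normal words\<close>

text \<open>Left multiplication by the letter \<open>b\<close> on normal words, that is, an arrival
  at the back of the queue. It stands outside the locales because \<open>word_normal_form\<close>
  uses it too.\<close>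

definition letter_act :: "('m, 'z) monoid_scheme \<Rightarrow> 'm set \<Rightarrow> 'm \<Rightarrow> 'm list \<Rightarrow> 'm list" where
  "letter_act X \<Sigma> b u = (case u of [] \<Rightarrow> [b]
     | a # w \<Rightarrow> if b \<otimes>\<^bsub>X\<^esub> a = \<one>\<^bsub>X\<^esub> then w else if b \<otimes>\<^bsub>X\<^esub> a \<in> \<Sigma> then (b \<otimes>\<^bsub>X\<^esub> a) # w else b # a # w)"

context zero_automatic begin

abbreviation "act \<equiv> letter_act X \<Sigma>"

lemmas act_def = letter_act_def[of X \<Sigma>]

lemma act_Nil [simp]: "act b [] = [b]" by (simp add: act_def)

lemma L_Nil [simp]: "[] \<in> L" by (simp add: normal_words_def)

lemma L_Cons: "a # w \<in> L \<longleftrightarrow> a \<in> \<Sigma> \<and> w \<in> L \<and> (w = [] \<or> hd w \<in> N a)"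
  by (cases w) (auto simp: normal_words_def Next_def)

lemma L_snoc: "v \<noteq> [] \<Longrightarrow> v @ [c] \<in> L \<longleftrightarrow> v \<in> L \<and> c \<in> N (last v)"
  by (auto simp: normal_words_def successively_append_iff Next_def)

lemma L_sub_lists: "u \<in> L \<Longrightarrow> set u \<subseteq> \<Sigma>"
  by (auto simp: normal_words_def)

lemma butlast_L: "u \<in> L \<Longrightarrow> butlast u \<in> L"
proof (cases u rule: rev_cases)
  case (snoc v c)
  then show "u \<in> L \<Longrightarrow> butlast u \<in> L" using L_snoc[of v c] by (cases "v = []") auto
qed simp

lemma act_closed: "b \<in> \<Sigma> \<Longrightarrow> u \<in> L \<Longrightarrow> act b u \<in> L"
  by (cases u) (auto simp: act_def L_Cons Next_mult in_N_iff)

lemma length_act: "length (act b u) \<le> Suc (length u)" "length u \<le> Suc (length (act b u))"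
  by (cases u; simp add: act_def)+

lemma finite_L_le: "finite {u \<in> L. length u \<le> n}"
  by (rule finite_subset[OF _ finite_lists_length_le[OF finite_gens, of n]]) (use L_sub_lists in auto)

text \<open>Finite windows of the nonempty states. A jump changes the length by at most one, so sums
  over predecessors and successors can be taken over such windows.\<close>

definition busy :: "nat \<Rightarrow> 'm list set" where
  "busy n = {u \<in> L. u \<noteq> [] \<and> length u \<le> n}"

lemma finite_busy [simp]: "finite (busy n)"
  unfolding busy_def by (rule finite_subset[OF _ finite_L_le[of n]]) auto

end

section \<open>Transition rates off the empty word\<close>

context zero_automatic_queue begin

text \<open>Self-loops are included (\<open>act b u = u\<close> can occur in a finite factor), so
  every normal word has total rate \<open>lam + \<mu>\<close>. At nonempty words the generator is
  \<open>rate\<close> minus this constant on the diagonal, and no \<open>r\<close> occurs.\<close>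

definition rate :: "'m list \<Rightarrow> 'm list \<Rightarrow> real" where
  "rate u v = lam * (\<Sum>b\<in>\<Sigma>. pmf \<nu> b * of_bool (act b u = v)) + \<mu> * of_bool (butlast u = v)"

lemma rate_nonneg: "0 \<le> rate u v"
  unfolding rate_def using lam_pos mu_pos by (intro add_nonneg_nonneg mult_nonneg_nonneg sum_nonneg) auto

lemma rate_eq_0_if_shorter: "length u > Suc (length v) \<Longrightarrow> rate u v = 0"
proof -
  assume l: "length u > Suc (length v)"
  then have "act b u \<noteq> v" for b using length_act(2)[of u b] by auto
  moreover have "butlast u \<noteq> v" using l by auto
  ultimately show ?thesis by (simp add: rate_def)
qed

lemma sum_rate_busy:
  fixes f :: "'m list \<Rightarrow> real"
  assumes "finite F" "F \<subseteq> L - {[]}" "busy (Suc (length v)) \<subseteq> F"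
  shows "(\<Sum>u\<in>F. f u * rate u v) = (\<Sum>u\<in>busy (Suc (length v)). f u * rate u v)"
proof (rule sum.mono_neutral_right[OF assms(1,3)], rule ballI)
  fix u assume "u \<in> F - busy (Suc (length v))"
  then have "length u > Suc (length v)" using assms(2) by (auto simp: busy_def)
  then show "f u * rate u v = 0" by (simp add: rate_eq_0_if_shorter)
qed

lemma inflow_expand:
  "(\<Sum>u\<in>busy n. f u * rate u v)
    = lam * (\<Sum>(b, u)\<in>{(b, u) \<in> \<Sigma> \<times> busy n. act b u = v}. pmf \<nu> b * f u)
      + \<mu> * (\<Sum>u\<in>{u \<in> busy n. butlast u = v}. f u)"
proof -
  have "(\<Sum>u\<in>busy n. f u * rate u v) = lam * (\<Sum>b\<in>\<Sigma>. \<Sum>u\<in>busy n. pmf \<nu> b * f u * of_bool (act b u = v))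
      + \<mu> * (\<Sum>u\<in>busy n. f u * of_bool (butlast u = v))"
    unfolding rate_def distrib_left sum.distrib
    by (subst sum.swap) (simp add: sum_distrib_left mult_ac del: sum_mult_of_bool_eq sum_of_bool_mult_eq)
  moreover have "(\<Sum>b\<in>\<Sigma>. \<Sum>u\<in>busy n. pmf \<nu> b * f u * of_bool (act b u = v))
      = (\<Sum>(b, u)\<in>{(b, u) \<in> \<Sigma> \<times> busy n. act b u = v}. pmf \<nu> b * f u)"
    unfolding sum.cartesian_product
    by (rule sum.mono_neutral_cong_right) (auto simp: finite_gens)
  moreover have "(\<Sum>u\<in>busy n. f u * of_bool (butlast u = v)) = (\<Sum>u\<in>{u \<in> busy n. butlast u = v}. f u)"
    by (rule sum.mono_neutral_cong_right) auto
  ultimately show ?thesis by simp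
qed

text \<open>The predecessors of \<open>a # w\<close> are \<open>w\<close> by pushing,
  \<open>d # w\<close> by merging, \<open>d # a # w\<close> by cancellation and
  \<open>a # w @ [c]\<close> by service. For \<open>w = []\<close> the push starts from the empty
  word and is left to the source term.\<close>

lemma inflow_Cons:
  assumes v: "a # w \<in> L"
  shows "(\<Sum>u\<in>busy (Suc (length (a # w))). f u * rate u (a # w))
    = lam * ((if w = [] then 0 else pmf \<nu> a * f w)
        + (\<Sum>(b, d)\<in>{(b, d) \<in> \<Sigma> \<times> \<Sigma>. b \<cdot> d = a}. pmf \<nu> b * f (d # w))
        + (\<Sum>(b, d)\<in>{(b, d) \<in> \<Sigma> \<times> \<Sigma>. d \<in> N a \<and> b \<cdot> d = \<one>\<^bsub>X\<^esub>}. pmf \<nu> b * f (d # a # w)))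
      + \<mu> * (\<Sum>c\<in>N (last (a # w)). f (a # w @ [c]))"
proof -
  have a: "a \<in> \<Sigma>" "w \<in> L" "w = [] \<or> hd w \<in> N a" using v by (auto simp: L_Cons)
  let ?n = "Suc (length (a # w))"
  let ?P2 = "{(b, d) \<in> \<Sigma> \<times> \<Sigma>. b \<cdot> d = a}" and ?P3 = "{(b, d) \<in> \<Sigma> \<times> \<Sigma>. d \<in> N a \<and> b \<cdot> d = \<one>\<^bsub>X\<^esub>}"
  let ?A1 = "if w = [] then {} else {(a, w)}"
  let ?A2 = "(\<lambda>(b, d). (b, d # w)) ` ?P2" and ?A3 = "(\<lambda>(b, d). (b, d # a # w)) ` ?P3"
  have "{(b, u) \<in> \<Sigma> \<times> busy ?n. act b u = a # w} = ?A1 \<union> ?A2 \<union> ?A3" (is "?S = _")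
  proof (intro equalityI subsetI)
    fix x assume "x \<in> ?S"
    then obtain b u where x: "x = (b, u)" "b \<in> \<Sigma>" "u \<in> busy ?n" "act b u = a # w" by auto
    then obtain d w' where u: "u = d # w'" by (cases u) (auto simp: busy_def)
    have d: "d \<in> \<Sigma>" "w' = [] \<or> hd w' \<in> N d" using x(3) u by (auto simp: busy_def L_Cons)
    show "x \<in> ?A1 \<union> ?A2 \<union> ?A3"
      using x u d N_sym[OF a(1) d(1)] by (auto simp: act_def image_iff split: if_splits)
  next
    fix x assume "x \<in> ?A1 \<union> ?A2 \<union> ?A3"
    then consider "w \<noteq> []" "x = (a, w)" | b d where "b \<in> \<Sigma>" "d \<in> \<Sigma>" "b \<cdot> d = a" "x = (b, d # w)"
      | b d where "b \<in> \<Sigma>" "d \<in> \<Sigma>" "d \<in> N a" "b \<cdot> d = \<one>\<^bsub>X\<^esub>" "x = (b, d # a # w)"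
      by (auto split: if_splits)
    then show "x \<in> ?S"
    proof cases
      case 1
      then show ?thesis using a by (cases w) (auto simp: busy_def act_def in_N_iff)
    next
      case 2
      then show ?thesis using a Next_mult[of b d] one_notin by (auto simp: busy_def act_def L_Cons)
    next
      case 3
      then show ?thesis using v a N_sym[OF a(1), of d] by (auto simp: busy_def act_def L_Cons)
    qed
  qed
  then have "(\<Sum>(b, u)\<in>?S. pmf \<nu> b * f u) = (\<Sum>(b, u)\<in>?A1. pmf \<nu> b * f u) + (\<Sum>(b, u)\<in>?A2. pmf \<nu> b * f u)
      + (\<Sum>(b, u)\<in>?A3. pmf \<nu> b * f u)"
    by (simp only:) (subst sum.union_disjoint; (subst sum.union_disjoint)?; auto)
  also have "(\<Sum>(b, u)\<in>?A2. pmf \<nu> b * f u) = (\<Sum>(b, d)\<in>?P2. pmf \<nu> b * f (d # w))"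
    by (subst sum.reindex) (auto simp: inj_on_def case_prod_beta)
  also have "(\<Sum>(b, u)\<in>?A3. pmf \<nu> b * f u) = (\<Sum>(b, d)\<in>?P3. pmf \<nu> b * f (d # a # w))"
    by (subst sum.reindex) (auto simp: inj_on_def case_prod_beta)
  finally have 1: "(\<Sum>(b, u)\<in>?S. pmf \<nu> b * f u) = (if w = [] then 0 else pmf \<nu> a * f w)
     + (\<Sum>(b, d)\<in>?P2. pmf \<nu> b * f (d # w)) + (\<Sum>(b, d)\<in>?P3. pmf \<nu> b * f (d # a # w))" by simp
  have "{u \<in> busy ?n. butlast u = a # w} = (\<lambda>c. (a # w) @ [c]) ` N (last (a # w))" (is "?U = ?V")
  proof (intro equalityI subsetI)
    fix u assume u: "u \<in> ?U"
    then have "u = (a # w) @ [last u]" by (metis (mono_tags, lifting) append_butlast_last_id butlast.simps(1) list.distinct(1) mem_Collect_eq)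
    then show "u \<in> ?V" using u L_snoc[of "a # w" "last u"] by (auto simp: busy_def)
  next
    fix u assume "u \<in> ?V"
    then show "u \<in> ?U" using v L_snoc[of "a # w"] by (auto simp: busy_def butlast_append)
  qed
  then have "(\<Sum>u\<in>?U. f u) = (\<Sum>c\<in>N (last (a # w)). f (a # w @ [c]))"
    by (simp only:) (subst sum.reindex; simp add: inj_on_def)
  then show ?thesis unfolding inflow_expand 1 by simp
qed

lemma inflow_Nil:
  "(\<Sum>u\<in>busy (Suc 0). f u * rate u []) = (\<Sum>(b, d)\<in>{(b, d) \<in> \<Sigma> \<times> \<Sigma>. b \<cdot> d = \<one>\<^bsub>X\<^esub>}. lam * (pmf \<nu> b * f [d]))
      + \<mu> * (\<Sum>a\<in>\<Sigma>. f [a])"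
proof -
  have b1: "busy (Suc 0) = (\<lambda>a. [a]) ` \<Sigma>"
    by (auto simp: busy_def L_Cons length_Suc_conv le_Suc_eq)
  have "{(b, u) \<in> \<Sigma> \<times> busy (Suc 0). act b u = []} = (\<lambda>(b, d). (b, [d])) ` {(b, d) \<in> \<Sigma> \<times> \<Sigma>. b \<cdot> d = \<one>\<^bsub>X\<^esub>}"
    unfolding b1 by (auto simp: act_def image_iff split: if_splits)
  then have "(\<Sum>(b, u)\<in>{(b, u) \<in> \<Sigma> \<times> busy (Suc 0). act b u = []}. pmf \<nu> b * f u)
      = (\<Sum>(b, d)\<in>{(b, d) \<in> \<Sigma> \<times> \<Sigma>. b \<cdot> d = \<one>\<^bsub>X\<^esub>}. pmf \<nu> b * f [d])"
    by (simp only:) (subst sum.reindex; auto simp: inj_on_def case_prod_beta)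
  moreover have "{u \<in> busy (Suc 0). butlast u = []} = (\<lambda>a. [a]) ` \<Sigma>"
    unfolding b1 by auto
  then have "(\<Sum>u\<in>{u \<in> busy (Suc 0). butlast u = []}. f u) = (\<Sum>a\<in>\<Sigma>. f [a])"
    by (simp only:) (subst sum.reindex; simp add: inj_on_def)
  ultimately show ?thesis unfolding inflow_expand by (simp add: sum_distrib_left case_prod_beta)
qed

lemma outflow:
  assumes "finite F"
  shows "(\<Sum>v\<in>F. rate u v * g v) = lam * (\<Sum>b\<in>\<Sigma>. pmf \<nu> b * (if act b u \<in> F then g (act b u) else 0))
      + \<mu> * (if butlast u \<in> F then g (butlast u) else 0)"
proof -
  have "(\<Sum>v\<in>F. rate u v * g v) = (\<Sum>v\<in>F. lam * (\<Sum>b\<in>\<Sigma>. pmf \<nu> b * (if act b u = v then g v else 0)))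
      + (\<Sum>v\<in>F. \<mu> * (if butlast u = v then g v else 0))"
    unfolding rate_def distrib_right sum.distrib
    by (auto simp: sum_distrib_left sum_distrib_right mult_ac of_bool_def intro!: arg_cong2[where f = "(+)"] sum.cong)
  also have "\<dots> = lam * (\<Sum>b\<in>\<Sigma>. pmf \<nu> b * (\<Sum>v\<in>F. if act b u = v then g v else 0))
      + \<mu> * (\<Sum>v\<in>F. if butlast u = v then g v else 0)"
    unfolding sum_distrib_left[symmetric] by (subst sum.swap) (simp add: sum_distrib_left)
  finally show ?thesis using assms by (simp add: sum.delta')
qed

end

lemma has_sum_finite_support_iff:
  fixes f :: "'a \<Rightarrow> real"
  assumes "finite G" "G \<subseteq> A" "\<And>x. x \<in> A - G \<Longrightarrow> f x = 0"
  shows "(f has_sum s) A \<longleftrightarrow> sum f G = s"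
proof -
  have "(f has_sum s) A \<longleftrightarrow> (f has_sum s) G"
    by (rule has_sum_cong_neutral) (use assms in auto)
  also have "\<dots> \<longleftrightarrow> sum f G = s"
    using has_sum_finite[OF assms(1), of f] has_sum_unique by blast
  finally show ?thesis .
qed

section \<open>Null vectors of product form and admissible solutions\<close>

context zero_automatic_queue begin

text \<open>The arrivals into the empty word, which has weight 1 in the product form. Only here does
  \<open>r\<close> enter the dynamics, linearly and through its sums over \<open>N\<close>.\<close>

definition source :: "('m \<Rightarrow> real) \<Rightarrow> 'm list \<Rightarrow> real" where
  "source r v = (if length v = 1 then lam * (pmf \<nu> (hd v) * sum r (N (hd v))) else 0)"

text \<open>The column of the null vector equation at a nonempty word, with self-loops counted on
  both sides and the contribution of the empty word replaced by a general source.\<close>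

definition balanced_at :: "('m list \<Rightarrow> real) \<Rightarrow> ('m list \<Rightarrow> real) \<Rightarrow> 'm list \<Rightarrow> bool" where
  "balanced_at s f v \<longleftrightarrow> (\<Sum>u\<in>busy (Suc (length v)). f u * rate u v) + s v = (lam + \<mu>) * f v"

lemma rate_eq_0_if_longer: "length v > Suc (length u) \<Longrightarrow> rate u v = 0"
proof -
  assume l: "length v > Suc (length u)"
  then have "act b u \<noteq> v" for b using length_act(1)[of b u] by auto
  moreover have "butlast u \<noteq> v" using l by auto
  ultimately show ?thesis by (simp add: rate_def)
qed

lemma sum_rate:
  assumes "u \<in> L"
  shows "(\<Sum>v\<in>{v \<in> L. length v \<le> Suc (length u)}. rate u v) = lam + \<mu>"
proof -
  have "(\<Sum>v\<in>{v \<in> L. length v \<le> Suc (length u)}. rate u v * 1)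
      = lam * (\<Sum>b\<in>\<Sigma>. pmf \<nu> b * 1) + \<mu> * 1"
    by (subst outflow[OF finite_L_le])
      (use assms act_closed butlast_L[of u] length_act(1)[of _ u] in \<open>auto intro!: arg_cong2[where f = "(+)"] sum.cong\<close>)
  then show ?thesis by (simp add: sum_nu)
qed

text \<open>By \<open>N_sym\<close> the letters of \<open>N a\<close> are those that can be pushed
  onto \<open>a\<close>, so the three sums of \<open>queue_rate\<close> exhaust \<Sigma> up to the
  letters with \<open>b \<cdot> a = a\<close>. These are self-loops and contribute nothing to
  \<open>v \<noteq> u\<close>.\<close>

lemma queue_rate_eq_rate:
  assumes u: "u \<in> L" "u \<noteq> []" and vu: "v \<noteq> u"
  shows "queue_rate X \<Sigma> \<nu> r lam \<mu> u v = rate u v"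
proof -
  obtain a w where uw: "u = a # w" using u by (cases u) auto
  have a: "a \<in> \<Sigma>" using u uw by (simp add: L_Cons)
  have Na: "N a = {b \<in> \<Sigma>. b \<cdot> a \<notin> \<Sigma> \<and> b \<cdot> a \<noteq> \<one>\<^bsub>X\<^esub>}"
  proof -
    have "N a = {b \<in> \<Sigma>. a \<in> N b}" using N_sym a N_sub by blast
    then show ?thesis using a by (simp add: in_N_iff)
  qed
  let ?h = "\<lambda>b. if act b u = v then lam * pmf \<nu> b else 0"
  let ?S = "{b \<in> \<Sigma>. b \<cdot> a \<in> \<Sigma>}" and ?I = "{b \<in> \<Sigma>. b \<cdot> a = \<one>\<^bsub>X\<^esub>}"
  have h0: "lam * (\<Sum>b\<in>\<Sigma>. pmf \<nu> b * of_bool (act b u = v)) = sum ?h \<Sigma>"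
    unfolding sum_distrib_left by (rule sum.cong) (auto simp: of_bool_def)
  have split: "N a \<union> ?S \<union> ?I = \<Sigma>" by (auto simp: Na)
  have "sum ?h (N a \<union> ?S \<union> ?I) = sum ?h (N a \<union> ?S) + sum ?h ?I"
    using one_notin finite_gens by (intro sum.union_disjoint) (auto simp: Na)
  also have "sum ?h (N a \<union> ?S) = sum ?h (N a) + sum ?h ?S"
    using finite_gens by (intro sum.union_disjoint) (auto simp: Na)
  finally have h: "sum ?h \<Sigma> = sum ?h (N a) + sum ?h ?S + sum ?h ?I" unfolding split .
  have h1: "sum ?h (N a) = (\<Sum>b\<in>N a. if v = b # a # w then lam * pmf \<nu> b else 0)"
  proof (intro sum.cong refl)
    fix b assume "b \<in> N a"
    then have "act b u = b # a # w" using Na uw by (auto simp: act_def)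
    then show "?h b = (if v = b # a # w then lam * pmf \<nu> b else 0)" by auto
  qed
  have h2: "sum ?h ?S = (\<Sum>b\<in>{b \<in> \<Sigma>. b \<cdot> a \<in> \<Sigma> \<and> b \<cdot> a \<noteq> a}. if v = (b \<cdot> a) # w then lam * pmf \<nu> b else 0)"
    by (rule sum.mono_neutral_cong_right) (use one_notin vu uw finite_gens in \<open>auto simp: act_def\<close>)
  have h3: "sum ?h ?I = (\<Sum>b\<in>?I. if v = w then lam * pmf \<nu> b else 0)"
    by (intro sum.cong refl) (auto simp: act_def uw)
  note 1 = h0[unfolded h h1 h2 h3]
  have 2: "\<mu> * of_bool (butlast u = v) = (if v = butlast (a # w) then \<mu> else 0)" unfolding uw by auto
  show ?thesis unfolding rate_def 1 2 unfolding uw queue_rate.simps ..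
qed

lemma queue_rate_empty:
  assumes "v \<in> L" "v \<noteq> []"
  shows "queue_rate X \<Sigma> \<nu> r lam \<mu> [] v = source r v"
proof (cases "length v = 1")
  case True
  then obtain a where v: "v = [a]" by (auto simp: length_Suc_conv)
  then show ?thesis using assms finite_gens unfolding v
    by (simp add: source_def L_Cons sum.delta)
next
  case False
  then have "v \<noteq> [a]" for a by auto
  then show ?thesis using False by (simp add: source_def)
qed

lemma sum_source: "(\<Sum>v\<in>busy (Suc n). source r v) = lam * \<AA> r"
proof -
  have "(\<Sum>v\<in>busy (Suc n). source r v) = (\<Sum>v\<in>(\<lambda>a. [a]) ` \<Sigma>. source r v)"
    by (rule sum.mono_neutral_right) (auto simp: finite_busy[unfolded busy_def] busy_def L_Cons source_def length_Suc_conv)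
  also have "\<dots> = lam * \<AA> r"
    by (subst sum.reindex) (auto simp: inj_on_def source_def traffic_A_def sum_distrib_left)
  finally show ?thesis .
qed

lemma infsum_finite_support:
  fixes f :: "'a \<Rightarrow> real"
  assumes "finite G" "G \<subseteq> A" "\<And>x. x \<in> A - G \<Longrightarrow> f x = 0"
  shows "infsum f A = sum f G"
  using has_sum_finite_support_iff[where s = "sum f G", OF assms] by (auto intro: infsumI)

text \<open>The generator does not count self-loops as departures, hence the \<open>rate u u\<close>
  that is added back.\<close>

lemma queue_generator_diag:
  assumes u: "u \<in> L" "u \<noteq> []"
  shows "queue_generator X \<Sigma> \<nu> r lam \<mu> u u = rate u u - (lam + \<mu>)"
proof -
  let ?F = "{v \<in> L. length v \<le> Suc (length u)}"
  have "(\<Sum>\<^sub>\<infinity>v\<in>L - {u}. queue_rate X \<Sigma> \<nu> r lam \<mu> u v) = (\<Sum>\<^sub>\<infinity>v\<in>L - {u}. rate u v)"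
    by (rule infsum_cong) (use queue_rate_eq_rate[OF u] in auto)
  also have "\<dots> = (\<Sum>v\<in>?F - {u}. rate u v)"
    by (rule infsum_finite_support) (use rate_eq_0_if_longer[of u] in \<open>auto simp: finite_L_le\<close>)
  also have "\<dots> = lam + \<mu> - rate u u"
    using sum_rate[OF u(1)] u sum.remove[OF finite_L_le, of u "Suc (length u)" "rate u"] by simp
  finally show ?thesis by (simp add: queue_generator_def)
qed

lemma queue_generator_empty: "queue_generator X \<Sigma> \<nu> r lam \<mu> [] [] = - lam * \<AA> r"
proof -
  have "(\<Sum>\<^sub>\<infinity>v\<in>L - {[]}. queue_rate X \<Sigma> \<nu> r lam \<mu> [] v) = (\<Sum>\<^sub>\<infinity>v\<in>L - {[]}. source r v)"
    by (rule infsum_cong) (use queue_rate_empty in auto)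
  also have "\<dots> = (\<Sum>v\<in>busy (Suc 0). source r v)"
    by (rule infsum_finite_support) (auto simp: finite_busy[unfolded busy_def] busy_def source_def)
  finally show ?thesis by (simp add: queue_generator_def sum_source del: queue_rate.simps)
qed

lemma queue_generator_off_diag:
  "u \<in> L \<Longrightarrow> u \<noteq> [] \<Longrightarrow> v \<noteq> u \<Longrightarrow> queue_generator X \<Sigma> \<nu> r lam \<mu> u v = rate u v"
  "v \<in> L \<Longrightarrow> v \<noteq> [] \<Longrightarrow> queue_generator X \<Sigma> \<nu> r lam \<mu> [] v = source r v"
  by (auto simp: queue_generator_def queue_rate_eq_rate queue_rate_empty simp del: queue_rate.simps)

lemma column_sum_iff:
  assumes p: "p [] = 1" and v: "v \<in> L" "v \<noteq> []"
  shows "((\<lambda>u. p u * queue_generator X \<Sigma> \<nu> r lam \<mu> u v) has_sum 0) L \<longleftrightarrow> balanced_at (source r) p v"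
proof -
  let ?Q = "queue_generator X \<Sigma> \<nu> r lam \<mu>" and ?B = "busy (Suc (length v))"
  let ?G = "insert [] ?B"
  have vB: "v \<in> ?B" "[] \<notin> ?B" using v by (auto simp: busy_def)
  have "sum (\<lambda>u. p u * ?Q u v) ?G = source r v + (\<Sum>u\<in>?B. p u * ?Q u v)"
    using vB v by (simp add: p queue_generator_off_diag(2))
  also have "(\<Sum>u\<in>?B. p u * ?Q u v) = (\<Sum>u\<in>?B. p u * rate u v - (if u = v then (lam + \<mu>) * p v else 0))"
    by (intro sum.cong refl) (use v in \<open>auto simp: busy_def queue_generator_diag queue_generator_off_diag(1) algebra_simps\<close>)
  also have "\<dots> = (\<Sum>u\<in>?B. p u * rate u v) - (lam + \<mu>) * p v"
    using vB by (simp add: sum_subtractf sum.delta)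
  finally have "sum (\<lambda>u. p u * ?Q u v) ?G = source r v + (\<Sum>u\<in>?B. p u * rate u v) - (lam + \<mu>) * p v" by simp
  moreover have "((\<lambda>u. p u * ?Q u v) has_sum 0) L \<longleftrightarrow> sum (\<lambda>u. p u * ?Q u v) ?G = 0"
  proof (rule has_sum_finite_support_iff)
    fix u assume u: "u \<in> L - ?G"
    then have "length u > Suc (length v)" by (auto simp: busy_def)
    moreover from this have "v \<noteq> u" by auto
    ultimately show "p u * ?Q u v = 0" using u by (auto simp: queue_generator_off_diag(1) rate_eq_0_if_shorter)
  qed (auto simp: finite_busy[unfolded busy_def] busy_def)
  ultimately show ?thesis by (auto simp: balanced_at_def)
qed

lemma flux_into_empty:
  assumes p: "\<And>a. a \<in> \<Sigma> \<Longrightarrow> p [a] = \<rho> * r a" and sum1: "sum r \<Sigma> = 1"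
  shows "(\<Sum>u\<in>busy (Suc 0). p u * rate u []) = \<rho> * (\<mu> + lam * \<CC> r)"
proof -
  have "(\<Sum>(b, d)\<in>{(b, d) \<in> \<Sigma> \<times> \<Sigma>. b \<cdot> d = \<one>\<^bsub>X\<^esub>}. lam * (pmf \<nu> b * p [d])) = \<rho> * lam * \<CC> r"
    unfolding traffic_C_def sum_distrib_left by (intro sum.cong refl) (auto simp: p)
  moreover have "(\<Sum>a\<in>\<Sigma>. p [a]) = \<rho>" using sum1 by (simp add: p sum_distrib_left[symmetric])
  ultimately show ?thesis unfolding inflow_Nil by (simp add: algebra_simps)
qed

text \<open>The empty word is entered by service and by cancellation from the one-letter words only.
  Equating this flow with the total arrival rate is the equation that defines \<rho> in an
  admissible solution.\<close>

lemma column_sum_empty_iff: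
  assumes p: "p [] = 1" "\<And>a. a \<in> \<Sigma> \<Longrightarrow> p [a] = \<rho> * r a" and sum1: "sum r \<Sigma> = 1"
  shows "((\<lambda>u. p u * queue_generator X \<Sigma> \<nu> r lam \<mu> u []) has_sum 0) L \<longleftrightarrow> \<rho> * (\<mu> + lam * \<CC> r) = lam * \<AA> r"
proof -
  let ?Q = "queue_generator X \<Sigma> \<nu> r lam \<mu>" and ?B = "busy (Suc 0)"
  let ?G = "insert [] ?B"
  have "sum (\<lambda>u. p u * ?Q u []) ?G = - lam * \<AA> r + (\<Sum>u\<in>?B. p u * ?Q u [])"
    by (simp add: p queue_generator_empty finite_busy[unfolded busy_def] busy_def)
  also have "(\<Sum>u\<in>?B. p u * ?Q u []) = (\<Sum>u\<in>?B. p u * rate u [])"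
    by (intro sum.cong refl) (auto simp: busy_def queue_generator_off_diag(1))
  also have "\<dots> = \<rho> * (\<mu> + lam * \<CC> r)"
    by (rule flux_into_empty) (use p sum1 in auto)
  finally have "sum (\<lambda>u. p u * ?Q u []) ?G = \<rho> * (\<mu> + lam * \<CC> r) - lam * \<AA> r" by simp
  moreover have "((\<lambda>u. p u * ?Q u []) has_sum 0) L \<longleftrightarrow> sum (\<lambda>u. p u * ?Q u []) ?G = 0"
  proof (rule has_sum_finite_support_iff)
    fix u assume u: "u \<in> L - ?G"
    then have "length u > Suc (length ([] :: 'm list))" by (auto simp: busy_def)
    then have "rate u [] = 0" by (rule rate_eq_0_if_shorter)
    then show "p u * ?Q u [] = 0" using u by (auto simp: queue_generator_off_diag(1))
  qed (auto simp: finite_busy[unfolded busy_def] busy_def)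
  ultimately show ?thesis by auto
qed

lemma simplex_int_pos: "r \<in> simplex_int \<Sigma> \<Longrightarrow> a \<in> \<Sigma> \<Longrightarrow> 0 < r a"
  unfolding simplex_int_def by (drule CollectD, drule conjunct1, drule PiE_mem) auto

context
  fixes \<rho> :: real and r :: "'m \<Rightarrow> real"
  assumes r_simplex: "r \<in> simplex_int \<Sigma>" and rho_pos: "0 < \<rho>"
begin

lemma r_pos: "a \<in> \<Sigma> \<Longrightarrow> 0 < r a"
  using simplex_int_pos[OF r_simplex] .

lemma r_N_pos: "a \<in> \<Sigma> \<Longrightarrow> 0 < sum r (N a)"
  by (rule sum_N_pos) (auto intro: r_pos)

abbreviation "pf \<equiv> product_form X \<Sigma> \<rho> r"

lemma p_Nil: "pf [] = 1" by (simp add: product_form_def)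

lemma p_single: "pf [a] = \<rho> * r a" by (simp add: product_form_def)

lemma p_Cons: "w \<noteq> [] \<Longrightarrow> pf (a # w) = \<rho> * (r a / sum r (N a)) * pf w"
  by (simp add: product_form_def)

lemma p_pos: "set u \<subseteq> \<Sigma> \<Longrightarrow> 0 < pf u"
proof (induction u)
  case (Cons a w)
  then show ?case using rho_pos r_pos r_N_pos[of a]
    by (cases "w = []") (auto simp: p_Nil p_single p_Cons)
qed (simp add: p_Nil)

text \<open>When \<open>c\<close> becomes the front letter, \<open>last v\<close> acquires the
  denominator \<open>sum r (N (last v))\<close>, which the sum over \<open>c\<close> cancels.
  Service therefore preserves the product form up to the factor \<rho>.\<close>

lemma sum_p_snoc:
  assumes "v \<in> L" "v \<noteq> []"
  shows "(\<Sum>c\<in>N (last v). pf (v @ [c])) = \<rho> * pf v"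
proof -
  have l: "last v \<in> \<Sigma>" using assms L_sub_lists last_in_set by blast
  note s = r_N_pos[OF l]
  let ?q = "\<lambda>a. r a / sum r (N a)"
  have "prod_list (map ?q v) = prod_list (map ?q (butlast v)) * ?q (last v)"
    using assms(2) by (cases v rule: rev_cases) auto
  then have "pf (v @ [c]) = \<rho> * pf v / sum r (N (last v)) * r c" for c
    using assms(2) by (simp add: product_form_def)
  then have "(\<Sum>c\<in>N (last v). pf (v @ [c])) = \<rho> * pf v / sum r (N (last v)) * sum r (N (last v))"
    by (simp only: sum_distrib_left)
  then show ?thesis using s by simp
qed

lemma balanced_at_single_iff:
  assumes "a \<in> \<Sigma>"
  shows "balanced_at (source r) pf [a] \<longleftrightarrow>
    \<rho> * (lam + \<mu>) * r a = \<rho>\<^sup>2 * \<mu> * r a + lam * pmf \<nu> a * sum r (N a)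
        + \<rho> * lam * swap_sum r a + \<rho>\<^sup>2 * lam * (pop_sum r a * r a)"
proof -
  have L: "[a] \<in> L" using assms by (simp add: L_Cons)
  have 1: "(\<Sum>(b, d)\<in>{(b, d) \<in> \<Sigma> \<times> \<Sigma>. b \<cdot> d = a}. pmf \<nu> b * pf [d]) = \<rho> * swap_sum r a"
    unfolding swap_sum_def sum_distrib_left by (intro sum.cong refl) (auto simp: p_single)
  have 2: "(\<Sum>(b, d)\<in>{(b, d) \<in> \<Sigma> \<times> \<Sigma>. d \<in> N a \<and> b \<cdot> d = \<one>\<^bsub>X\<^esub>}. pmf \<nu> b * pf [d, a]) = \<rho>\<^sup>2 * (pop_sum r a * r a)"
    unfolding pop_sum_def sum_distrib_left sum_distrib_right
    by (intro sum.cong refl) (auto simp: p_single p_Cons power2_eq_square)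
  have 3: "(\<Sum>c\<in>N (last [a]). pf (a # [] @ [c])) = \<rho>\<^sup>2 * r a"
    using sum_p_snoc[OF L] by (simp add: p_single power2_eq_square)
  show ?thesis
    unfolding balanced_at_def inflow_Cons[OF L] 1 2 3 by (auto simp: source_def p_single algebra_simps)
qed

text \<open>This is the traffic equation for \<open>a\<close> multiplied by
  \<open>pf w / sum r (N a)\<close>. The same multiple appears in the merging term because
  \<open>Next_mult\<close> gives \<open>N d = N a\<close> there.\<close>

lemma balanced_at_Cons:
  assumes L: "a # w \<in> L" and w: "w \<noteq> []"
    and tte: "\<rho> * (lam + \<mu>) * r a = \<rho>\<^sup>2 * \<mu> * r a + lam * pmf \<nu> a * sum r (N a)
        + \<rho> * lam * swap_sum r a + \<rho>\<^sup>2 * lam * (pop_sum r a * r a)"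
  shows "balanced_at (source r) pf (a # w)"
proof -
  have a: "a \<in> \<Sigma>" using L by (simp add: L_Cons)
  note s = r_N_pos[OF a]
  obtain k where k: "pf w = k * sum r (N a)" using s that[of "pf w / sum r (N a)"] by simp
  have 1: "(\<Sum>(b, d)\<in>{(b, d) \<in> \<Sigma> \<times> \<Sigma>. b \<cdot> d = a}. pmf \<nu> b * pf (d # w)) = k * (\<rho> * swap_sum r a)"
    unfolding swap_sum_def sum_distrib_left
    by (intro sum.cong refl) (use a w s Next_mult in \<open>auto simp: p_Cons k\<close>)
  have 2: "(\<Sum>(b, d)\<in>{(b, d) \<in> \<Sigma> \<times> \<Sigma>. d \<in> N a \<and> b \<cdot> d = \<one>\<^bsub>X\<^esub>}. pmf \<nu> b * pf (d # a # w)) = k * (\<rho>\<^sup>2 * (pop_sum r a * r a))"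
    unfolding pop_sum_def sum_distrib_left sum_distrib_right
    by (intro sum.cong refl) (use w s in \<open>auto simp: p_Cons k power2_eq_square\<close>)
  have 3: "(\<Sum>c\<in>N (last (a # w)). pf (a # w @ [c])) = k * (\<rho>\<^sup>2 * r a)"
    using sum_p_snoc[OF L] w s by (simp add: p_Cons k power2_eq_square)
  have 5: "pf (a # w) = k * (\<rho> * r a)" using w s by (simp add: p_Cons k)
  have "(\<Sum>u\<in>busy (Suc (length (a # w))). pf u * rate u (a # w)) + source r (a # w) =
     lam * (pmf \<nu> a * (k * sum r (N a)) + k * (\<rho> * swap_sum r a) + k * (\<rho>\<^sup>2 * (pop_sum r a * r a))) + \<mu> * (k * (\<rho>\<^sup>2 * r a))"
    unfolding inflow_Cons[OF L] 1 2 3 using w by (simp add: source_def k)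
  also have "\<dots> = k * (\<rho>\<^sup>2 * \<mu> * r a + lam * pmf \<nu> a * sum r (N a)
        + \<rho> * lam * swap_sum r a + \<rho>\<^sup>2 * lam * (pop_sum r a * r a))"
    by (simp add: distrib_left mult_ac)
  also have "\<dots> = (lam + \<mu>) * pf (a # w)"
    unfolding tte[symmetric] 5 by simp
  finally show ?thesis unfolding balanced_at_def .
qed

end

text \<open>The balance at one-letter words is already the whole traffic system, and
  \<open>balanced_at_Cons\<close> extends it to all longer words.\<close>

lemma admissible_iff:
  assumes "r \<in> simplex_int \<Sigma>" "0 < \<rho>"
  shows "admissible_solution X \<Sigma> \<nu> lam \<mu> \<rho> r \<longleftrightarrow>
    (\<forall>v\<in>L - {[]}. balanced_at (source r) (product_form X \<Sigma> \<rho> r) v) \<and> \<rho> * (\<mu> + lam * \<CC> r) = lam * \<AA> r"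
proof -
  note rp = simplex_int_pos[OF assms(1)]
  have "r \<in> extensional \<Sigma>" using assms(1) by (simp add: simplex_int_def PiE_def)
  then have 1: "r \<in> \<Sigma> \<rightarrow>\<^sub>E {0..}" using rp by (simp add: PiE_def less_imp_le)
  have "0 < \<mu> + lam * \<CC> r"
  proof -
    have "0 \<le> \<CC> r" by (rule traffic_C_nonneg) (use rp in force)
    then show ?thesis using lam_pos mu_pos by (simp add: add_pos_nonneg)
  qed
  then have 2: "\<rho> = lam * \<AA> r / (\<mu> + lam * \<CC> r) \<longleftrightarrow> \<rho> * (\<mu> + lam * \<CC> r) = lam * \<AA> r"
    by (simp add: eq_divide_eq)
  have 3: "(\<forall>v\<in>L - {[]}. balanced_at (source r) (product_form X \<Sigma> \<rho> r) v) \<longleftrightarrow>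
     (\<forall>a\<in>\<Sigma>. \<rho> * (lam + \<mu>) * r a = \<rho>\<^sup>2 * \<mu> * r a + lam * pmf \<nu> a * sum r (N a)
        + \<rho> * lam * swap_sum r a + \<rho>\<^sup>2 * lam * (pop_sum r a * r a))" (is "?B \<longleftrightarrow> ?T")
  proof
    assume B: ?B
    show ?T
    proof
      fix a assume a: "a \<in> \<Sigma>"
      then have "[a] \<in> L - {[]}" by (simp add: L_Cons)
      with B have "balanced_at (source r) (product_form X \<Sigma> \<rho> r) [a]" by (rule bspec)
      then show "\<rho> * (lam + \<mu>) * r a = \<rho>\<^sup>2 * \<mu> * r a + lam * pmf \<nu> a * sum r (N a)
        + \<rho> * lam * swap_sum r a + \<rho>\<^sup>2 * lam * (pop_sum r a * r a)"
        by (rule balanced_at_single_iff[OF assms a, THEN iffD1])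
    qed
  next
    assume T: ?T
    show ?B
    proof
      fix v assume v: "v \<in> L - {[]}"
      then obtain a w where aw: "v = a # w" by (cases v) auto
      then have L: "a # w \<in> L" and a: "a \<in> \<Sigma>" using v by (simp_all add: L_Cons)
      note t = bspec[OF T a]
      show "balanced_at (source r) (product_form X \<Sigma> \<rho> r) v"
      proof (cases "w = []")
        case True
        show ?thesis unfolding aw True
          by (rule balanced_at_single_iff[OF assms a, THEN iffD2, OF t])
      next
        case False
        show ?thesis unfolding aw
          by (rule balanced_at_Cons[OF assms L False t])
      qed
    qed
  qed
  show ?thesis
    unfolding admissible_solution_def twisted_traffic_iff 2 3 using assms 1 by blast
qed

theorem null_vector_iff_admissible:
  assumes "r \<in> simplex_int \<Sigma>" "0 < \<rho>"
  shows "null_vector L (product_form X \<Sigma> \<rho> r) (queue_generator X \<Sigma> \<nu> r lam \<mu>)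
    \<longleftrightarrow> admissible_solution X \<Sigma> \<nu> lam \<mu> \<rho> r"
proof -
  let ?p = "product_form X \<Sigma> \<rho> r"
  have s1: "sum r \<Sigma> = 1" using assms(1) by (simp add: simplex_int_def)
  have p: "?p [] = 1" "\<And>a. ?p [a] = \<rho> * r a" by (simp_all add: product_form_def)
  have ball_split: "(\<forall>v\<in>L. P v) \<longleftrightarrow> (\<forall>v\<in>L - {[]}. P v) \<and> P []" for P :: "'m list \<Rightarrow> bool"
    using L_Nil by blast
  have "null_vector L ?p (queue_generator X \<Sigma> \<nu> r lam \<mu>) \<longleftrightarrow>
      (\<forall>v\<in>L - {[]}. ((\<lambda>u. ?p u * queue_generator X \<Sigma> \<nu> r lam \<mu> u v) has_sum 0) L)
      \<and> ((\<lambda>u. ?p u * queue_generator X \<Sigma> \<nu> r lam \<mu> u []) has_sum 0) L"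
    unfolding null_vector_def by (rule ball_split)
  also have "\<dots> \<longleftrightarrow> (\<forall>v\<in>L - {[]}. balanced_at (source r) ?p v) \<and> \<rho> * (\<mu> + lam * \<CC> r) = lam * \<AA> r"
    by (intro conj_cong ball_cong refl column_sum_iff column_sum_empty_iff[where \<rho> = \<rho>] p s1) auto
  finally show ?thesis using admissible_iff[OF assms] by blast
qed

end

section \<open>Occupation times of an excursion\<close>

context zero_automatic begin

text \<open>The expected length after \<open>k\<close> arrivals without service. The recursion
  conditions on the first arrival, which keeps probability spaces out of the argument until the
  drift is needed.\<close>

primrec mean_length :: "nat \<Rightarrow> 'm list \<Rightarrow> real" where
  "mean_length 0 u = real (length u)"
| "mean_length (Suc k) u = (\<Sum>b\<in>\<Sigma>. pmf \<nu> b * mean_length k (act b u))"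

lemma mean_length_nonneg: "0 \<le> mean_length k u"
  by (induction k arbitrary: u) (auto intro!: sum_nonneg)

lemma act_append: "u \<noteq> [] \<Longrightarrow> act b (u @ v) = act b u @ v"
  by (cases u) (auto simp: act_def)

text \<open>A step shortens a word by at most one letter, so the first \<open>k\<close> steps act
  inside \<open>u\<close> and never touch the front letter \<open>c\<close>.\<close>

lemma mean_length_snoc: "k \<le> length u \<Longrightarrow> mean_length k (u @ [c]) = mean_length k u + 1"
proof (induction k arbitrary: u)
  case (Suc k)
  then have u: "u \<noteq> []" by auto
  have "k \<le> length (act b u)" for b using Suc.prems length_act(2)[of u b] by linarith
  then have "mean_length k (act b (u @ [c])) = mean_length k (act b u) + 1" for b
    using Suc.IH act_append[OF u] by simp
  then show ?case by (simp add: distrib_left sum.distrib sum_nu)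
qed simp

text \<open>Averaging the expected length over the first \<open>n\<close> steps makes one service decrease the
  potential of a long word by exactly \<open>n\<close>, whereas one arrival increases it by at most the mean
  displacement of \<open>n\<close> steps of the random walk.\<close>

definition potential :: "nat \<Rightarrow> 'm list \<Rightarrow> real" where
  "potential n u = (\<Sum>k<n. mean_length k u)"

lemma potential_nonneg: "0 \<le> potential n u"
  unfolding potential_def by (intro sum_nonneg mean_length_nonneg)

text \<open>An arrival shifts the averaging window by one step, and the difference
  telescopes.\<close>

lemma potential_arrival:
  "(\<Sum>b\<in>\<Sigma>. pmf \<nu> b * potential n (act b u)) = potential n u + mean_length n u - real (length u)"
proof -
  have "(\<Sum>b\<in>\<Sigma>. pmf \<nu> b * potential n (act b u)) = (\<Sum>k<n. mean_length (Suc k) u)"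
    unfolding potential_def by (simp add: sum_distrib_left sum.swap[of _ "{..<n}"])
  then show ?thesis
    using sum.lessThan_Suc_shift[of "\<lambda>k. mean_length k u" n] by (simp add: potential_def)
qed

lemma potential_service: "n < length u \<Longrightarrow> potential n (butlast u) = potential n u - real n"
proof (cases u rule: rev_cases)
  case (snoc v c)
  assume "n < length u"
  then have "potential n u = (\<Sum>k<n. mean_length k v + 1)"
    unfolding potential_def snoc by (intro sum.cong refl mean_length_snoc) (simp add: snoc)
  then show ?thesis by (simp add: potential_def snoc sum.distrib)
qed simp

end

section \<open>Occupation times and their limit\<close>

context zero_automatic_queue begin

text \<open>Picard iterates of the balance equations, started at 0: the expected time at
  \<open>v\<close> within the first \<open>k\<close> states, self-loops counted, of an excursion
  that starts with intensity \<open>s\<close> and is stopped at the empty word. If \<open>s\<close>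
  lives on one-letter words, no word longer than \<open>k\<close> is reached by then, so the window
  \<open>busy k\<close> loses nothing.\<close>

primrec visits :: "('m list \<Rightarrow> real) \<Rightarrow> nat \<Rightarrow> 'm list \<Rightarrow> real" where
  "visits s 0 v = 0"
| "visits s (Suc k) v = (s v + (\<Sum>u\<in>busy k. visits s k u * rate u v)) / (lam + \<mu>)"

lemma visits_nonneg: "(\<And>v. 0 \<le> s v) \<Longrightarrow> 0 \<le> visits s k v"
proof (induction k arbitrary: v)
  case (Suc k)
  have "0 \<le> (\<Sum>u\<in>busy k. visits s k u * rate u v)"
    by (intro sum_nonneg mult_nonneg_nonneg Suc rate_nonneg)
  then show ?case using Suc.prems[of v] lam_pos mu_pos by simp
qed simp

lemma busy_mono: "m \<le> n \<Longrightarrow> busy m \<subseteq> busy n"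
  by (auto simp: busy_def)

lemma visits_mono_Suc:
  assumes "\<And>v. 0 \<le> s v"
  shows "visits s k v \<le> visits s (Suc k) v"
proof (induction k arbitrary: v)
  case 0
  then show ?case using assms[of v] lam_pos mu_pos by (simp add: busy_def)
next
  case (Suc k)
  have "(\<Sum>u\<in>busy k. visits s k u * rate u v) \<le> (\<Sum>u\<in>busy k. visits s (Suc k) u * rate u v)"
    by (intro sum_mono mult_right_mono Suc rate_nonneg)
  also have "\<dots> \<le> (\<Sum>u\<in>busy (Suc k). visits s (Suc k) u * rate u v)"
    by (intro sum_mono2 finite_busy busy_mono mult_nonneg_nonneg rate_nonneg visits_nonneg assms) simp
  finally show ?case
    unfolding visits.simps(2)[of s k] visits.simps(2)[of s "Suc k"]
    using lam_pos mu_pos by (intro divide_right_mono add_left_mono) auto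
qed

lemma visits_scale_le:
  assumes "\<And>v. m * s v \<le> s' v"
  shows "m * visits s k v \<le> visits s' k v"
proof (induction k arbitrary: v)
  case (Suc k)
  have "m * (\<Sum>u\<in>busy k. visits s k u * rate u v) = (\<Sum>u\<in>busy k. (m * visits s k u) * rate u v)"
    by (simp add: sum_distrib_left mult_ac)
  also have "\<dots> \<le> (\<Sum>u\<in>busy k. visits s' k u * rate u v)"
    by (intro sum_mono mult_right_mono Suc rate_nonneg)
  finally have "m * (s v + (\<Sum>u\<in>busy k. visits s k u * rate u v)) \<le> s' v + (\<Sum>u\<in>busy k. visits s' k u * rate u v)"
    using assms[of v] by (simp add: distrib_left)
  then show ?case using lam_pos mu_pos by (simp add: divide_right_mono)
qed simp

lemma sum_rate_le_inflow:
  fixes f :: "'m list \<Rightarrow> real"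
  assumes "\<And>u. u \<in> L \<Longrightarrow> u \<noteq> [] \<Longrightarrow> 0 \<le> f u"
  shows "(\<Sum>u\<in>busy k. f u * rate u v) \<le> (\<Sum>u\<in>busy (Suc (length v)). f u * rate u v)"
proof -
  let ?K = "max k (Suc (length v))"
  have "(\<Sum>u\<in>busy k. f u * rate u v) \<le> (\<Sum>u\<in>busy ?K. f u * rate u v)"
    using assms by (intro sum_mono2 finite_busy busy_mono mult_nonneg_nonneg rate_nonneg) (auto simp: busy_def)
  also have "\<dots> = (\<Sum>u\<in>busy (Suc (length v)). f u * rate u v)"
    by (rule sum_rate_busy) (auto simp: busy_def finite_busy[unfolded busy_def])
  finally show ?thesis .
qed

text \<open>Iteration from 0 stays below every nonnegative solution, because the inflow is
  monotone.\<close>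

lemma visits_le:
  assumes "\<And>u. u \<in> L \<Longrightarrow> u \<noteq> [] \<Longrightarrow> 0 \<le> p u"
    and bal: "\<And>v. v \<in> L \<Longrightarrow> v \<noteq> [] \<Longrightarrow> balanced_at s p v"
    and "v \<in> L" "v \<noteq> []"
  shows "visits s k v \<le> p v"
  using assms(3,4)
proof (induction k arbitrary: v)
  case (Suc k)
  have "(\<Sum>u\<in>busy k. visits s k u * rate u v) \<le> (\<Sum>u\<in>busy k. p u * rate u v)"
    by (intro sum_mono mult_right_mono Suc rate_nonneg) (auto simp: busy_def)
  also have "\<dots> \<le> (\<Sum>u\<in>busy (Suc (length v)). p u * rate u v)"
    by (rule sum_rate_le_inflow[OF assms(1)])
  also have "\<dots> = (lam + \<mu>) * p v - s v"
    using bal[OF Suc.prems] by (simp add: balanced_at_def)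
  finally show ?case using lam_pos mu_pos by (simp add: pos_divide_le_eq mult.commute)
qed (use assms(1) in simp)

text \<open>\<open>p\<close> is the minimal solution of its own balance equations: the expected occupation times
  of an excursion have finite total mass by the Foster-Lyapunov estimate, so they carry the same flux into
  the empty word as \<open>p\<close> does, and the difference, having no flux left, vanishes.\<close>

context
  fixes p s :: "'m list \<Rightarrow> real" and n :: nat
  assumes p_nonneg: "\<And>u. u \<in> L \<Longrightarrow> u \<noteq> [] \<Longrightarrow> 0 \<le> p u"
    and p_balanced: "\<And>v. v \<in> L \<Longrightarrow> v \<noteq> [] \<Longrightarrow> balanced_at s p v"
    and s_nonneg: "\<And>v. 0 \<le> s v" and s_single: "\<And>v. length v \<noteq> 1 \<Longrightarrow> s v = 0"
    and p_flux: "(\<Sum>u\<in>busy (Suc 0). p u * rate u []) = (\<Sum>v\<in>busy (Suc 0). s v)"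
    and drift: "lam * mean_length n [] < \<mu> * real n"
    and subadditive: "\<And>u. u \<in> L \<Longrightarrow> mean_length n u \<le> mean_length n [] + real (length u)"
begin

text \<open>On words longer than \<open>n\<close> the decrease \<open>\<mu> * n\<close> by service
  outweighs the increase by arrivals, which is at most \<open>lam * mean_length n []\<close>. On the
  finitely many shorter words the exact decrease fails, and a crude bound by a sum over
  \<open>busy n\<close> is enough.\<close>

lemma potential_drift:
  assumes u: "u \<in> L" "u \<noteq> []"
  shows "lam * (\<Sum>b\<in>\<Sigma>. pmf \<nu> b * potential n (act b u)) + \<mu> * potential n (butlast u)
    \<le> (lam + \<mu>) * potential n u - (\<mu> * n - lam * mean_length n [])
      + (if length u \<le> n then \<mu> * (n + (\<Sum>u\<in>busy n. potential n (butlast u))) else 0)"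
proof -
  have "lam * (\<Sum>b\<in>\<Sigma>. pmf \<nu> b * potential n (act b u)) \<le> lam * (potential n u + mean_length n [])"
    unfolding potential_arrival using subadditive[OF u(1)] lam_pos by (intro mult_left_mono) auto
  moreover have "\<mu> * potential n (butlast u)
    \<le> \<mu> * (potential n u - n + (if length u \<le> n then n + (\<Sum>u\<in>busy n. potential n (butlast u)) else 0))"
  proof (rule mult_left_mono)
    show "potential n (butlast u) \<le> potential n u - n + (if length u \<le> n then n + (\<Sum>u\<in>busy n. potential n (butlast u)) else 0)"
    proof (cases "length u \<le> n")
      case True
      then have "u \<in> busy n" using u by (simp add: busy_def)
      then have "potential n (butlast u) \<le> (\<Sum>u\<in>busy n. potential n (butlast u))"
        by (intro member_le_sum potential_nonneg finite_busy)
      then show ?thesis using True potential_nonneg[of n u] by simp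
    next
      case False
      then show ?thesis using potential_service[of n u] by simp
    qed
  qed (use mu_pos in simp)
  ultimately show ?thesis by (simp add: algebra_simps split: if_splits)
qed

definition mass :: "nat \<Rightarrow> real" where
  "mass k = (\<Sum>v\<in>busy k. visits s k v)"

text \<open>One step of the iteration tested against \<open>g\<close>. With
  \<open>g = potential n\<close> it yields the Foster-Lyapunov estimate, with \<open>g = 1\<close>
  the conservation of mass.\<close>

lemma sum_visits_Suc:
  "(lam + \<mu>) * (\<Sum>v\<in>busy (Suc k). visits s (Suc k) v * g v)
    = (\<Sum>v\<in>busy (Suc 0). s v * g v) + (\<Sum>u\<in>busy k. visits s k u * (\<Sum>v\<in>busy (Suc k). rate u v * g v))"
proof -
  have "(lam + \<mu>) * (\<Sum>v\<in>busy (Suc k). visits s (Suc k) v * g v)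
      = (\<Sum>v\<in>busy (Suc k). (s v + (\<Sum>u\<in>busy k. visits s k u * rate u v)) * g v)"
    unfolding sum_distrib_left using lam_pos mu_pos by (intro sum.cong refl) simp
  also have "\<dots> = (\<Sum>v\<in>busy (Suc k). s v * g v) + (\<Sum>v\<in>busy (Suc k). \<Sum>u\<in>busy k. visits s k u * (rate u v * g v))"
    by (simp add: distrib_right sum.distrib sum_distrib_right mult.assoc)
  also have "(\<Sum>v\<in>busy (Suc k). s v * g v) = (\<Sum>v\<in>busy (Suc 0). s v * g v)"
    by (rule sum.mono_neutral_right) (use s_single finite_busy[of "Suc k"] in \<open>auto simp: busy_def le_Suc_eq\<close>)
  also have "(\<Sum>v\<in>busy (Suc k). \<Sum>u\<in>busy k. visits s k u * (rate u v * g v))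
      = (\<Sum>u\<in>busy k. visits s k u * (\<Sum>v\<in>busy (Suc k). rate u v * g v))"
    by (subst sum.swap) (simp add: sum_distrib_left)
  finally show ?thesis .
qed

text \<open>Since the iterates increase in \<open>k\<close>, the potential terms on the two sides
  cancel and leave \<open>\<epsilon> * mass k\<close> bounded by the source plus a multiple of the
  time on words of length at most \<open>n\<close>. That time is bounded beforehand by
  \<open>visits_le\<close>, as \<open>p\<close> has a finite sum over \<open>busy n\<close>.\<close>

lemma mass_bounded: "\<exists>B. \<forall>k. mass k \<le> B"
proof -
  define \<epsilon> where "\<epsilon> = \<mu> * n - lam * mean_length n []"
  define c where "c = \<mu> * (n + (\<Sum>u\<in>busy n. potential n (butlast u)))"
  have eps: "0 < \<epsilon>" using drift by (simp add: \<epsilon>_def)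
  have c: "0 \<le> c" unfolding c_def using mu_pos by (intro mult_nonneg_nonneg add_nonneg_nonneg sum_nonneg potential_nonneg) auto
  note v0 = visits_nonneg[of s, OF s_nonneg]
  have "\<epsilon> * mass k \<le> (\<Sum>v\<in>busy (Suc 0). s v * potential n v) + c * (\<Sum>u\<in>busy n. p u)" for k
  proof -
    have le: "(\<Sum>v\<in>busy (Suc k). rate u v * potential n v)
        \<le> (lam + \<mu>) * potential n u - \<epsilon> + (if length u \<le> n then c else 0)" if u: "u \<in> busy k" for u
    proof -
      have uL: "u \<in> L" "u \<noteq> []" using u by (auto simp: busy_def)
      have "(\<Sum>v\<in>busy (Suc k). rate u v * potential n v)
          \<le> lam * (\<Sum>b\<in>\<Sigma>. pmf \<nu> b * potential n (act b u)) + \<mu> * potential n (butlast u)"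
        unfolding outflow[OF finite_busy]
        using lam_pos mu_pos potential_nonneg
        by (intro add_mono mult_left_mono sum_mono) auto
      also have "\<dots> \<le> (lam + \<mu>) * potential n u - \<epsilon> + (if length u \<le> n then c else 0)"
        using potential_drift[OF uL] unfolding \<epsilon>_def c_def .
      finally show ?thesis .
    qed
    have "(lam + \<mu>) * (\<Sum>u\<in>busy k. visits s k u * potential n u)
        \<le> (lam + \<mu>) * (\<Sum>v\<in>busy (Suc k). visits s (Suc k) v * potential n v)"
    proof (intro mult_left_mono)
      have "(\<Sum>u\<in>busy k. visits s k u * potential n u) \<le> (\<Sum>u\<in>busy k. visits s (Suc k) u * potential n u)"
        by (intro sum_mono mult_right_mono visits_mono_Suc s_nonneg potential_nonneg)
      also have "\<dots> \<le> (\<Sum>u\<in>busy (Suc k). visits s (Suc k) u * potential n u)"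
        by (intro sum_mono2 finite_busy busy_mono mult_nonneg_nonneg v0 potential_nonneg) simp
      finally show "(\<Sum>u\<in>busy k. visits s k u * potential n u) \<le> (\<Sum>u\<in>busy (Suc k). visits s (Suc k) u * potential n u)" .
    qed (use lam_pos mu_pos in simp)
    also have "\<dots> \<le> (\<Sum>v\<in>busy (Suc 0). s v * potential n v)
        + (\<Sum>u\<in>busy k. visits s k u * ((lam + \<mu>) * potential n u - \<epsilon> + (if length u \<le> n then c else 0)))"
      unfolding sum_visits_Suc by (intro add_left_mono sum_mono mult_left_mono le v0)
    also have "(\<Sum>u\<in>busy k. visits s k u * ((lam + \<mu>) * potential n u - \<epsilon> + (if length u \<le> n then c else 0)))
        = (lam + \<mu>) * (\<Sum>u\<in>busy k. visits s k u * potential n u) - \<epsilon> * mass k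
          + c * (\<Sum>u\<in>busy k. if length u \<le> n then visits s k u else 0)"
      unfolding mass_def sum_distrib_left sum_subtractf[symmetric] sum.distrib[symmetric]
      by (intro sum.cong refl) (simp add: algebra_simps)
    also have "c * (\<Sum>u\<in>busy k. if length u \<le> n then visits s k u else 0) \<le> c * (\<Sum>u\<in>busy n. p u)"
    proof (rule mult_left_mono[OF _ c])
      have "(\<Sum>u\<in>busy k. if length u \<le> n then visits s k u else 0) = (\<Sum>u\<in>{u \<in> busy k. length u \<le> n}. visits s k u)"
        by (simp add: sum.inter_filter)
      also have "\<dots> \<le> (\<Sum>u\<in>{u \<in> busy k. length u \<le> n}. p u)"
        by (intro sum_mono visits_le p_nonneg p_balanced) (auto simp: busy_def)
      also have "\<dots> \<le> (\<Sum>u\<in>busy n. p u)"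
        by (intro sum_mono2 p_nonneg) (auto simp: busy_def finite_busy[unfolded busy_def])
      finally show "(\<Sum>u\<in>busy k. if length u \<le> n then visits s k u else 0) \<le> (\<Sum>u\<in>busy n. p u)" .
    qed
    finally show ?thesis by simp
  qed
  then have "mass k \<le> ((\<Sum>v\<in>busy (Suc 0). s v * potential n v) + c * (\<Sum>u\<in>busy n. p u)) / \<epsilon>" for k
    using eps by (simp add: pos_le_divide_eq mult.commute)
  then show ?thesis by blast
qed

text \<open>Under the constant test function, mass is lost only by jumps into the empty
  word.\<close>

lemma mass_Suc:
  "(lam + \<mu>) * mass (Suc k) = (\<Sum>v\<in>busy (Suc 0). s v) + (lam + \<mu>) * mass k - (\<Sum>u\<in>busy k. visits s k u * rate u [])"
proof -
  have row: "(\<Sum>v\<in>busy (Suc k). rate u v * 1) = lam + \<mu> - rate u []" if u: "u \<in> busy k" for u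
  proof -
    have uL: "u \<in> L" "length u \<le> k" using u by (auto simp: busy_def)
    have "{v \<in> L. length v \<le> Suc k} = insert [] (busy (Suc k))" by (auto simp: busy_def)
    moreover have "[] \<notin> busy (Suc k)" by (simp add: busy_def)
    moreover have "(\<Sum>v\<in>{v \<in> L. length v \<le> Suc k}. rate u v) = (\<Sum>v\<in>{v \<in> L. length v \<le> Suc (length u)}. rate u v)"
      by (rule sum.mono_neutral_right) (use uL rate_eq_0_if_longer[of u] in \<open>auto simp: finite_L_le not_le_imp_less intro: ccontr\<close>)
    ultimately show ?thesis using sum_rate[OF uL(1)] by simp
  qed
  have "(\<Sum>u\<in>busy k. visits s k u * (\<Sum>v\<in>busy (Suc k). rate u v * 1))
      = (\<Sum>u\<in>busy k. visits s k u * (lam + \<mu> - rate u []))"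
    by (rule sum.cong[OF refl]) (simp only: row)
  also have "\<dots> = (lam + \<mu>) * mass k - (\<Sum>u\<in>busy k. visits s k u * rate u [])"
    by (simp add: mass_def sum_distrib_left right_diff_distrib sum_subtractf mult.commute)
  finally show ?thesis using sum_visits_Suc[of k "\<lambda>_. 1"] by (simp add: mass_def)
qed

lemma visits_tendsto:
  assumes "v \<in> L" "v \<noteq> []"
  shows "(\<lambda>k. visits s k v) \<longlonglongrightarrow> p v"
proof -
  define g where "g v = lim (\<lambda>k. visits s k v)" for v
  have inc: "incseq (\<lambda>k. visits s k v)" for v
    by (intro incseq_SucI visits_mono_Suc s_nonneg)
  have le: "visits s k v \<le> p v" if "v \<in> L" "v \<noteq> []" for k v
    using visits_le[OF _ _ that] p_nonneg p_balanced by blast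
  have g: "(\<lambda>k. visits s k v) \<longlonglongrightarrow> g v" if v: "v \<in> L" "v \<noteq> []" for v
  proof -
    obtain l where "(\<lambda>k. visits s k v) \<longlonglongrightarrow> l"
      using incseq_convergent[OF inc, of v "p v"] le[OF v] by blast
    then show ?thesis unfolding g_def by (simp add: limI)
  qed
  have g_le: "g v \<le> p v" if v: "v \<in> L" "v \<noteq> []" for v
    by (rule LIMSEQ_le_const2[OF g[OF v]]) (use le[OF v] in auto)
  have g_bal: "balanced_at s g v" if v: "v \<in> L" "v \<noteq> []" for v
  proof -
    let ?B = "busy (Suc (length v))"
    have "(\<lambda>k. (s v + (\<Sum>u\<in>?B. visits s k u * rate u v)) / (lam + \<mu>)) \<longlonglongrightarrow> (s v + (\<Sum>u\<in>?B. g u * rate u v)) / (lam + \<mu>)"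
      using lam_pos mu_pos by (intro tendsto_intros tendsto_sum g) (auto simp: busy_def)
    moreover have "eventually (\<lambda>k. (s v + (\<Sum>u\<in>?B. visits s k u * rate u v)) / (lam + \<mu>) = visits s (Suc k) v) sequentially"
    proof (rule eventually_sequentiallyI[of "Suc (length v)"])
      fix k assume k: "Suc (length v) \<le> k"
      have "(\<Sum>u\<in>busy k. visits s k u * rate u v) = (\<Sum>u\<in>?B. visits s k u * rate u v)"
        by (rule sum_rate_busy) (use k in \<open>auto simp: busy_def finite_busy[unfolded busy_def]\<close>)
      then show "(s v + (\<Sum>u\<in>?B. visits s k u * rate u v)) / (lam + \<mu>) = visits s (Suc k) v" by simp
    qed
    ultimately have "(\<lambda>k. visits s (Suc k) v) \<longlonglongrightarrow> (s v + (\<Sum>u\<in>?B. g u * rate u v)) / (lam + \<mu>)"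
      by (rule Lim_transform_eventually)
    from LIMSEQ_unique[OF this LIMSEQ_Suc[OF g[OF v]]]
    have "(s v + (\<Sum>u\<in>?B. g u * rate u v)) / (lam + \<mu>) = g v" .
    then show ?thesis using lam_pos mu_pos by (simp add: balanced_at_def field_simps)
  qed
  define h where "h v = p v - g v" for v
  have h0: "0 \<le> h v" if "v \<in> L" "v \<noteq> []" for v using g_le[OF that] by (simp add: h_def)
  have h_bal: "(\<Sum>u\<in>busy (Suc (length v)). h u * rate u v) = (lam + \<mu>) * h v" if v: "v \<in> L" "v \<noteq> []" for v
    using g_bal[OF v] p_balanced[OF v]
    by (simp add: h_def balanced_at_def left_diff_distrib right_diff_distrib sum_subtractf)
  \<comment> \<open>The increments of the bounded increasing \<open>mass\<close> tend to 0, so by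
    \<open>mass_Suc\<close> the flow into the empty word tends to the whole source.\<close>
  have "(\<lambda>k. \<Sum>u\<in>busy (Suc 0). visits s k u * rate u []) \<longlonglongrightarrow> (\<Sum>v\<in>busy (Suc 0). s v)"
  proof -
    obtain B where B: "\<And>k. mass k \<le> B" using mass_bounded by blast
    have "mass k \<le> mass (Suc k)" for k
    proof -
      have "mass k \<le> (\<Sum>v\<in>busy k. visits s (Suc k) v)"
        unfolding mass_def by (intro sum_mono visits_mono_Suc s_nonneg)
      also have "\<dots> \<le> mass (Suc k)"
        unfolding mass_def by (intro sum_mono2 finite_busy busy_mono visits_nonneg s_nonneg) simp
      finally show ?thesis .
    qed
    then have "incseq mass" by (rule incseq_SucI)
    then obtain m where m: "mass \<longlonglongrightarrow> m" using incseq_convergent[of mass B] B by blast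
    have "(\<lambda>k. (\<Sum>v\<in>busy (Suc 0). s v) + (lam + \<mu>) * mass k - (lam + \<mu>) * mass (Suc k))
        \<longlonglongrightarrow> (\<Sum>v\<in>busy (Suc 0). s v) + (lam + \<mu>) * m - (lam + \<mu>) * m"
      by (intro tendsto_intros m LIMSEQ_Suc[OF m])
    moreover have "eventually (\<lambda>k. (\<Sum>v\<in>busy (Suc 0). s v) + (lam + \<mu>) * mass k - (lam + \<mu>) * mass (Suc k)
        = (\<Sum>u\<in>busy (Suc 0). visits s k u * rate u [])) sequentially"
    proof (rule eventually_sequentiallyI[of "Suc 0"])
      fix k assume k: "Suc 0 \<le> k"
      have "(\<Sum>u\<in>busy k. visits s k u * rate u []) = (\<Sum>u\<in>busy (Suc (length ([] :: 'm list))). visits s k u * rate u [])"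
        by (rule sum_rate_busy) (use k in \<open>auto simp: busy_def finite_busy[unfolded busy_def]\<close>)
      then show "(\<Sum>v\<in>busy (Suc 0). s v) + (lam + \<mu>) * mass k - (lam + \<mu>) * mass (Suc k)
          = (\<Sum>u\<in>busy (Suc 0). visits s k u * rate u [])"
        using mass_Suc[of k] by simp
    qed
    ultimately show ?thesis by (simp add: Lim_transform_eventually)
  qed
  moreover have "(\<lambda>k. \<Sum>u\<in>busy (Suc 0). visits s k u * rate u []) \<longlonglongrightarrow> (\<Sum>u\<in>busy (Suc 0). g u * rate u [])"
    by (intro tendsto_intros tendsto_sum g) (auto simp: busy_def)
  ultimately have "(\<Sum>u\<in>busy (Suc 0). g u * rate u []) = (\<Sum>v\<in>busy (Suc 0). s v)"
    using LIMSEQ_unique by blast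
  then have flux0: "(\<Sum>u\<in>busy (Suc 0). h u * rate u []) = 0"
    using p_flux by (simp add: h_def left_diff_distrib sum_subtractf)
  have rate_service: "\<mu> \<le> rate u (butlast u)" for u
    unfolding rate_def using lam_pos by (simp add: sum_nonneg)
  \<comment> \<open>The inflow consists of nonnegative terms and service has positive rate, so a
    zero inflow into \<open>v\<close> kills \<open>h\<close> at every word that is served into
    \<open>v\<close>. Adding front letters one at a time to the empty word then reaches all
    words.\<close>
  have vanish: "h u = 0" if "(\<Sum>u\<in>busy k. h u * rate u v) = 0" "u \<in> busy k" "butlast u = v" for k u v
  proof -
    have "h u * rate u v = 0"
      using sum_nonneg_eq_0_iff[of "busy k" "\<lambda>u. h u * rate u v"] that h0 rate_nonneg
      by (auto simp: busy_def finite_busy[unfolded busy_def])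
    moreover have "0 < rate u v" using rate_service[of u] that(3) mu_pos by simp
    ultimately show ?thesis by simp
  qed
  have "h v = 0" if "v \<in> L" "v \<noteq> []" for v
    using that
  proof (induction v rule: rev_induct)
    case (snoc c w)
    show ?case
    proof (cases "w = []")
      case True
      then show ?thesis using vanish[OF flux0, of "w @ [c]"] snoc.prems by (simp add: busy_def)
    next
      case False
      then have w: "w \<in> L" using snoc.prems L_snoc by blast
      have "(\<Sum>u\<in>busy (Suc (length w)). h u * rate u w) = 0"
        using h_bal[OF w False] snoc.IH[OF w False] by simp
      from vanish[OF this, of "w @ [c]"] show ?thesis using snoc.prems by (simp add: busy_def)
    qed
  qed simp
  from this[OF assms] show ?thesis using g[OF assms] by (simp add: h_def)
qed

end
end

section \<open>Uniqueness\<close>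

context zero_automatic_queue begin

lemma source_nonneg: "(\<And>a. a \<in> \<Sigma> \<Longrightarrow> 0 \<le> r a) \<Longrightarrow> 0 \<le> source r v"
  unfolding source_def using lam_pos N_sub by (auto intro!: mult_nonneg_nonneg sum_nonneg)

text \<open>By \<open>sum_p_snoc\<close>, each further front letter multiplies the level sum by
  \<rho>.\<close>

lemma sum_product_form_level:
  assumes r: "r \<in> simplex_int \<Sigma>" and rho: "0 < \<rho>"
  shows "(\<Sum>v\<in>{v \<in> L. length v = Suc n}. product_form X \<Sigma> \<rho> r v) = \<rho> ^ Suc n"
proof (induction n)
  case 0
  have "{v \<in> L. length v = Suc 0} = (\<lambda>a. [a]) ` \<Sigma>" by (auto simp: L_Cons length_Suc_conv)
  then have "(\<Sum>v\<in>{v \<in> L. length v = Suc 0}. product_form X \<Sigma> \<rho> r v) = (\<Sum>a\<in>\<Sigma>. \<rho> * r a)"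
    by (simp only:) (subst sum.reindex; simp add: inj_on_def product_form_def)
  then show ?case using r by (simp add: sum_distrib_left[symmetric] simplex_int_def)
next
  case (Suc n)
  let ?p = "product_form X \<Sigma> \<rho> r"
  let ?S = "SIGMA v:{v \<in> L. length v = Suc n}. N (last v)"
  have fin: "finite {v \<in> L. length v = Suc n}"
    by (rule finite_subset[OF _ finite_L_le[of "Suc n"]]) auto
  have "{v \<in> L. length v = Suc (Suc n)} = (\<lambda>(v, c). v @ [c]) ` ?S"
  proof (intro equalityI subsetI)
    fix u assume u: "u \<in> {v \<in> L. length v = Suc (Suc n)}"
    then obtain v c where vc: "u = v @ [c]" by (cases u rule: rev_cases) auto
    then have "v \<noteq> []" using u by auto
    then show "u \<in> (\<lambda>(v, c). v @ [c]) ` ?S" using u vc L_snoc[of v c] by (auto simp: image_iff)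
  next
    fix u assume "u \<in> (\<lambda>(v, c). v @ [c]) ` ?S"
    then obtain v c where vc: "v \<in> L" "length v = Suc n" "c \<in> N (last v)" "u = v @ [c]" by auto
    then have "v \<noteq> []" by auto
    then show "u \<in> {v \<in> L. length v = Suc (Suc n)}" using vc L_snoc[of v c] by auto
  qed
  then have "(\<Sum>v\<in>{v \<in> L. length v = Suc (Suc n)}. ?p v) = (\<Sum>x\<in>?S. ?p (fst x @ [snd x]))"
    by (simp only:) (subst sum.reindex; auto simp: inj_on_def case_prod_beta)
  also have "\<dots> = (\<Sum>v\<in>{v \<in> L. length v = Suc n}. \<Sum>c\<in>N (last v). ?p (v @ [c]))"
    using fin by (simp add: sum.Sigma case_prod_beta)
  also have "\<dots> = (\<Sum>v\<in>{v \<in> L. length v = Suc n}. \<rho> * ?p v)"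
  proof (rule sum.cong[OF refl])
    fix v assume "v \<in> {v \<in> L. length v = Suc n}"
    then have "v \<in> L" "v \<noteq> []" by auto
    then show "(\<Sum>c\<in>N (last v). ?p (v @ [c])) = \<rho> * ?p v" by (rule sum_p_snoc[OF r rho])
  qed
  finally show ?case using Suc by (simp add: sum_distrib_left[symmetric])
qed

context
  fixes n :: nat
  assumes drift: "lam * mean_length n [] < \<mu> * real n"
    and subadditive: "\<And>u. u \<in> L \<Longrightarrow> mean_length n u \<le> mean_length n [] + real (length u)"
begin

lemma visits_tendsto_product_form:
  assumes adm: "admissible_solution X \<Sigma> \<nu> lam \<mu> \<rho> r" and v: "v \<in> L" "v \<noteq> []"
  shows "(\<lambda>k. visits (source r) k v) \<longlonglongrightarrow> product_form X \<Sigma> \<rho> r v"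
proof -
  have r: "r \<in> simplex_int \<Sigma>" and rho: "0 < \<rho>" using adm by (auto simp: admissible_solution_def)
  note bal = admissible_iff[OF r rho, THEN iffD1, OF adm]
  have rp: "0 < r a" if "a \<in> \<Sigma>" for a using simplex_int_pos[OF r that] .
  show ?thesis
  proof (rule visits_tendsto[of _ _ n, OF _ _ _ _ _ drift subadditive v])
    show "0 \<le> product_form X \<Sigma> \<rho> r u" if "u \<in> L" for u
      using p_pos[OF r rho, of u] L_sub_lists[OF that] by simp
    show "0 \<le> source r u" for u using rp by (intro source_nonneg) (auto simp: less_imp_le)
    show "source r u = 0" if "length u \<noteq> 1" for u using that by (simp add: source_def)
    show "balanced_at (source r) (product_form X \<Sigma> \<rho> r) u" if "u \<in> L" "u \<noteq> []" for u
      using bal that by blast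
    have "(\<Sum>u\<in>busy (Suc 0). product_form X \<Sigma> \<rho> r u * rate u []) = \<rho> * (\<mu> + lam * \<CC> r)"
      by (rule flux_into_empty) (use r in \<open>auto simp: product_form_def simplex_int_def\<close>)
    then show "(\<Sum>u\<in>busy (Suc 0). product_form X \<Sigma> \<rho> r u * rate u []) = sum (source r) (busy (Suc 0))"
      using bal by (simp add: sum_source)
  qed
qed

text \<open>The sources depend on the vectors only through the sums over \<open>N\<close>, so the
  hypothesis compares the sources; \<open>visits_scale_le\<close> passes this to the occupation
  times and hence to their limits.\<close>

lemma product_form_comparison:
  assumes adm: "admissible_solution X \<Sigma> \<nu> lam \<mu> \<rho> r" "admissible_solution X \<Sigma> \<nu> lam \<mu> \<rho>' r'"
    and m: "\<And>a. a \<in> \<Sigma> \<Longrightarrow> m * sum r (N a) \<le> sum r' (N a)" and v: "v \<in> L" "v \<noteq> []"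
  shows "m * product_form X \<Sigma> \<rho> r v \<le> product_form X \<Sigma> \<rho>' r' v"
proof (rule LIMSEQ_le[OF tendsto_mult_left[OF visits_tendsto_product_form[OF adm(1) v]]
    visits_tendsto_product_form[OF adm(2) v]])
  have "m * source r u \<le> source r' u" for u
  proof (cases "length u = 1 \<and> hd u \<in> \<Sigma>")
    case True
    have "pmf \<nu> (hd u) * (m * sum r (N (hd u))) \<le> pmf \<nu> (hd u) * sum r' (N (hd u))"
      using m True by (intro mult_left_mono) auto
    then show ?thesis using True lam_pos by (simp add: source_def mult_ac)
  next
    case False
    \<comment> \<open>\<open>visits_scale_le\<close> asks for the comparison at all words; letters
      outside \<Sigma> have probability 0.\<close>
    then have "length u \<noteq> 1 \<or> pmf \<nu> (hd u) = 0" using supp by (auto simp: set_pmf_iff)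
    then show ?thesis by (auto simp: source_def)
  qed
  then show "\<exists>K. \<forall>k\<ge>K. m * visits (source r) k v \<le> visits (source r') k v"
    using visits_scale_le by blast
qed

text \<open>The largest \<open>m\<close> for which the sources compare. The letter at which the
  bound is attained supplies the contradiction in \<open>admissible_solution_unique\<close>.\<close>

lemma min_ratio:
  assumes r: "r \<in> simplex_int \<Sigma>" "r' \<in> simplex_int \<Sigma>"
  obtains m a where "0 < m" "\<And>b. b \<in> \<Sigma> \<Longrightarrow> m * sum r (N b) \<le> sum r' (N b)"
    "a \<in> \<Sigma>" "m * sum r (N a) = sum r' (N a)"
proof -
  let ?f = "\<lambda>a. sum r' (N a) / sum r (N a)"
  have p: "0 < sum r (N a)" "0 < sum r' (N a)" if "a \<in> \<Sigma>" for a
    using r_N_pos[OF r(1) zero_less_one that] r_N_pos[OF r(2) zero_less_one that] by auto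
  have "Min (?f ` \<Sigma>) \<in> ?f ` \<Sigma>" using finite_gens gens_nonempty by (intro Min_in) auto
  then obtain a where a: "a \<in> \<Sigma>" "Min (?f ` \<Sigma>) = ?f a" by auto
  have le: "?f a \<le> ?f b" if "b \<in> \<Sigma>" for b
    unfolding a(2)[symmetric] using that finite_gens by (intro Min_le) auto
  have "?f a * sum r (N b) \<le> sum r' (N b)" if "b \<in> \<Sigma>" for b
    by (rule pos_le_divide_eq[OF p(1)[OF that], THEN iffD1, OF le[OF that]])
  moreover have "0 < ?f a" "?f a * sum r (N a) = sum r' (N a)" using p[OF a(1)] by auto
  ultimately show ?thesis using that a(1) by blast
qed

text \<open>Summed over the words of length \<open>k\<close>, the comparison reads
  \<open>m * \<rho> ^ k \<le> \<rho>' ^ k\<close>, which fails for large \<open>k\<close> if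
  \<open>\<rho>' < \<rho>\<close>.\<close>

lemma admissible_load_le:
  assumes adm: "admissible_solution X \<Sigma> \<nu> lam \<mu> \<rho> r" "admissible_solution X \<Sigma> \<nu> lam \<mu> \<rho>' r'"
  shows "\<rho> \<le> \<rho>'"
proof (rule ccontr)
  assume "\<not> \<rho> \<le> \<rho>'"
  have r: "r \<in> simplex_int \<Sigma>" "r' \<in> simplex_int \<Sigma>" and rho: "0 < \<rho>" "0 < \<rho>'"
    using adm by (auto simp: admissible_solution_def)
  obtain m a where m: "0 < m" "\<And>b. b \<in> \<Sigma> \<Longrightarrow> m * sum r (N b) \<le> sum r' (N b)"
    using min_ratio[OF r] by metis
  have "m \<le> (\<rho>' / \<rho>) ^ Suc k" for k
  proof -
    have "m * \<rho> ^ Suc k = (\<Sum>v\<in>{v \<in> L. length v = Suc k}. m * product_form X \<Sigma> \<rho> r v)"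
      using sum_product_form_level[OF r(1) rho(1), of k] by (simp add: sum_distrib_left[symmetric])
    also have "\<dots> \<le> (\<Sum>v\<in>{v \<in> L. length v = Suc k}. product_form X \<Sigma> \<rho>' r' v)"
      by (intro sum_mono product_form_comparison[OF adm m(2)]) auto
    also have "\<dots> = \<rho>' ^ Suc k" by (rule sum_product_form_level[OF r(2) rho(2)])
    finally show ?thesis using rho by (simp add: power_divide pos_le_divide_eq del: power_Suc)
  qed
  moreover have "(\<lambda>k. (\<rho>' / \<rho>) ^ Suc k) \<longlonglongrightarrow> 0"
    by (intro LIMSEQ_Suc LIMSEQ_realpow_zero) (use rho \<open>\<not> \<rho> \<le> \<rho>'\<close> in auto)
  ultimately have "m \<le> 0" by (intro LIMSEQ_le_const[of _ 0 m]) auto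
  then show False using m(1) by simp
qed

text \<open>A strong minimum principle. For the minimal ratio \<open>m\<close> the difference
  \<open>D\<close> is nonnegative and again balanced, with source \<open>y\<close>. If
  \<open>y\<close> were positive at one letter, irreducibility would make it positive at all
  letters, against the equality at \<open>a0\<close>. Hence \<open>r' = m * r\<close> on \<Sigma>,
  and normalisation gives \<open>m = 1\<close>.\<close>

theorem admissible_solution_unique:
  assumes adm: "admissible_solution X \<Sigma> \<nu> lam \<mu> \<rho> r" "admissible_solution X \<Sigma> \<nu> lam \<mu> \<rho>' r'"
  shows "\<rho> = \<rho>' \<and> r = r'"
proof -
  have rho_eq: "\<rho>' = \<rho>" using admissible_load_le[OF adm] admissible_load_le[OF adm(2,1)] by simp
  have r: "r \<in> simplex_int \<Sigma>" "r' \<in> simplex_int \<Sigma>" and rho: "0 < \<rho>"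
    using adm by (auto simp: admissible_solution_def)
  obtain m a0 where m: "0 < m" "\<And>b. b \<in> \<Sigma> \<Longrightarrow> m * sum r (N b) \<le> sum r' (N b)"
    "a0 \<in> \<Sigma>" "m * sum r (N a0) = sum r' (N a0)"
    using min_ratio[OF r] by metis
  \<comment> \<open>Equal loads let both product forms use the same \<rho>, so that
    \<open>D [a]\<close> is a multiple of \<open>y a\<close>.\<close>
  let ?p = "product_form X \<Sigma> \<rho> r" and ?p' = "product_form X \<Sigma> \<rho> r'"
  define D where "D v = ?p' v - m * ?p v" for v
  define y where "y a = r' a - m * r a" for a
  have Dy: "D [a] = \<rho> * y a" for a by (simp add: D_def y_def product_form_def algebra_simps)
  have D0: "0 \<le> D v" if "v \<in> L" "v \<noteq> []" for v
    using product_form_comparison[OF adm m(2) that] by (simp add: D_def rho_eq)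
  have y0: "0 \<le> y a" if "a \<in> \<Sigma>" for a
    using D0[of "[a]"] that rho unfolding Dy by (simp add: L_Cons zero_le_mult_iff)
  have D_bal: "(\<Sum>u\<in>busy (Suc (length v)). D u * rate u v) + source y v = (lam + \<mu>) * D v"
    if v: "v \<in> L - {[]}" for v
  proof -
    have "balanced_at (source r) ?p v" "balanced_at (source r') ?p' v"
      using v admissible_iff[OF r(1) rho, THEN iffD1, OF adm(1)]
        admissible_iff[OF r(2) rho, THEN iffD1] adm(2) unfolding rho_eq by blast+
    then have 1: "(\<Sum>u\<in>busy (Suc (length v)). ?p u * rate u v) = (lam + \<mu>) * ?p v - source r v"
      and 2: "(\<Sum>u\<in>busy (Suc (length v)). ?p' u * rate u v) = (lam + \<mu>) * ?p' v - source r' v"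
      unfolding balanced_at_def by linarith+
    have "(\<Sum>u\<in>busy (Suc (length v)). D u * rate u v)
        = (\<Sum>u\<in>busy (Suc (length v)). ?p' u * rate u v) - m * (\<Sum>u\<in>busy (Suc (length v)). ?p u * rate u v)"
      by (simp add: D_def left_diff_distrib sum_subtractf sum_distrib_left mult.assoc)
    moreover have "source y v = source r' v - m * source r v"
      by (simp add: source_def y_def sum_subtractf sum_distrib_left[symmetric] algebra_simps)
    ultimately show ?thesis unfolding 1 2 by (simp add: D_def algebra_simps)
  qed
  have "{a \<in> \<Sigma>. 0 < y a} = {}"
  proof (rule ccontr)
    assume ne: "{a \<in> \<Sigma>. 0 < y a} \<noteq> {}"
    have pos: "0 < y a" if a: "a \<in> \<Sigma>" and gt: "0 < D u * rate u [a] \<or> 0 < source y [a]" and u: "u \<in> busy (Suc (Suc 0))" for a u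
    proof -
      have s0: "0 \<le> source y [a]" by (rule source_nonneg) (rule y0)
      have nn: "0 \<le> D u * rate u [a]" if "u \<in> busy (Suc (Suc 0))" for u
        using that D0 rate_nonneg by (auto simp: busy_def)
      then have "0 \<le> (\<Sum>u\<in>busy (Suc (Suc 0)). D u * rate u [a])" by (intro sum_nonneg)
      moreover have "D u * rate u [a] \<le> (\<Sum>u\<in>busy (Suc (Suc 0)). D u * rate u [a])"
        by (rule member_le_sum[OF u]) (use nn in auto)
      ultimately have "0 < (lam + \<mu>) * D [a]"
        using D_bal[of "[a]"] a gt s0 by (auto simp: L_Cons)
      then show ?thesis using lam_pos mu_pos rho unfolding Dy by (simp add: zero_less_mult_iff)
    qed
    have "{a \<in> \<Sigma>. 0 < y a} = \<Sigma>"
    proof (rule irreducible[OF _ ne])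
      fix a b assume a: "a \<in> set_pmf \<nu>" and b: "b \<in> N a" "b \<in> {a \<in> \<Sigma>. 0 < y a}"
      have as: "a \<in> \<Sigma>" using a supp by blast
      have "y b \<le> sum y (N a)" by (rule member_le_sum) (use b y0 N_sub in auto)
      then have "0 < source y [a]" using a b lam_pos by (simp add: source_def pmf_positive)
      then show "a \<in> {a \<in> \<Sigma>. 0 < y a}" using pos[OF as, of "[a]"] as by (simp add: busy_def L_Cons)
    next
      fix b d assume b: "b \<in> set_pmf \<nu>" and d: "d \<in> {a \<in> \<Sigma>. 0 < y a}" and bd: "b \<cdot> d \<in> \<Sigma>"
      have bs: "b \<in> \<Sigma>" using b supp by blast
      have "act b [d] = [b \<cdot> d]" using bd one_notin by (auto simp: act_def)
      then have "pmf \<nu> b \<le> (\<Sum>c\<in>\<Sigma>. pmf \<nu> c * of_bool (act c [d] = [b \<cdot> d]))"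
        using member_le_sum[of b \<Sigma> "\<lambda>c. pmf \<nu> c * of_bool (act c [d] = [b \<cdot> d])"] bs finite_gens by simp
      moreover have "0 < pmf \<nu> b" using b by (rule pmf_positive)
      ultimately have "0 < rate [d] [b \<cdot> d]"
        unfolding rate_def using lam_pos mu_pos by (intro add_pos_nonneg mult_pos_pos) auto
      moreover have "0 < D [d]" unfolding Dy using d rho by simp
      ultimately show "b \<cdot> d \<in> {a \<in> \<Sigma>. 0 < y a}"
        using pos[OF bd, of "[d]"] d bd by (simp add: busy_def L_Cons)
    qed auto
    then have "0 < y b" if "b \<in> \<Sigma>" for b using that by blast
    then have "0 < sum y (N a0)" using sum_N_pos[of y a0] m(3) by blast
    then show False using m(4) by (simp add: y_def sum_subtractf sum_distrib_left[symmetric])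
  qed
  then have y_zero: "r' a = m * r a" if "a \<in> \<Sigma>" for a
    using y0[OF that] that unfolding y_def by fastforce
  have "sum r' \<Sigma> = m * sum r \<Sigma>" using y_zero by (simp add: sum_distrib_left)
  then have "m = 1" using r by (simp add: simplex_int_def)
  have "r = r'"
  proof (rule extensionalityI)
    show "r \<in> extensional \<Sigma>" "r' \<in> extensional \<Sigma>" using r by (simp_all add: simplex_int_def PiE_def)
    show "r a = r' a" if "a \<in> \<Sigma>" for a using y_zero[OF that] \<open>m = 1\<close> by simp
  qed
  then show ?thesis using rho_eq by simp
qed

theorem admissible_solution_ex1: "\<exists>!(\<rho>, r). admissible_solution X \<Sigma> \<nu> lam \<mu> \<rho> r"
  using admissible_solution_exists admissible_solution_unique by fast

theorem null_vector_ex1: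
  "\<exists>!r. r \<in> simplex_int \<Sigma> \<and>
     (\<exists>\<rho>>0. null_vector L (product_form X \<Sigma> \<rho> r) (queue_generator X \<Sigma> \<nu> r lam \<mu>))"
proof -
  have "r \<in> simplex_int \<Sigma> \<and> (\<exists>\<rho>>0. null_vector L (product_form X \<Sigma> \<rho> r) (queue_generator X \<Sigma> \<nu> r lam \<mu>))
      \<longleftrightarrow> (\<exists>\<rho>. admissible_solution X \<Sigma> \<nu> lam \<mu> \<rho> r)" for r
    using null_vector_iff_admissible by (auto simp: admissible_solution_def)
  then show ?thesis using admissible_solution_exists admissible_solution_unique by metis
qed

end
end

section \<open>Random walk and drift\<close>

text \<open>Of \<open>nf\<close> it is only required that left multiplication by a letter becomes
  \<open>letter_act\<close>; the normal form of any product of letters is then built up letter by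
  letter, see \<open>foldr_letter_act\<close>.\<close>

locale word_normal_form = Group.monoid X for X :: "'m monoid" and \<Sigma> :: "'m set" and nf :: "'m \<Rightarrow> 'm list" +
  assumes finite_letters: "finite \<Sigma>"
    and letters_carrier: "\<Sigma> \<subseteq> carrier X"
    and one_not_letter: "\<one>\<^bsub>X\<^esub> \<notin> \<Sigma>"
    and nf_one: "nf \<one>\<^bsub>X\<^esub> = []"
    and nf_letter: "\<lbrakk>a \<in> \<Sigma>; x \<in> carrier X\<rbrakk> \<Longrightarrow> nf (a \<otimes>\<^bsub>X\<^esub> x) = letter_act X \<Sigma> a (nf x)"
begin

lemma word_prod_closed: "set w \<subseteq> \<Sigma> \<Longrightarrow> word_prod X w \<in> carrier X"
  by (induction w) (use letters_carrier in \<open>auto simp: word_prod_def\<close>)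

lemma word_prod_Cons: "word_prod X (a # w) = a \<otimes>\<^bsub>X\<^esub> word_prod X w"
  by (simp add: word_prod_def)

lemma word_prod_append:
  "set v \<subseteq> \<Sigma> \<Longrightarrow> set w \<subseteq> \<Sigma> \<Longrightarrow> word_prod X (v @ w) = word_prod X v \<otimes>\<^bsub>X\<^esub> word_prod X w"
proof (induction v)
  case Nil
  then show ?case using word_prod_closed[of w] by (simp add: word_prod_def)
next
  case (Cons a v)
  then show ?case using letters_carrier word_prod_closed[of v] word_prod_closed[of w]
    by (auto simp: word_prod_Cons m_assoc)
qed

lemma foldr_letter_act: "set w \<subseteq> \<Sigma> \<Longrightarrow> foldr (letter_act X \<Sigma>) w [] = nf (word_prod X w)"
proof (induction w)
  case Nil
  then show ?case by (simp add: word_prod_def nf_one)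
next
  case (Cons a w)
  then show ?case using word_prod_closed[of w] by (simp add: word_prod_Cons nf_letter)
qed

lemma word_prod_letter_act:
  assumes "b \<in> \<Sigma>" "set u \<subseteq> \<Sigma>"
  shows "word_prod X (letter_act X \<Sigma> b u) = b \<otimes>\<^bsub>X\<^esub> word_prod X u"
proof (cases u)
  case (Cons a w)
  then have "a \<in> carrier X" "b \<in> carrier X" "word_prod X w \<in> carrier X"
    using assms letters_carrier word_prod_closed by auto
  then show ?thesis using Cons m_assoc[of b a "word_prod X w"] by (auto simp: letter_act_def word_prod_Cons)
qed (use assms letters_carrier in \<open>auto simp: word_prod_def letter_act_def\<close>)

lemma set_letter_act: "b \<in> \<Sigma> \<Longrightarrow> set u \<subseteq> \<Sigma> \<Longrightarrow> set (letter_act X \<Sigma> b u) \<subseteq> \<Sigma>"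
  by (cases u) (auto simp: letter_act_def)

lemma length_foldr_letter_act: "length (foldr (letter_act X \<Sigma>) w u) \<le> length w + length u"
proof (induction w)
  case (Cons a w)
  have "length (letter_act X \<Sigma> a v) \<le> Suc (length v)" for v
    by (cases v) (auto simp: letter_act_def)
  from this[of "foldr (letter_act X \<Sigma>) w u"] Cons show ?case by simp
qed simp

text \<open>Reducing a word letter by letter never lengthens it; this is applied to a shortest
  representative. The inequality suffices, since the mean length is only to be bounded from
  above.\<close>

lemma length_nf_le:
  assumes "set w \<subseteq> \<Sigma>"
  shows "length (nf (word_prod X w)) \<le> word_length X \<Sigma> (word_prod X w)"
proof -
  let ?P = "\<lambda>k. \<exists>v\<in>lists \<Sigma>. length v = k \<and> word_prod X v = word_prod X w"
  have "?P (length w)" using assms by auto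
  then have "?P (word_length X \<Sigma> (word_prod X w))" unfolding word_length_def by (rule LeastI)
  then obtain v where v: "set v \<subseteq> \<Sigma>" "length v = word_length X \<Sigma> (word_prod X w)" "word_prod X v = word_prod X w"
    by auto
  have "length (foldr (letter_act X \<Sigma>) v []) \<le> length v" using length_foldr_letter_act[of v "[]"] by simp
  then show ?thesis using foldr_letter_act[OF v(1)] v(2,3) by simp
qed

lemma word_length_le:
  assumes "set w \<subseteq> \<Sigma>"
  shows "word_length X \<Sigma> (word_prod X w) \<le> length w"
  unfolding word_length_def by (rule Least_le) (use assms in auto)

text \<open>Normal forms are powers of a single letter, and the exponent sum \<open>h\<close> is the
  isomorphism. This recognises the infinite case with a disconnected \<open>Next\<close>
  graph.\<close>

lemma iso_integer_groupI:
  assumes letters: "\<Sigma> = {a, b}" "a \<noteq> b" and inverse: "a \<otimes>\<^bsub>X\<^esub> b = \<one>\<^bsub>X\<^esub>" "b \<otimes>\<^bsub>X\<^esub> a = \<one>\<^bsub>X\<^esub>"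
    and squares: "a \<otimes>\<^bsub>X\<^esub> a \<notin> \<Sigma> \<union> {\<one>\<^bsub>X\<^esub>}" "b \<otimes>\<^bsub>X\<^esub> b \<notin> \<Sigma> \<union> {\<one>\<^bsub>X\<^esub>}"
    and gen: "\<And>x. x \<in> carrier X \<Longrightarrow> \<exists>w. set w \<subseteq> \<Sigma> \<and> word_prod X w = x"
  shows "X \<cong> integer_group"
proof -
  define sg :: "'m \<Rightarrow> int" where "sg c = (if c = a then 1 else - 1)" for c
  define h where "h x = sum_list (map sg (nf x))" for x
  have power: "\<exists>n c. c \<in> \<Sigma> \<and> nf x = replicate n c" if x: "x \<in> carrier X" for x
  proof -
    have "\<exists>n c. c \<in> \<Sigma> \<and> nf (word_prod X w) = replicate n c" if "set w \<subseteq> \<Sigma>" for w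
      using that
    proof (induction w)
      case Nil
      then show ?case using letters by (intro exI[of _ 0]) (auto simp: word_prod_def nf_one)
    next
      case (Cons d w)
      then obtain n c where c: "c \<in> \<Sigma>" "nf (word_prod X w) = replicate n c" by auto
      have d: "d \<in> \<Sigma>" using Cons by simp
      have nf: "nf (word_prod X (d # w)) = letter_act X \<Sigma> d (replicate n c)"
        using Cons.prems c word_prod_closed[of w] by (simp add: word_prod_Cons nf_letter)
      show ?case
      proof (cases n)
        case 0
        then have "letter_act X \<Sigma> d (replicate n c) = replicate 1 d" by (simp add: letter_act_def)
        then show ?thesis using nf d by metis
      next
        case (Suc m)
        have "letter_act X \<Sigma> d (replicate n c) = (if d = c then replicate (Suc n) c else replicate m c)"
          using c d letters inverse squares Suc by (auto simp: letter_act_def)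
        then show ?thesis using nf c(1) by metis
      qed
    qed
    then show ?thesis using gen[OF x] by blast
  qed
  have h_letter: "h (c \<otimes>\<^bsub>X\<^esub> x) = sg c + h x" if c: "c \<in> \<Sigma>" and x: "x \<in> carrier X" for c x
  proof -
    obtain n d where d: "d \<in> \<Sigma>" "nf x = replicate n d" using power[OF x] by blast
    show ?thesis
    proof (cases n)
      case 0
      then show ?thesis using d by (simp add: h_def nf_letter[OF c x] letter_act_def)
    next
      case (Suc m)
      then show ?thesis using d c letters inverse squares
        by (auto simp: h_def nf_letter[OF c x] letter_act_def sg_def)
    qed
  qed
  have h_word: "h (word_prod X w \<otimes>\<^bsub>X\<^esub> y) = sum_list (map sg w) + h y" if "set w \<subseteq> \<Sigma>" and y: "y \<in> carrier X" for w y
    using that(1)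
  proof (induction w)
    case Nil
    then show ?case using y by (simp add: word_prod_def)
  next
    case (Cons c w)
    have "c \<in> carrier X" "word_prod X w \<in> carrier X" using Cons.prems letters_carrier word_prod_closed[of w] by auto
    then show ?case using Cons y by (simp add: word_prod_Cons m_assoc h_letter)
  qed
  have h_one: "h \<one>\<^bsub>X\<^esub> = 0" by (simp add: h_def nf_one)
  have h_prod: "h (word_prod X w) = sum_list (map sg w)" if "set w \<subseteq> \<Sigma>" for w
    using h_word[OF that one_closed] word_prod_closed[OF that] by (simp add: h_one)
  have nf_inverse: "word_prod X (nf x) = x" if x: "x \<in> carrier X" for x
  proof -
    have "word_prod X (nf (word_prod X w)) = word_prod X w \<and> set (nf (word_prod X w)) \<subseteq> \<Sigma>" if "set w \<subseteq> \<Sigma>" for w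
      using that
    proof (induction w)
      case (Cons c w)
      then show ?case using word_prod_closed[of w] set_letter_act
        by (simp add: word_prod_Cons nf_letter word_prod_letter_act)
    qed (simp add: word_prod_def nf_one)
    then show ?thesis using gen[OF x] by blast
  qed
  have "h \<in> hom X integer_group"
  proof (rule homI)
    fix x y assume "x \<in> carrier X" "y \<in> carrier X"
    then show "h (x \<otimes>\<^bsub>X\<^esub> y) = h x \<otimes>\<^bsub>integer_group\<^esub> h y"
      using gen[of x] h_word h_prod by auto
  qed simp
  moreover have "inj_on h (carrier X)"
  proof (rule inj_onI)
    fix x y assume xy: "x \<in> carrier X" "y \<in> carrier X" "h x = h y"
    obtain n c where c: "c \<in> \<Sigma>" "nf x = replicate n c" using power[OF xy(1)] by blast
    obtain m d where d: "d \<in> \<Sigma>" "nf y = replicate m d" using power[OF xy(2)] by blast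
    have "int n * sg c = int m * sg d" using xy(3) c d by (simp add: h_def sum_list_replicate)
    then have "n = m \<and> (c = d \<or> n = 0)"
      using c(1) d(1) letters by (auto simp: sg_def split: if_splits)
    then have "nf x = nf y" using c d by auto
    then show "x = y" using nf_inverse xy by metis
  qed
  moreover have "h ` carrier X = carrier integer_group"
  proof -
    have "z \<in> h ` carrier X" for z :: int
    proof -
      let ?w = "replicate (nat \<bar>z\<bar>) (if 0 \<le> z then a else b)"
      have w: "set ?w \<subseteq> \<Sigma>" using letters by auto
      have "h (word_prod X ?w) = z"
        unfolding h_prod[OF w] using letters by (auto simp: sg_def sum_list_replicate)
      then show ?thesis using word_prod_closed[OF w] by (metis imageI)
    qed
    then show ?thesis by auto
  qed
  ultimately show ?thesis by (auto simp: is_iso_def iso_def bij_betw_def)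
qed

text \<open>The point is irreducibility: \<open>connected\<close> involves all letters, whereas the
  closure of \<open>Z\<close> only involves steps in the support of \<nu>. As the support generates
  \<open>X\<close>, each letter is a product of support letters, and membership in \<open>Z\<close>
  is followed along its reduction.\<close>

lemma zero_automaticI:
  assumes Next_commute: "\<And>a b. \<lbrakk>a \<in> \<Sigma>; b \<in> Next X \<Sigma> a\<rbrakk> \<Longrightarrow> a \<in> Next X \<Sigma> b"
    and Next_mult: "\<And>a b. \<lbrakk>a \<in> \<Sigma>; b \<in> \<Sigma>; a \<otimes>\<^bsub>X\<^esub> b \<in> \<Sigma>\<rbrakk> \<Longrightarrow> Next X \<Sigma> (a \<otimes>\<^bsub>X\<^esub> b) = Next X \<Sigma> b"
    and connected: "\<And>Z. \<lbrakk>Z \<subseteq> \<Sigma>; Z \<noteq> {}; \<And>a. a \<in> Z \<Longrightarrow> Next X \<Sigma> a \<subseteq> Z\<rbrakk> \<Longrightarrow> Z = \<Sigma>"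
    and infinite_X: "infinite (carrier X)"
    and supp: "set_pmf \<nu> \<subseteq> \<Sigma>" and gen: "generates X (set_pmf \<nu>)"
  shows "zero_automatic X \<Sigma> \<nu>"
proof
  have word: "\<exists>w. set w \<subseteq> set_pmf \<nu> \<and> word_prod X w = x" if x: "x \<in> carrier X" for x
  proof -
    have "x \<in> word_prod X ` lists (set_pmf \<nu>)" using gen x by (simp add: generates_def)
    then show ?thesis by auto
  qed
  show "Next X \<Sigma> a \<noteq> {}" if a: "a \<in> \<Sigma>" for a
  proof
    \<comment> \<open>Then \<open>{a}\<close> is closed and thus equals \<Sigma>, and all products
      of letters are the unit or \<open>a\<close>, too few for an infinite monoid.\<close>
    assume empty: "Next X \<Sigma> a = {}"
    then have "{a} = \<Sigma>" using a by (intro connected) auto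
    have "word_prod X w \<in> {\<one>\<^bsub>X\<^esub>, a}" if "set w \<subseteq> \<Sigma>" for w
      using that
    proof (induction w)
      case (Cons b w)
      have ac: "a \<in> carrier X" using a letters_carrier by blast
      have "a \<otimes>\<^bsub>X\<^esub> a \<in> \<Sigma> \<union> {\<one>\<^bsub>X\<^esub>}" using empty a by (auto simp: Next_def)
      then show ?case using Cons \<open>{a} = \<Sigma>\<close> ac by (auto simp: word_prod_Cons)
    qed (simp add: word_prod_def)
    then have "carrier X \<subseteq> {\<one>\<^bsub>X\<^esub>, a}" using word supp by blast
    then show False using infinite_X finite_subset by blast
  qed
  fix Z
  assume Z: "Z \<subseteq> \<Sigma>" "Z \<noteq> {}"
    and push: "\<And>a b. \<lbrakk>a \<in> set_pmf \<nu>; b \<in> Next X \<Sigma> a; b \<in> Z\<rbrakk> \<Longrightarrow> a \<in> Z"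
    and swap: "\<And>b d. \<lbrakk>b \<in> set_pmf \<nu>; d \<in> Z; b \<otimes>\<^bsub>X\<^esub> d \<in> \<Sigma>\<rbrakk> \<Longrightarrow> b \<otimes>\<^bsub>X\<^esub> d \<in> Z"
  show "Z = \<Sigma>"
  proof (rule connected[OF Z], rule subsetI)
    fix f a assume f: "f \<in> Z" and a: "a \<in> Next X \<Sigma> f"
    have aS: "a \<in> \<Sigma>" and fS: "f \<in> \<Sigma>" using a f Z by (auto simp: Next_def)
    \<comment> \<open>The invariant of the reduction: every letter \<open>c\<close> with
      \<open>f \<in> Next X \<Sigma> c\<close> lies in \<open>Z\<close>. A pushed letter satisfies
      it by \<open>push\<close> against \<open>f\<close>; merging preserves it because the product
      has the same \<open>Next\<close> as the old letter. For a word representing \<open>a\<close>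
      the reduction ends in \<open>[a]\<close>.\<close>
    have letters: "\<forall>c\<in>set (foldr (letter_act X \<Sigma>) w []). c \<in> \<Sigma> \<and> (f \<in> Next X \<Sigma> c \<longrightarrow> c \<in> Z)"
      if "set w \<subseteq> set_pmf \<nu>" for w
      using that
    proof (induction w)
      case (Cons b w)
      then have b: "b \<in> set_pmf \<nu>" "b \<in> \<Sigma>" using supp by auto
      let ?u = "foldr (letter_act X \<Sigma>) w []"
      have IH: "\<forall>c\<in>set ?u. c \<in> \<Sigma> \<and> (f \<in> Next X \<Sigma> c \<longrightarrow> c \<in> Z)" using Cons by simp
      have bZ: "f \<in> Next X \<Sigma> b \<longrightarrow> b \<in> Z" using push[OF b(1) _ f] by blast
      show ?case
      proof (cases ?u)
        case Nil
        then show ?thesis using b bZ by (simp add: letter_act_def[of X \<Sigma> b])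
      next
        case (Cons d u)
        have d: "d \<in> \<Sigma>" "f \<in> Next X \<Sigma> d \<longrightarrow> d \<in> Z" using IH Cons by auto
        have "b \<otimes>\<^bsub>X\<^esub> d \<in> \<Sigma> \<Longrightarrow> f \<in> Next X \<Sigma> (b \<otimes>\<^bsub>X\<^esub> d) \<longrightarrow> b \<otimes>\<^bsub>X\<^esub> d \<in> Z"
          using Next_mult[OF b(2) d(1)] d(2) swap[OF b(1)] by simp
        then show ?thesis using IH Cons b bZ d by (simp add: letter_act_def[of X \<Sigma> b])
      qed
    qed simp
    obtain w where w: "set w \<subseteq> set_pmf \<nu>" "word_prod X w = a"
      using word aS letters_carrier by blast
    have "nf a = [a]"
      using nf_letter[OF aS one_closed] aS letters_carrier by (auto simp: nf_one letter_act_def)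
    then have "foldr (letter_act X \<Sigma>) w [] = [a]"
      using foldr_letter_act[of w] w supp by auto
    then show "a \<in> Z" using letters[OF w(1)] Next_commute[OF fS a] by simp
  qed
qed (use finite_letters one_not_letter Next_commute Next_mult supp in blast)+

end

section \<open>Mean length and the drift of the random walk\<close>

locale zero_automatic_normal_form = zero_automatic X \<Sigma> \<nu> + word_normal_form X \<Sigma> nf
  for X :: "'m monoid" and \<Sigma> \<nu> nf
begin

lemma foldr_act_normal: "x \<in> L \<Longrightarrow> foldr act x [] = x"
proof (induction x)
  case (Cons a w)
  then show ?case
    using N_sym[of a] N_sub by (cases w) (auto simp: L_Cons act_def in_N_iff)
qed simp

lemma foldr_act_append_nf:
  assumes "x \<in> L" "u \<in> L"
  shows "foldr act x u = nf (word_prod X x \<cdot> word_prod X u)"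
proof -
  have s: "set x \<subseteq> \<Sigma>" "set u \<subseteq> \<Sigma>" using assms L_sub_lists by auto
  have "foldr act x u = foldr act (x @ u) []" using foldr_act_normal[OF assms(2)] by simp
  also have "\<dots> = nf (word_prod X (x @ u))" using s by (intro foldr_letter_act) auto
  finally show ?thesis using word_prod_append[OF s] by simp
qed

text \<open>Associativity in \<open>X\<close>, transported by \<open>nf\<close>.\<close>

lemma act_foldr_act:
  assumes "b \<in> \<Sigma>" "x \<in> L" "u \<in> L"
  shows "act b (foldr act x u) = foldr act (act b x) u"
proof -
  have c: "b \<in> carrier X" "word_prod X x \<in> carrier X" "word_prod X u \<in> carrier X"
    using assms letters_carrier word_prod_closed L_sub_lists by auto
  show ?thesis
    using assms c foldr_act_append_nf[of x u] foldr_act_append_nf[OF act_closed[OF assms(1,2)] assms(3)]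
    by (simp add: word_prod_letter_act L_sub_lists m_assoc nf_letter)
qed

text \<open>The induction needs a general \<open>x\<close>; the case \<open>x = []\<close> compares
  the walk started at \<open>u\<close> with the one started at the empty word.\<close>

lemma mean_length_subadditive:
  assumes "x \<in> L" "u \<in> L"
  shows "mean_length k (foldr act x u) \<le> mean_length k x + real (length u)"
  using assms
proof (induction k arbitrary: x)
  case 0
  then show ?case using length_foldr_letter_act[of x u] by simp
next
  case (Suc k)
  have "mean_length (Suc k) (foldr act x u) \<le> (\<Sum>b\<in>\<Sigma>. pmf \<nu> b * (mean_length k (act b x) + real (length u)))"
    unfolding mean_length.simps(2)
    by (intro sum_mono mult_left_mono) (use Suc act_closed act_foldr_act in auto)
  also have "\<dots> = mean_length (Suc k) x + real (length u)"
    by (simp add: distrib_left sum.distrib sum_distrib_right[symmetric] sum_nu)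
  finally show ?case .
qed

definition words :: "nat \<Rightarrow> 'm list set" where
  "words k = {w. set w \<subseteq> \<Sigma> \<and> length w = k}"

definition word_mean :: "nat \<Rightarrow> ('m list \<Rightarrow> real) \<Rightarrow> real" where
  "word_mean k g = (\<Sum>w\<in>words k. (\<Prod>i<k. pmf \<nu> (w ! i)) * g w)"

lemma finite_words: "finite (words k)"
  unfolding words_def using finite_lists_length_eq[OF finite_gens] .

text \<open>The new letter is appended at the end because \<open>foldr\<close> lets the last letter
  act first. In this order the left multiplications of \<open>mean_length\<close> produce the normal
  form of \<open>word_prod X w\<close>.\<close>

lemma word_mean_Suc: "word_mean (Suc k) g = (\<Sum>b\<in>\<Sigma>. pmf \<nu> b * word_mean k (\<lambda>w. g (w @ [b])))"
proof -
  have "words (Suc k) = (\<lambda>(b, w). w @ [b]) ` (\<Sigma> \<times> words k)"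
  proof (intro equalityI subsetI)
    fix v assume "v \<in> words (Suc k)"
    then show "v \<in> (\<lambda>(b, w). w @ [b]) ` (\<Sigma> \<times> words k)"
      by (cases v rule: rev_cases) (auto simp: words_def image_iff)
  qed (auto simp: words_def)
  then have "word_mean (Suc k) g = (\<Sum>p\<in>\<Sigma> \<times> words k. (\<Prod>i<Suc k. pmf \<nu> ((snd p @ [fst p]) ! i)) * g (snd p @ [fst p]))"
    unfolding word_mean_def by (simp only:) (subst sum.reindex; auto simp: inj_on_def case_prod_beta)
  also have "\<dots> = (\<Sum>p\<in>\<Sigma> \<times> words k. pmf \<nu> (fst p) * ((\<Prod>i<k. pmf \<nu> (snd p ! i)) * g (snd p @ [fst p])))"
    by (intro sum.cong refl) (auto simp: words_def nth_append)
  finally show ?thesis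
    by (simp add: word_mean_def sum_distrib_left sum.cartesian_product case_prod_beta)
qed

lemma mean_length_word_mean: "mean_length k u = word_mean k (\<lambda>w. real (length (foldr act w u)))"
proof (induction k arbitrary: u)
  case 0
  have "words 0 = {[]}" by (auto simp: words_def)
  then show ?case by (simp add: word_mean_def)
qed (simp add: word_mean_Suc)

lemma mean_length_le: "mean_length k [] \<le> word_mean k (\<lambda>w. real (word_length X \<Sigma> (word_prod X w)))"
  unfolding mean_length_word_mean word_mean_def
  by (intro sum_mono mult_left_mono prod_nonneg)
    (auto simp: words_def foldr_letter_act length_nf_le)

text \<open>Dominated convergence: \<open>k\<close> letters have a product of length at most
  \<open>k\<close>, so the almost sure limit is also the limit of the means.\<close>

lemma word_mean_tendsto_drift:
  assumes "is_drift X \<Sigma> \<nu> \<gamma>"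
  shows "(\<lambda>k. word_mean k (\<lambda>w. real (word_length X \<Sigma> (word_prod X w))) / real k) \<longlonglongrightarrow> \<gamma>"
proof -
  define P where "P = (\<Pi>\<^sub>M i\<in>(UNIV :: nat set). measure_pmf \<nu>)"
  interpret product_prob_space "\<lambda>_ :: nat. measure_pmf \<nu>" UNIV ..
  have P: "prob_space P" unfolding P_def by (rule prob_space_axioms)
  interpret PP: prob_space P by (rule P)
  let ?len = "\<lambda>w. real (word_length X \<Sigma> (word_prod X w))"
  define cyl where "cyl w = prod_emb UNIV (\<lambda>_. measure_pmf \<nu>) {..<length w} (\<Pi>\<^sub>E i\<in>{..<length w}. {w ! i})" for w :: "'m list"
  have cyl_sets: "cyl w \<in> sets P" for w
    unfolding cyl_def P_def by (rule sets_PiM_I) auto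
  have cyl_measure: "measure P (cyl w) = (\<Prod>i<length w. pmf \<nu> (w ! i))" for w
    unfolding cyl_def P_def by (subst measure_PiM_emb) (auto simp: pmf.rep_eq)
  have cyl_iff: "x \<in> cyl w \<longleftrightarrow> map x [0..<k] = w" if "length w = k" for x w k
    using that by (auto simp: cyl_def prod_emb_def PiE_iff list_eq_iff_nth_eq)
  \<comment> \<open>A cylinder sum rather than the length itself, which need not be measurable when the type
    of the letters is uncountable.\<close>
  define G where "G k x = (\<Sum>w\<in>words k. ?len w * indicator (cyl w) x) / real k" for k and x :: "nat \<Rightarrow> 'm"
  have G_meas: "G k \<in> borel_measurable P" for k
    unfolding G_def by (intro borel_measurable_divide borel_measurable_sum borel_measurable_times
        borel_measurable_const borel_measurable_indicator cyl_sets)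
  have G_int: "integral\<^sup>L P (G k) = word_mean k ?len / real k" for k
  proof -
    have "integral\<^sup>L P (G k) = (\<Sum>w\<in>words k. ?len w * measure P (cyl w)) / real k"
      unfolding G_def using cyl_sets by (simp add: PP.emeasure_eq_measure)
    also have "(\<Sum>w\<in>words k. ?len w * measure P (cyl w)) = word_mean k ?len"
      unfolding word_mean_def cyl_measure by (intro sum.cong refl) (auto simp: words_def)
    finally show ?thesis .
  qed
  have "AE x in P. x i \<in> \<Sigma>" for i
    unfolding P_def
    by (rule AE_PiM_component) (use supp in \<open>auto simp: AE_measure_pmf_iff prob_space_measure_pmf\<close>)
  then have letters: "AE x in P. \<forall>i. x i \<in> \<Sigma>" by (simp add: AE_all_countable)
  have G_eq: "G k x = ?len (map x [0..<k]) / real k" if x: "\<forall>i. x i \<in> \<Sigma>" for k x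
  proof -
    have "(\<Sum>w\<in>words k. ?len w * indicator (cyl w) x) = (\<Sum>w\<in>{map x [0..<k]}. ?len w * indicator (cyl w) x)"
      by (rule sum.mono_neutral_right[OF finite_words]) (use x in \<open>auto simp: words_def cyl_iff indicator_def\<close>)
    also have "\<dots> = ?len (map x [0..<k])" by (simp add: cyl_iff)
    finally show ?thesis by (simp add: G_def)
  qed
  have lim: "AE x in P. (\<lambda>k. G k x) \<longlonglongrightarrow> \<gamma>"
    using assms letters unfolding is_drift_def P_def[symmetric] by eventually_elim (simp add: G_eq)
  have bound: "AE x in P. norm (G k x) \<le> 1" for k
    using letters
  proof eventually_elim
    case (elim x)
    then have "word_length X \<Sigma> (word_prod X (map x [0..<k])) \<le> k"
      using word_length_le[of "map x [0..<k]"] by auto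
    then show ?case unfolding G_eq[OF elim] by (auto simp: divide_le_eq_1)
  qed
  have "(\<lambda>k. integral\<^sup>L P (G k)) \<longlonglongrightarrow> integral\<^sup>L P (\<lambda>_. \<gamma>)"
    by (rule integral_dominated_convergence[where w = "\<lambda>_. 1"]) (use lim bound G_meas in auto)
  then show ?thesis by (simp add: G_int PP.prob_space)
qed

lemma eventually_drift_condition:
  assumes "is_drift X \<Sigma> \<nu> \<gamma>" "0 < lam" "lam * \<gamma> < \<mu>"
  obtains n where "lam * mean_length n [] < \<mu> * real n"
proof -
  let ?g = "\<lambda>w. real (word_length X \<Sigma> (word_prod X w))"
  have "(\<lambda>k. lam * (word_mean k ?g / real k)) \<longlonglongrightarrow> lam * \<gamma>"
    by (intro tendsto_intros word_mean_tendsto_drift assms)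
  then have "eventually (\<lambda>k. lam * (word_mean k ?g / real k) < \<mu>) sequentially"
    using assms(3) by (rule order_tendstoD)
  then obtain K where K: "\<And>k. k \<ge> K \<Longrightarrow> lam * (word_mean k ?g / real k) < \<mu>"
    by (auto simp: eventually_sequentially)
  \<comment> \<open>The index \<open>Suc K\<close> makes the division one by a positive
    number.\<close>
  have "lam * (word_mean (Suc K) ?g / real (Suc K)) < \<mu>" by (rule K) simp
  then have "lam * word_mean (Suc K) ?g < \<mu> * real (Suc K)"
    by (simp add: pos_divide_less_eq)
  moreover have "lam * mean_length (Suc K) [] \<le> lam * word_mean (Suc K) ?g"
    using mean_length_le[of "Suc K"] assms(2) by (intro mult_left_mono) (auto simp del: mean_length.simps)
  ultimately show ?thesis using that[of "Suc K"] by (simp del: mean_length.simps)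
qed

theorem unique_solutions:
  assumes "is_drift X \<Sigma> \<nu> \<gamma>" "0 < lam" "0 < \<mu>" "lam * \<gamma> < \<mu>"
  shows "(\<exists>!(\<rho>, r). admissible_solution X \<Sigma> \<nu> lam \<mu> \<rho> r)
       \<and> (\<exists>!r. r \<in> simplex_int \<Sigma> \<and>
            (\<exists>\<rho>>0. null_vector L (product_form X \<Sigma> \<rho> r) (queue_generator X \<Sigma> \<nu> r lam \<mu>)))"
proof -
  interpret zero_automatic_queue X \<Sigma> \<nu> lam \<mu>
    by unfold_locales (use assms in auto)
  obtain n where n: "lam * mean_length n [] < \<mu> * real n"
    using eventually_drift_condition[OF assms(1,2,4)] by blast
  have "mean_length n u \<le> mean_length n [] + real (length u)" if "u \<in> L" for u
    using mean_length_subadditive[OF L_Nil that] by simp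
  then show ?thesis
    using admissible_solution_ex1[OF n] null_vector_ex1[OF n] by blast
qed

end

section \<open>Normal forms in plain monoids\<close>

lemma copy_mult:
  assumes "inj f" "x \<in> carrier G" "y \<in> carrier G"
  shows "f x \<otimes>\<^bsub>copy_monoid f G\<^esub> f y = f (x \<otimes>\<^bsub>G\<^esub> y)"
  using assms by (simp add: copy_monoid_def inj_on_subset[OF assms(1)] inv_into_f_f)

lemma copy_one: "\<one>\<^bsub>copy_monoid f G\<^esub> = f \<one>\<^bsub>G\<^esub>"
  by (simp add: copy_monoid_def)

lemma copy_carrier: "carrier (copy_monoid f G) = f ` carrier G"
  by (simp add: copy_monoid_def)

lemma monoid_copy:
  assumes "inj f" "Group.monoid G"
  shows "Group.monoid (copy_monoid f G)"
proof -
  interpret Group.monoid G by fact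
  show ?thesis
    by (rule monoidI) (auto simp: copy_mult[OF assms(1)] copy_one copy_carrier m_assoc)
qed

lemma monoid_free_monoid: "Group.monoid (free_monoid S)"
  by (rule monoidI) (auto simp: free_monoid_def)

definition fg_reduced :: "('t \<times> bool) list \<Rightarrow> bool" where
  "fg_reduced = successively (\<lambda>a b. \<not> (fst a = fst b \<and> snd a \<noteq> snd b))"

lemma carrier_free_group: "carrier (free_group T) = {w. set w \<subseteq> T \<times> UNIV \<and> fg_reduced w}"
  by (auto simp: free_group_def fg_reduced_def)

lemma fg_reduced_Cons: "fg_reduced (a # w) \<longleftrightarrow> fg_reduced w \<and> (w = [] \<or> \<not> (fst a = fst (hd w) \<and> snd a \<noteq> snd (hd w)))"
  by (cases w) (auto simp: fg_reduced_def)

lemma fg_reduced_Nil [simp]: "fg_reduced []"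
  by (simp add: fg_reduced_def)

lemma fg_cons_reduced: "fg_reduced w \<Longrightarrow> fg_reduced (fg_cons a w)"
  by (cases w) (auto simp: fg_reduced_Cons)

lemma set_fg_cons: "set (fg_cons a w) \<subseteq> insert a (set w)"
  by (cases w) auto

text \<open>If \<open>b\<close> cancels the head of \<open>w\<close>, that head is \<open>a\<close>
  and is put back; otherwise \<open>a\<close> cancels the \<open>b\<close> just placed.
  Associativity in the free group rests on this.\<close>

lemma fg_cons_cancel:
  assumes "fg_reduced w" "fst a = fst b" "snd a \<noteq> snd b"
  shows "fg_cons a (fg_cons b w) = w"
proof (cases w)
  case (Cons c v)
  show ?thesis
  proof (cases "fst b = fst c \<and> snd b \<noteq> snd c")
    case True
    then have "a = c" using assms by (auto simp: prod_eq_iff)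
    then show ?thesis using Cons True assms by (cases v) (auto simp: fg_reduced_Cons)
  next
    case False
    then show ?thesis using Cons assms by auto
  qed
qed (use assms in auto)

lemma foldr_fg_reduced: "fg_reduced v \<Longrightarrow> fg_reduced (foldr fg_cons u v)"
  by (induction u) (auto intro: fg_cons_reduced)

lemma foldr_fg_cons:
  assumes "fg_reduced v"
  shows "foldr fg_cons (fg_cons a u) v = fg_cons a (foldr fg_cons u v)"
  by (cases u) (use fg_cons_cancel[OF foldr_fg_reduced[OF assms]] in auto)

lemma monoid_free_group:
  fixes T :: "'t set"
  shows "Group.monoid (free_group T)"
proof (rule monoidI)
  have r: "foldr fg_cons u [] = u" if "fg_reduced u" for u :: "('t \<times> bool) list"
    using that
  proof (induction u)
    case (Cons a u)
    then show ?case by (cases u) (auto simp: fg_reduced_Cons)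
  qed simp
  have set_foldr: "set (foldr fg_cons u v) \<subseteq> set u \<union> set v" for u v :: "('t \<times> bool) list"
  proof (induction u)
    case (Cons a u)
    then show ?case using set_fg_cons[of a "foldr fg_cons u v"] by auto
  qed simp
  have m: "u \<otimes>\<^bsub>free_group T\<^esub> v = foldr fg_cons u v" for u v :: "('t \<times> bool) list"
    by (simp add: free_group_def)
  have o: "\<one>\<^bsub>free_group T\<^esub> = []" by (simp add: free_group_def)
  fix u v w
  assume u: "u \<in> carrier (free_group T)"
  show "u \<otimes>\<^bsub>free_group T\<^esub> \<one>\<^bsub>free_group T\<^esub> = u"
    using u r by (simp add: m o carrier_free_group)
  assume v: "v \<in> carrier (free_group T)"
  show "u \<otimes>\<^bsub>free_group T\<^esub> v \<in> carrier (free_group T)"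
    using u v set_foldr[of u v] foldr_fg_reduced[of v u] by (auto simp: m carrier_free_group)
  assume w: "w \<in> carrier (free_group T)"
  have "foldr fg_cons (foldr fg_cons u v) w = foldr fg_cons u (foldr fg_cons v w)"
    by (induction u) (use w in \<open>auto simp: foldr_fg_cons carrier_free_group\<close>)
  then show "u \<otimes>\<^bsub>free_group T\<^esub> v \<otimes>\<^bsub>free_group T\<^esub> w = u \<otimes>\<^bsub>free_group T\<^esub> (v \<otimes>\<^bsub>free_group T\<^esub> w)"
    by (simp add: m)
qed (auto simp: free_group_def)

text \<open>A syllable of the free product may be a long word in a free factor, whereas \<Sigma> has
  only its generators; elements of a finite factor already are single letters.\<close>

fun letters_of :: "factor_idx \<times> ('s, 't, 'x) factor_elt \<Rightarrow> ('s, 't, 'x) plain_elt list" where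
  "letters_of (i, FreeMonElt ss) = map (\<lambda>s. [(i, FreeMonElt [s])]) ss"
| "letters_of (i, FreeGrpElt ts) = map (\<lambda>t. [(i, FreeGrpElt [t])]) ts"
| "letters_of (i, FinElt x) = [[(i, FinElt x)]]"

definition plain_nf :: "('s, 't, 'x) plain_elt \<Rightarrow> ('s, 't, 'x) plain_elt list" where
  "plain_nf w = concat (map letters_of w)"

text \<open>By \<open>Next_iff\<close> this is the complement of \<open>Next\<close> on letters, in
  a form whose symmetry is evident.\<close>

definition clash :: "('s, 't, 'x) plain_elt \<Rightarrow> ('s, 't, 'x) plain_elt \<Rightarrow> bool" where
  "clash a b \<longleftrightarrow> (\<exists>i x y. a = [(FinIdx i, FinElt x)] \<and> b = [(FinIdx i, FinElt y)])
     \<or> (\<exists>t \<beta>. a = [(FreeGrpIdx, FreeGrpElt [(t, \<beta>)])] \<and> b = [(FreeGrpIdx, FreeGrpElt [(t, \<not> \<beta>)])])"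

lemma clash_sym: "clash a b \<Longrightarrow> clash b a"
  by (auto simp: clash_def)

section \<open>Letters and clashes in a plain monoid\<close>

locale plain =
  fixes S :: "'s set" and T :: "'t set" and k :: nat and M :: "nat \<Rightarrow> 'x monoid"
  assumes finite_S: "finite S" and finite_T: "finite T"
    and M: "\<And>i. i \<in> {1..k} \<Longrightarrow> Group.monoid (M i)" "\<And>i. i \<in> {1..k} \<Longrightarrow> finite (carrier (M i))"
begin

abbreviation "I \<equiv> {FreeMonIdx, FreeGrpIdx} \<union> FinIdx ` {1..k}"
abbreviation "G \<equiv> plain_factor S T M"
abbreviation "X \<equiv> plain_monoid S T k M"
abbreviation "\<Sigma> \<equiv> plain_gens S T k M"

lemma monoid_factor: "i \<in> I \<Longrightarrow> Group.monoid (G i)"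
  by (auto intro!: monoid_copy monoid_free_monoid monoid_free_group M simp: inj_def)

lemma monoid_X: "Group.monoid X"
  unfolding plain_monoid_def by (rule monoid_free_product) (rule monoid_factor)

lemma factor_one:
  "\<one>\<^bsub>G FreeMonIdx\<^esub> = FreeMonElt []" "\<one>\<^bsub>G FreeGrpIdx\<^esub> = FreeGrpElt []" "\<one>\<^bsub>G (FinIdx i)\<^esub> = FinElt \<one>\<^bsub>M i\<^esub>"
  by (simp_all add: copy_one free_monoid_def free_group_def)

lemma factor_mult:
  "set ss \<subseteq> S \<Longrightarrow> set ss' \<subseteq> S \<Longrightarrow> FreeMonElt ss \<otimes>\<^bsub>G FreeMonIdx\<^esub> FreeMonElt ss' = FreeMonElt (ss @ ss')"
  "fst \<tau> \<in> T \<Longrightarrow> set ts \<subseteq> T \<times> UNIV \<Longrightarrow> fg_reduced ts \<Longrightarrow>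
     FreeGrpElt [\<tau>] \<otimes>\<^bsub>G FreeGrpIdx\<^esub> FreeGrpElt ts = FreeGrpElt (fg_cons \<tau> ts)"
  "x \<in> carrier (M i) \<Longrightarrow> y \<in> carrier (M i) \<Longrightarrow> FinElt x \<otimes>\<^bsub>G (FinIdx i)\<^esub> FinElt y = FinElt (x \<otimes>\<^bsub>M i\<^esub> y)"
proof -
  show "FreeMonElt ss \<otimes>\<^bsub>G FreeMonIdx\<^esub> FreeMonElt ss' = FreeMonElt (ss @ ss')" if "set ss \<subseteq> S" "set ss' \<subseteq> S"
    using that by (simp add: copy_mult inj_def free_monoid_def in_lists_conv_set subset_eq)
  show "FreeGrpElt [\<tau>] \<otimes>\<^bsub>G FreeGrpIdx\<^esub> FreeGrpElt ts = FreeGrpElt (fg_cons \<tau> ts)"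
    if "fst \<tau> \<in> T" "set ts \<subseteq> T \<times> UNIV" "fg_reduced ts"
  proof -
    have "[\<tau>] \<in> carrier (free_group T)" "ts \<in> carrier (free_group T)"
      using that by (auto simp: carrier_free_group fg_reduced_Cons mem_Times_iff)
    then have "FreeGrpElt [\<tau>] \<otimes>\<^bsub>G FreeGrpIdx\<^esub> FreeGrpElt ts = FreeGrpElt ([\<tau>] \<otimes>\<^bsub>free_group T\<^esub> ts)"
      by (simp add: copy_mult inj_def)
    then show ?thesis by (simp add: free_group_def)
  qed
  show "FinElt x \<otimes>\<^bsub>G (FinIdx i)\<^esub> FinElt y = FinElt (x \<otimes>\<^bsub>M i\<^esub> y)" if "x \<in> carrier (M i)" "y \<in> carrier (M i)"
    using that by (simp add: copy_mult inj_def)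
qed

lemma X_one: "\<one>\<^bsub>X\<^esub> = []"
  by (simp add: plain_monoid_def fp_one)

lemma X_mult: "[(i, g)] \<otimes>\<^bsub>X\<^esub> w = fp_cons G (i, g) w"
  by (simp add: plain_monoid_def fp_mult)

lemma gens_iff:
  "a \<in> \<Sigma> \<longleftrightarrow> (\<exists>s\<in>S. a = [(FreeMonIdx, FreeMonElt [s])])
    \<or> (\<exists>t\<in>T. \<exists>\<beta>. a = [(FreeGrpIdx, FreeGrpElt [(t, \<beta>)])])
    \<or> (\<exists>i\<in>{1..k}. \<exists>x\<in>carrier (M i). x \<noteq> \<one>\<^bsub>M i\<^esub> \<and> a = [(FinIdx i, FinElt x)])"
proof -
  have "fp_incl G FreeMonIdx (FreeMonElt [s]) = [(FreeMonIdx, FreeMonElt [s])]" for s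
    unfolding fp_incl_def factor_one by simp
  moreover have "fp_incl G FreeGrpIdx (FreeGrpElt [t]) = [(FreeGrpIdx, FreeGrpElt [t])]" for t
    unfolding fp_incl_def factor_one by simp
  moreover have "fp_incl G (FinIdx i) (FinElt x) = [(FinIdx i, FinElt x)]" if "x \<noteq> \<one>\<^bsub>M i\<^esub>" for i x
    unfolding fp_incl_def factor_one using that by simp
  moreover have "(\<exists>\<beta>. a = [(FreeGrpIdx, FreeGrpElt [(t, \<beta>)])])
      \<longleftrightarrow> a = [(FreeGrpIdx, FreeGrpElt [(t, True)])] \<or> a = [(FreeGrpIdx, FreeGrpElt [(t, False)])]" for t
    by (metis (full_types))
  ultimately show ?thesis
    unfolding plain_gens_def Let_def by (auto simp: image_iff)
qed

lemma gens_cases: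
  assumes "a \<in> \<Sigma>"
  obtains (mon) s where "s \<in> S" "a = [(FreeMonIdx, FreeMonElt [s])]"
    | (grp) t \<beta> where "t \<in> T" "a = [(FreeGrpIdx, FreeGrpElt [(t, \<beta>)])]"
    | (fin) i x where "i \<in> {1..k}" "x \<in> carrier (M i)" "x \<noteq> \<one>\<^bsub>M i\<^esub>" "a = [(FinIdx i, FinElt x)]"
  using assms unfolding gens_iff by blast

lemma gens_length: "a \<in> \<Sigma> \<Longrightarrow> length a = 1"
  by (erule gens_cases) auto

lemma finite_gens: "finite \<Sigma>"
  unfolding plain_gens_def Let_def using finite_S finite_T M(2) by auto

lemma carrier_Cons: "(i, g) # w \<in> carrier X \<longleftrightarrow>
   i \<in> I \<and> g \<in> carrier (G i) \<and> g \<noteq> \<one>\<^bsub>G i\<^esub> \<and> w \<in> carrier X \<and> (w = [] \<or> fst (hd w) \<noteq> i)"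
  unfolding plain_monoid_def by (rule fp_carrier_Cons)

lemma carrier_Cons_cases:
  assumes "(i, g) # w \<in> carrier X"
  obtains (mon) s ss where "i = FreeMonIdx" "g = FreeMonElt (s # ss)" "s \<in> S" "set ss \<subseteq> S"
    | (grp) \<tau> ts where "i = FreeGrpIdx" "g = FreeGrpElt (\<tau> # ts)" "fst \<tau> \<in> T" "set ts \<subseteq> T \<times> UNIV" "fg_reduced (\<tau> # ts)"
    | (fin) j x where "i = FinIdx j" "j \<in> {1..k}" "g = FinElt x" "x \<in> carrier (M j)" "x \<noteq> \<one>\<^bsub>M j\<^esub>"
proof -
  have ig: "i \<in> I" "g \<in> carrier (G i)" "g \<noteq> \<one>\<^bsub>G i\<^esub>" using assms by (simp_all add: carrier_Cons)
  then consider "i = FreeMonIdx" | "i = FreeGrpIdx" | j where "i = FinIdx j" "j \<in> {1..k}" by auto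
  then show ?thesis
  proof cases
    case 1
    then obtain ss where ss: "g = FreeMonElt ss" "set ss \<subseteq> S"
      using ig(2) by (auto simp: copy_carrier free_monoid_def)
    then have "ss \<noteq> []" using ig(3) 1 factor_one by auto
    then show ?thesis using mon 1 ss by (cases ss) auto
  next
    case 2
    then obtain ts where ts: "g = FreeGrpElt ts" "set ts \<subseteq> T \<times> UNIV" "fg_reduced ts"
      using ig(2) by (auto simp: copy_carrier carrier_free_group)
    then have "ts \<noteq> []" using ig(3) 2 factor_one by auto
    then show ?thesis using grp 2 ts by (cases ts) auto
  next
    case 3
    then obtain x where "g = FinElt x" "x \<in> carrier (M j)"
      using ig(2) by (auto simp: copy_carrier)
    then show ?thesis using fin 3 ig(3) by (simp add: copy_one)
  qed
qed

lemma gens_carrier: "\<Sigma> \<subseteq> carrier X"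
proof
  have Nil: "[] \<in> carrier X" by (simp add: plain_monoid_def)
  fix a assume "a \<in> \<Sigma>"
  then show "a \<in> carrier X"
    by (cases rule: gens_cases)
      (use Nil in \<open>auto simp: carrier_Cons copy_carrier copy_one free_monoid_def carrier_free_group fg_reduced_Cons,
        auto simp: free_group_def\<close>)
qed

lemma mult_letters:
  "i \<noteq> j \<Longrightarrow> [(i, g)] \<in> \<Sigma> \<Longrightarrow> [(i, g)] \<otimes>\<^bsub>X\<^esub> [(j, h)] = [(i, g), (j, h)]"
  "s \<in> S \<Longrightarrow> s' \<in> S \<Longrightarrow> [(FreeMonIdx, FreeMonElt [s])] \<otimes>\<^bsub>X\<^esub> [(FreeMonIdx, FreeMonElt [s'])]
     = [(FreeMonIdx, FreeMonElt [s, s'])]"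
  "t \<in> T \<Longrightarrow> t' \<in> T \<Longrightarrow> [(FreeGrpIdx, FreeGrpElt [(t, \<beta>)])] \<otimes>\<^bsub>X\<^esub> [(FreeGrpIdx, FreeGrpElt [(t', \<beta>')])]
     = (if t = t' \<and> \<beta> \<noteq> \<beta>' then [] else [(FreeGrpIdx, FreeGrpElt [(t, \<beta>), (t', \<beta>')])])"
  "x \<in> carrier (M l) \<Longrightarrow> y \<in> carrier (M l) \<Longrightarrow> x \<noteq> \<one>\<^bsub>M l\<^esub> \<Longrightarrow> [(FinIdx l, FinElt x)] \<otimes>\<^bsub>X\<^esub> [(FinIdx l, FinElt y)]
     = (if x \<otimes>\<^bsub>M l\<^esub> y = \<one>\<^bsub>M l\<^esub> then [] else [(FinIdx l, FinElt (x \<otimes>\<^bsub>M l\<^esub> y))])"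
proof -
  show "[(i, g)] \<otimes>\<^bsub>X\<^esub> [(j, h)] = [(i, g), (j, h)]" if "i \<noteq> j" "[(i, g)] \<in> \<Sigma>"
    using that gens_carrier by (auto simp: X_mult carrier_Cons)
qed (auto simp: X_mult factor_one factor_mult fg_reduced_Cons simp del: plain_factor.simps)

lemma letter_not_long: "[x, y] \<notin> \<Sigma>" "[(FreeMonIdx, FreeMonElt [s, s'])] \<notin> \<Sigma>"
  "[(FreeGrpIdx, FreeGrpElt [\<tau>, \<tau>'])] \<notin> \<Sigma>" "[] \<notin> \<Sigma>"
  by (auto simp: gens_iff)

text \<open>Letters of different factors, of the free monoid, or of the free group without being
  inverse have a product of normal-form length two; in a common finite factor the product is the
  unit or a letter.\<close>

lemma Next_iff:
  assumes a: "a \<in> \<Sigma>" and b: "b \<in> \<Sigma>"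
  shows "b \<in> Next X \<Sigma> a \<longleftrightarrow> \<not> clash a b"
proof -
  have diff: "b \<in> Next X \<Sigma> a \<and> \<not> clash a b" if "a = [(i, g)]" "b = [(j, h)]" "i \<noteq> j" for i j g h
    using that a b mult_letters(1)[of i j g h] by (auto simp: Next_def X_one letter_not_long clash_def)
  show ?thesis
    using a
  proof (cases rule: gens_cases)
    case (mon s)
    note mon' = this
    show ?thesis using b
    proof (cases rule: gens_cases)
      case (mon s')
      then show ?thesis using mon' b by (simp add: Next_def X_one mult_letters letter_not_long clash_def)
    qed (use diff mon' in auto)
  next
    case (grp t \<beta>)
    note grp' = this
    show ?thesis using b
    proof (cases rule: gens_cases)
      case (grp t' \<beta>')
      then show ?thesis using grp' b by (auto simp: Next_def X_one mult_letters letter_not_long clash_def)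
    qed (use diff grp' in auto)
  next
    case (fin i x)
    note fin' = this
    show ?thesis using b
    proof (cases rule: gens_cases)
      case (fin j y)
      show ?thesis
      proof (cases "i = j")
        case True
        interpret Group.monoid "M i" using M(1) fin' by blast
        have "x \<otimes>\<^bsub>M i\<^esub> y \<in> carrier (M i)" using m_closed[of x y] fin(2) fin'(2) True by simp
        then have "[(FinIdx i, FinElt (x \<otimes>\<^bsub>M i\<^esub> y))] \<in> \<Sigma>" if "x \<otimes>\<^bsub>M i\<^esub> y \<noteq> \<one>\<^bsub>M i\<^esub>"
          using that fin fin' True by (auto simp: gens_iff)
        then show ?thesis using fin fin' True by (auto simp: Next_def X_one mult_letters clash_def)
      qed (use diff fin fin' in auto)
    qed (use diff fin' in auto)
  qed
qed

lemma Next_commute: "a \<in> \<Sigma> \<Longrightarrow> b \<in> Next X \<Sigma> a \<Longrightarrow> a \<in> Next X \<Sigma> b"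
  using Next_iff[of a b] Next_iff[of b a] clash_sym[of b a] by (auto simp: Next_def)

text \<open>Inverse free generators multiply to the unit, so the product can be a letter only inside
  a finite factor, and there \<open>Next\<close> depends on the factor alone.\<close>

lemma Next_mult:
  assumes "a \<in> \<Sigma>" "b \<in> \<Sigma>" "a \<otimes>\<^bsub>X\<^esub> b \<in> \<Sigma>"
  shows "Next X \<Sigma> (a \<otimes>\<^bsub>X\<^esub> b) = Next X \<Sigma> b"
proof -
  have "clash a b" using Next_iff[OF assms(1,2)] assms by (auto simp: Next_def)
  then consider i x y where "a = [(FinIdx i, FinElt x)]" "b = [(FinIdx i, FinElt y)]"
    | t \<beta> where "a = [(FreeGrpIdx, FreeGrpElt [(t, \<beta>)])]" "b = [(FreeGrpIdx, FreeGrpElt [(t, \<not> \<beta>)])]"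
    unfolding clash_def by blast
  then show ?thesis
  proof cases
    case 1
    have xy: "x \<in> carrier (M i)" "x \<noteq> \<one>\<^bsub>M i\<^esub>" "y \<in> carrier (M i)" using assms(1,2) 1 by (auto simp: gens_iff)
    then have ab: "a \<otimes>\<^bsub>X\<^esub> b = [(FinIdx i, FinElt (x \<otimes>\<^bsub>M i\<^esub> y))]"
      using assms(3) unfolding 1 by (auto simp: mult_letters letter_not_long split: if_splits)
    have "clash (a \<otimes>\<^bsub>X\<^esub> b) c \<longleftrightarrow> clash b c" for c unfolding ab unfolding 1 by (auto simp: clash_def)
    then have "c \<in> Next X \<Sigma> (a \<otimes>\<^bsub>X\<^esub> b) \<longleftrightarrow> c \<in> Next X \<Sigma> b" if "c \<in> \<Sigma>" for c
      using Next_iff[OF assms(3) that] Next_iff[OF assms(2) that] by simp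
    then show ?thesis by (auto simp: Next_def)
  next
    case 2
    have "t \<in> T" using assms(1) 2 by (auto simp: gens_iff)
    then have "a \<otimes>\<^bsub>X\<^esub> b = []" unfolding 2 by (simp add: mult_letters)
    then show ?thesis using assms(3) letter_not_long by simp
  qed
qed

lemma plain_nf_Cons: "plain_nf (p # w) = letters_of p @ plain_nf w"
  by (simp add: plain_nf_def)

lemma hd_letters_of:
  assumes "(j, h) # w \<in> carrier X"
  obtains h' u where "letters_of (j, h) = [(j, h')] # u" "[(j, h')] \<in> \<Sigma>"
  using assms
proof (cases rule: carrier_Cons_cases)
  case (mon s ss)
  then show ?thesis using that by (simp add: gens_iff)
next
  case (grp \<tau> ts)
  then show ?thesis using that[of "FreeGrpElt [\<tau>]"] by (cases \<tau>) (auto simp: gens_iff)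
next
  case (fin l x)
  then show ?thesis using that by (auto simp: gens_iff)
qed

text \<open>Multiplication by \<open>a\<close> affects only the first syllable of \<open>x\<close>,
  and \<open>letter_act\<close> only inspects the first letter. The cases are thus a first syllable
  in another factor, or in the factor of \<open>a\<close>, for each of the three kinds of
  factor.\<close>

lemma plain_nf_letter:
  assumes a: "a \<in> \<Sigma>" and x: "x \<in> carrier X"
  shows "plain_nf (a \<otimes>\<^bsub>X\<^esub> x) = letter_act X \<Sigma> a (plain_nf x)"
proof -
  obtain i g where ig: "a = [(i, g)]" using gens_length[OF a] by (auto simp: length_Suc_conv)
  have la: "letters_of (i, g) = [a]" using a ig by (auto simp: gens_iff)
  have g1: "g \<noteq> \<one>\<^bsub>G i\<^esub>" using a gens_carrier unfolding ig by (auto simp: carrier_Cons)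
  show ?thesis
  proof (cases x)
    case Nil
    have "a \<otimes>\<^bsub>X\<^esub> [] = a" unfolding ig X_mult using g1 by simp
    then show ?thesis using la ig Nil by (simp add: plain_nf_def letter_act_def)
  next
    case (Cons p x')
    obtain j h where p: "p = (j, h)" by (cases p)
    have xc: "(j, h) # x' \<in> carrier X" using x Cons p by simp
    have x'1: "x' = [] \<or> fst (hd x') \<noteq> j" using xc by (simp add: carrier_Cons)
    show ?thesis
    proof (cases "i = j")
      case False
      obtain h' u where h': "letters_of (j, h) = [(j, h')] # u" using hd_letters_of[OF xc] by metis
      have "a \<otimes>\<^bsub>X\<^esub> x = (i, g) # x" unfolding ig X_mult Cons p using g1 False by simp
      moreover have "a \<otimes>\<^bsub>X\<^esub> [(j, h')] = [(i, g), (j, h')]" using False a unfolding ig by (rule mult_letters)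
      ultimately show ?thesis
        using la h' unfolding Cons p by (simp add: plain_nf_Cons letter_act_def letter_not_long X_one)
    next
      case True
      show ?thesis using xc
      proof (cases rule: carrier_Cons_cases)
        case (mon s ss)
        obtain s0 where s0: "s0 \<in> S" "g = FreeMonElt [s0]" using a ig mon True by (auto simp: gens_iff)
        have "a \<otimes>\<^bsub>X\<^esub> x = (FreeMonIdx, FreeMonElt (s0 # s # ss)) # x'"
          unfolding ig X_mult Cons p using mon s0 True
          by (simp add: factor_one factor_mult del: plain_factor.simps)
        moreover have "a \<otimes>\<^bsub>X\<^esub> [(FreeMonIdx, FreeMonElt [s])] = [(FreeMonIdx, FreeMonElt [s0, s])]"
          unfolding ig using True mon s0 by (simp add: mult_letters)
        ultimately show ?thesis
          using mon s0 True ig unfolding Cons p by (simp add: plain_nf_Cons letter_act_def letter_not_long X_one)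
      next
        case (grp \<tau> ts)
        obtain \<tau>0 where t0: "fst \<tau>0 \<in> T" "g = FreeGrpElt [\<tau>0]" using a ig grp True by (auto simp: gens_iff)
        have prod: "a \<otimes>\<^bsub>X\<^esub> x = (if fg_cons \<tau>0 (\<tau> # ts) = [] then x' else (FreeGrpIdx, FreeGrpElt (fg_cons \<tau>0 (\<tau> # ts))) # x')"
          unfolding ig X_mult Cons p using grp t0 True
          by (simp add: factor_one factor_mult mem_Times_iff del: plain_factor.simps fg_cons.simps)
        have ab: "a \<otimes>\<^bsub>X\<^esub> [(FreeGrpIdx, FreeGrpElt [\<tau>])]
            = (if fst \<tau>0 = fst \<tau> \<and> snd \<tau>0 \<noteq> snd \<tau> then [] else [(FreeGrpIdx, FreeGrpElt [\<tau>0, \<tau>])])"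
          unfolding ig using True grp t0 mult_letters(3)[of "fst \<tau>0" "fst \<tau>" "snd \<tau>0" "snd \<tau>"] by simp
        show ?thesis
        proof (cases "fst \<tau>0 = fst \<tau> \<and> snd \<tau>0 \<noteq> snd \<tau>")
          case inv: True
          then show ?thesis
            using prod ab grp unfolding Cons p by (simp add: plain_nf_Cons letter_act_def X_one)
        next
          case no: False
          then have "fg_cons \<tau>0 (\<tau> # ts) = \<tau>0 # \<tau> # ts" by auto
          then show ?thesis
            using prod ab grp t0 no ig True unfolding Cons p
            by (simp add: plain_nf_Cons letter_act_def X_one letter_not_long)
        qed
      next
        case (fin l y)
        obtain z where z: "z \<in> carrier (M l)" "z \<noteq> \<one>\<^bsub>M l\<^esub>" "g = FinElt z" using a ig fin True by (auto simp: gens_iff)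
        interpret Group.monoid "M l" using M(1) fin by blast
        have prod: "a \<otimes>\<^bsub>X\<^esub> x = (if z \<otimes>\<^bsub>M l\<^esub> y = \<one>\<^bsub>M l\<^esub> then x' else (FinIdx l, FinElt (z \<otimes>\<^bsub>M l\<^esub> y)) # x')"
          unfolding ig X_mult Cons p using fin z True
          by (simp add: factor_one factor_mult del: plain_factor.simps)
        have ab: "a \<otimes>\<^bsub>X\<^esub> [(FinIdx l, FinElt y)]
            = (if z \<otimes>\<^bsub>M l\<^esub> y = \<one>\<^bsub>M l\<^esub> then [] else [(FinIdx l, FinElt (z \<otimes>\<^bsub>M l\<^esub> y))])"
          unfolding ig using True fin z by (simp add: mult_letters)
        have "[(FinIdx l, FinElt (z \<otimes>\<^bsub>M l\<^esub> y))] \<in> \<Sigma>" if "z \<otimes>\<^bsub>M l\<^esub> y \<noteq> \<one>\<^bsub>M l\<^esub>"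
          using that fin z by (auto simp: gens_iff)
        then show ?thesis
          using prod ab fin unfolding Cons p by (auto simp: plain_nf_Cons letter_act_def X_one)
      qed
    qed
  qed
qed

sublocale word_normal_form X \<Sigma> plain_nf
proof -
  interpret X: Group.monoid X by (rule monoid_X)
  show "word_normal_form X \<Sigma> plain_nf"
    by unfold_locales
      (use finite_gens gens_carrier letter_not_long plain_nf_letter in \<open>auto simp: X_one plain_nf_def\<close>)
qed

text \<open>If \<open>Z\<close> is proper, each letter of \<open>Z\<close> clashes with each letter
  outside. One clashing pair \<open>a\<close>, \<open>b\<close> then confines all letters: they lie
  in one finite factor and \<open>X\<close> is finite, or they are a free generator and its inverse
  and \<open>X\<close> is the group of integers.\<close>

lemma Next_connected:
  assumes inf: "infinite (carrier X)" and not_Z: "\<not> X \<cong> integer_group"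
    and gen: "\<And>x. x \<in> carrier X \<Longrightarrow> \<exists>w. set w \<subseteq> \<Sigma> \<and> word_prod X w = x"
    and Z: "Z \<subseteq> \<Sigma>" "Z \<noteq> {}" "\<And>a. a \<in> Z \<Longrightarrow> Next X \<Sigma> a \<subseteq> Z"
  shows "Z = \<Sigma>"
proof (rule ccontr)
  assume "Z \<noteq> \<Sigma>"
  then obtain a b where a: "a \<in> Z" and b: "b \<in> \<Sigma>" "b \<notin> Z" using Z by blast
  have cl: "clash c d" if "c \<in> Z" "d \<in> \<Sigma>" "d \<notin> Z" for c d
    using Next_iff[of c d] Z that by blast
  have "clash a b" using cl[OF a b] .
  then consider i where "\<exists>x y. a = [(FinIdx i, FinElt x)] \<and> b = [(FinIdx i, FinElt y)]"
    | t \<beta> where "a = [(FreeGrpIdx, FreeGrpElt [(t, \<beta>)])]" "b = [(FreeGrpIdx, FreeGrpElt [(t, \<not> \<beta>)])]"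
    unfolding clash_def by blast
  then show False
  proof cases
    case 1
    have fin_letter: "\<exists>x. c = [(FinIdx i, FinElt x)]" if c: "c \<in> \<Sigma>" for c
    proof (cases "c \<in> Z")
      case True
      then show ?thesis using cl[OF _ b, of c] 1 by (auto simp: clash_def)
    next
      case False
      then show ?thesis using cl[OF a c] 1 by (auto simp: clash_def)
    qed
    have idx: "j = FinIdx i \<and> [(j, h)] \<in> \<Sigma>" if jh: "(j, h) # w \<in> carrier X" for j h w
    proof -
      obtain h' u where "letters_of (j, h) = [(j, h')] # u" "[(j, h')] \<in> \<Sigma>"
        using hd_letters_of[OF jh] by metis
      then have j: "j = FinIdx i" using fin_letter by blast
      show ?thesis using jh by (cases rule: carrier_Cons_cases) (use j in \<open>auto simp: gens_iff\<close>)
    qed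
    \<comment> \<open>All syllables belong to the factor \<open>i\<close>, while neighbouring
      syllables have distinct factors, so there is at most one.\<close>
    have "carrier X \<subseteq> insert [] \<Sigma>"
    proof
      fix x assume x: "x \<in> carrier X"
      show "x \<in> insert [] \<Sigma>"
      proof (cases x)
        case (Cons p w)
        obtain j h where p: "p = (j, h)" by (cases p)
        have jw: "w \<in> carrier X" "w = [] \<or> fst (hd w) \<noteq> j" using x Cons p by (simp_all add: carrier_Cons)
        have j: "j = FinIdx i" "[(j, h)] \<in> \<Sigma>" using idx x Cons p by auto
        have "w = []"
        proof (cases w)
          case (Cons q w')
          then show ?thesis using jw j idx[of "fst q" "snd q" w'] by simp
        qed
        then show ?thesis using Cons p j by simp
      qed simp
    qed
    then show False using inf finite_gens finite_subset by blast
  next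
    case 2
    have t: "t \<in> T" using a Z(1) 2 by (auto simp: gens_iff)
    have "c = a \<or> c = b" if c: "c \<in> \<Sigma>" for c
    proof (cases "c \<in> Z")
      case True
      then show ?thesis using cl[OF _ b, of c] 2 by (auto simp: clash_def)
    next
      case False
      then show ?thesis using cl[OF a c] 2 by (auto simp: clash_def)
    qed
    then have "\<Sigma> = {a, b}" using a b Z by blast
    moreover have "a \<noteq> b" using a b by blast
    moreover have "a \<otimes>\<^bsub>X\<^esub> b = \<one>\<^bsub>X\<^esub>" "b \<otimes>\<^bsub>X\<^esub> a = \<one>\<^bsub>X\<^esub>"
      unfolding 2 using t by (simp_all add: mult_letters X_one)
    moreover have "a \<otimes>\<^bsub>X\<^esub> a \<notin> \<Sigma> \<union> {\<one>\<^bsub>X\<^esub>}" "b \<otimes>\<^bsub>X\<^esub> b \<notin> \<Sigma> \<union> {\<one>\<^bsub>X\<^esub>}"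
      unfolding 2 using t by (simp_all add: mult_letters X_one letter_not_long)
    ultimately have "X \<cong> integer_group" using iso_integer_groupI[of a b] gen by blast
    then show False using not_Z by simp
  qed
qed

lemma normal_form:
  assumes inf: "infinite (carrier X)" and not_Z: "\<not> X \<cong> integer_group"
    and supp: "set_pmf \<nu> \<subseteq> \<Sigma>" and gen: "generates X (set_pmf \<nu>)"
  shows "zero_automatic_normal_form X \<Sigma> \<nu> plain_nf"
proof -
  have word: "\<exists>w. set w \<subseteq> \<Sigma> \<and> word_prod X w = x" if "x \<in> carrier X" for x
  proof -
    have "x \<in> word_prod X ` lists (set_pmf \<nu>)" using gen that by (simp add: generates_def)
    then show ?thesis using supp by (auto simp: in_lists_conv_set)
  qed
  have "zero_automatic X \<Sigma> \<nu>"
    by (rule zero_automaticI[OF Next_commute Next_mult Next_connected[OF inf not_Z word] inf supp gen])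
  then show ?thesis
    unfolding zero_automatic_normal_form_def using word_normal_form_axioms by (rule conjI)
qed

end

lemma plain_triple_normal_form:
  assumes "plain_triple X \<Sigma> \<nu>"
  shows "zero_automatic_normal_form X \<Sigma> \<nu> plain_nf"
proof -
  obtain S T k M where SM: "finite S" "finite T"
    "\<And>i. i \<in> {1..k} \<Longrightarrow> Group.monoid (M i)" "\<And>i. i \<in> {1..k} \<Longrightarrow> finite (carrier (M i))"
    and X: "X = plain_monoid S T k M" and \<Sigma>: "\<Sigma> = plain_gens S T k M"
    using assms unfolding plain_triple_def by blast
  have "plain S T k M" by (rule plain.intro[OF SM])
  then show ?thesis
    using assms unfolding X \<Sigma> plain_triple_def by (intro plain.normal_form) blast+
qed

theorem mainTheorem9:
  fixes X :: "('s, 't, 'x) plain_elt monoid" and \<Sigma> :: "('s, 't, 'x) plain_elt set"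
    and \<nu> :: "('s, 't, 'x) plain_elt pmf" and lam \<mu> \<gamma> :: real
  assumes "plain_triple X \<Sigma> \<nu>" and "lam > 0" and "\<mu> > 0"
    and "is_drift X \<Sigma> \<nu> \<gamma>" and "lam * \<gamma> < \<mu>"
  shows "(\<exists>!(\<rho>, r). admissible_solution X \<Sigma> \<nu> lam \<mu> \<rho> r)
       \<and> (\<exists>!r. r \<in> simplex_int \<Sigma> \<and>
            (\<exists>\<rho>>0. null_vector (normal_words X \<Sigma>) (product_form X \<Sigma> \<rho> r)
                      (queue_generator X \<Sigma> \<nu> r lam \<mu>)))"
  using zero_automatic_normal_form.unique_solutions[OF plain_triple_normal_form[OF assms(1)] assms(4,2,3,5)] .

end
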